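(* Let $m\ge1$, let $Br_m$ be the Brauer monoid, with group of units $S_m$, and let $$e=\frac1{m!}\sum_{\sigma\in S_m}\mathrm{sgn}(\sigma)\,\sigma\in\mathbb CBr_m.$$ Then $\mathbb CBr_m\,e\cong\mathrm{Ind}(V_{\mathrm{sgn}})$ as left $\mathbb CBr_m$-modules, where $V_{\mathrm{sgn}}$ is the sign representation of $S_m$, and $\mathbb CBr_m$ satisfies the group-injective condition.
   Context: $Br_m$ is the monoid of perfect matchings of $m$ top and $m$ bottom vertices; the product $xy$ stacks $x$ on top of $y$, identifying the bottom vertices of $x$ with the top vertices of $y$, and removes closed components. Its units are the matchings in which every block joins a top and a bottom vertex, identified with $S_m$. For a monoid $M$ with group of units $G$ and a $kG$-module $W$, $\mathrm{Ind}(W)$ is the $kM$-module with underlying space $W$ on which $G$ acts as given and $M\setminus G$ acts as $0$. Group-injective condition for $kM$: there is a projective indecomposable $kG$-module $P$ such that $\mathrm{Ind}(P)$ is an injective $kM$-module. *)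

theory Defs
  imports Complex_Main "HOL-Algebra.Algebra"
begin

section \<open>Left modules over a possibly noncommutative ring\<close>

text \<open>The library locale \<open>module\<close> requires a commutative ring of scalars. The following is the
  same list of axioms over an arbitrary ring; the record type of modules and the locale
  \<open>submodule\<close> (which does not require commutativity) are those of the library.
  The fields \<open>mult\<close> and \<open>one\<close> of a module record carry no meaning.\<close>

locale left_module = R?: ring R + M?: abelian_group M
  for R :: "('a, 'c) ring_scheme" (structure) and M :: "('a, 'b) module" (structure) +
  assumes smult_closed [simp, intro]:
      "\<lbrakk>r \<in> carrier R; x \<in> carrier M\<rbrakk> \<Longrightarrow> r \<odot>\<^bsub>M\<^esub> x \<in> carrier M"
    and smult_l_distr:
      "\<lbrakk>r \<in> carrier R; s \<in> carrier R; x \<in> carrier M\<rbrakk> \<Longrightarrow>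
        (r \<oplus>\<^bsub>R\<^esub> s) \<odot>\<^bsub>M\<^esub> x = r \<odot>\<^bsub>M\<^esub> x \<oplus>\<^bsub>M\<^esub> s \<odot>\<^bsub>M\<^esub> x"
    and smult_r_distr:
      "\<lbrakk>r \<in> carrier R; x \<in> carrier M; y \<in> carrier M\<rbrakk> \<Longrightarrow>
        r \<odot>\<^bsub>M\<^esub> (x \<oplus>\<^bsub>M\<^esub> y) = r \<odot>\<^bsub>M\<^esub> x \<oplus>\<^bsub>M\<^esub> r \<odot>\<^bsub>M\<^esub> y"
    and smult_assoc1:
      "\<lbrakk>r \<in> carrier R; s \<in> carrier R; x \<in> carrier M\<rbrakk> \<Longrightarrow>
        (r \<otimes>\<^bsub>R\<^esub> s) \<odot>\<^bsub>M\<^esub> x = r \<odot>\<^bsub>M\<^esub> (s \<odot>\<^bsub>M\<^esub> x)"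
    and smult_one [simp]: "x \<in> carrier M \<Longrightarrow> \<one>\<^bsub>R\<^esub> \<odot>\<^bsub>M\<^esub> x = x"

definition left_module_hom ::
    "('a, 'c) ring_scheme \<Rightarrow> ('a, 'b) module \<Rightarrow> ('a, 'd) module \<Rightarrow> ('b \<Rightarrow> 'd) set" where
  "left_module_hom R M N =
    {h \<in> carrier M \<rightarrow> carrier N.
      (\<forall>x\<in>carrier M. \<forall>y\<in>carrier M. h (x \<oplus>\<^bsub>M\<^esub> y) = h x \<oplus>\<^bsub>N\<^esub> h y) \<and>
      (\<forall>r\<in>carrier R. \<forall>x\<in>carrier M. h (r \<odot>\<^bsub>M\<^esub> x) = r \<odot>\<^bsub>N\<^esub> h x)}"

definition left_module_isomorphic ::
    "('a, 'c) ring_scheme \<Rightarrow> ('a, 'b) module \<Rightarrow> ('a, 'd) module \<Rightarrow> bool" where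
  "left_module_isomorphic R M N \<longleftrightarrow>
    left_module R M \<and> left_module R N \<and>
    (\<exists>h \<in> left_module_hom R M N. bij_betw h (carrier M) (carrier N))"

definition regular_module :: "('a, 'c) ring_scheme \<Rightarrow> ('a, 'a) module" where
  "regular_module R =
    \<lparr>carrier = carrier R, monoid.mult = monoid.mult R, one = \<one>\<^bsub>R\<^esub>, ring.zero = \<zero>\<^bsub>R\<^esub>,
     add = add R, smult = monoid.mult R\<rparr>"

definition principal_left_ideal :: "('a, 'c) ring_scheme \<Rightarrow> 'a \<Rightarrow> ('a, 'a) module" where
  "principal_left_ideal R a = (regular_module R)\<lparr>carrier := {r \<otimes>\<^bsub>R\<^esub> a |r. r \<in> carrier R}\<rparr>"

definition indecomposable_module :: "('a, 'c) ring_scheme \<Rightarrow> ('a, 'b) module \<Rightarrow> bool" where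
  "indecomposable_module R M \<longleftrightarrow>
    left_module R M \<and> carrier M \<noteq> {\<zero>\<^bsub>M\<^esub>} \<and>
    (\<forall>H K. submodule H R M \<and> submodule K R M \<and>
       H \<inter> K = {\<zero>\<^bsub>M\<^esub>} \<and> H <+>\<^bsub>M\<^esub> K = carrier M \<longrightarrow>
       H = {\<zero>\<^bsub>M\<^esub>} \<or> K = {\<zero>\<^bsub>M\<^esub>})"

text \<open>A quantifier inside a definition ranges over modules whose elements have one fixed type.
  For injectivity that type is the element type of the ring. By Baer's criterion this entails the
  extension property for modules over arbitrary types: see \<open>injective_moduleD\<close> below.\<close>

definition injective_module :: "('a, 'c) ring_scheme \<Rightarrow> ('a, 'b) module \<Rightarrow> bool" where
  "injective_module R I \<longleftrightarrow>
    left_module R I \<and>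
    (\<forall>(A :: ('a, 'a) module) (B :: ('a, 'a) module) j f.
       left_module R A \<and> left_module R B \<and>
       j \<in> left_module_hom R A B \<and> inj_on j (carrier A) \<and> f \<in> left_module_hom R A I \<longrightarrow>
       (\<exists>g \<in> left_module_hom R B I. \<forall>a\<in>carrier A. g (j a) = f a))"

text \<open>For projectivity the type of \<open>B\<close> is large enough to contain a free module mapping onto
  \<open>P\<close>. This entails the lifting property for modules over arbitrary types: see
  \<open>projective_moduleD\<close> below.\<close>

definition projective_module :: "('a, 'c) ring_scheme \<Rightarrow> ('a, 'b) module \<Rightarrow> bool" where
  "projective_module R P \<longleftrightarrow>
    left_module R P \<and>
    (\<forall>(B :: ('a, 'b \<Rightarrow> 'a) module) (C :: ('a, 'b) module) q f.
       left_module R B \<and> left_module R C \<and>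
       q \<in> left_module_hom R B C \<and> q ` carrier B = carrier C \<and> f \<in> left_module_hom R P C \<longrightarrow>
       (\<exists>g \<in> left_module_hom R P B. \<forall>x\<in>carrier P. q (g x) = f x))"


subsection \<open>Independence of the type of the test modules\<close>

lemma left_module_homD:
  assumes "h \<in> left_module_hom R M N"
  shows "\<And>x. x \<in> carrier M \<Longrightarrow> h x \<in> carrier N"
    and "\<And>x y. \<lbrakk>x \<in> carrier M; y \<in> carrier M\<rbrakk> \<Longrightarrow> h (x \<oplus>\<^bsub>M\<^esub> y) = h x \<oplus>\<^bsub>N\<^esub> h y"
    and "\<And>r x. \<lbrakk>r \<in> carrier R; x \<in> carrier M\<rbrakk> \<Longrightarrow> h (r \<odot>\<^bsub>M\<^esub> x) = r \<odot>\<^bsub>N\<^esub> h x"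
  using assms unfolding left_module_hom_def by auto

lemma left_module_homI:
  assumes "\<And>x. x \<in> carrier M \<Longrightarrow> h x \<in> carrier N"
    and "\<And>x y. \<lbrakk>x \<in> carrier M; y \<in> carrier M\<rbrakk> \<Longrightarrow> h (x \<oplus>\<^bsub>M\<^esub> y) = h x \<oplus>\<^bsub>N\<^esub> h y"
    and "\<And>r x. \<lbrakk>r \<in> carrier R; x \<in> carrier M\<rbrakk> \<Longrightarrow> h (r \<odot>\<^bsub>M\<^esub> x) = r \<odot>\<^bsub>N\<^esub> h x"
  shows "h \<in> left_module_hom R M N"
  using assms unfolding left_module_hom_def by auto

context left_module
begin

lemma smult_l_null [simp]: assumes "x \<in> carrier M" shows "\<zero>\<^bsub>R\<^esub> \<odot>\<^bsub>M\<^esub> x = \<zero>\<^bsub>M\<^esub>"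
proof -
  have "\<zero>\<^bsub>R\<^esub> \<odot>\<^bsub>M\<^esub> x \<oplus>\<^bsub>M\<^esub> \<zero>\<^bsub>R\<^esub> \<odot>\<^bsub>M\<^esub> x = \<zero>\<^bsub>R\<^esub> \<odot>\<^bsub>M\<^esub> x"
    using smult_l_distr[of "\<zero>\<^bsub>R\<^esub>" "\<zero>\<^bsub>R\<^esub>" x] assms by simp
  then show ?thesis
    using assms by (metis M.add.r_cancel_one' R.zero_closed smult_closed)
qed

lemma smult_l_minus:
  assumes "r \<in> carrier R" "x \<in> carrier M"
  shows "(\<ominus>\<^bsub>R\<^esub> r) \<odot>\<^bsub>M\<^esub> x = \<ominus>\<^bsub>M\<^esub> (r \<odot>\<^bsub>M\<^esub> x)"
proof -
  have "(\<ominus>\<^bsub>R\<^esub> r) \<odot>\<^bsub>M\<^esub> x \<oplus>\<^bsub>M\<^esub> r \<odot>\<^bsub>M\<^esub> x = \<zero>\<^bsub>M\<^esub>"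
    using smult_l_distr[of "\<ominus>\<^bsub>R\<^esub> r" r x] assms by (simp add: R.l_neg)
  then show ?thesis
    using assms by (metis M.minus_equality R.a_inv_closed smult_closed)
qed

end

lemma left_ideal_left_module:
  fixes R (structure)
  assumes "ring R" and L: "L \<subseteq> carrier R" "\<zero>\<^bsub>R\<^esub> \<in> L"
    "\<And>x y. \<lbrakk>x \<in> L; y \<in> L\<rbrakk> \<Longrightarrow> x \<oplus>\<^bsub>R\<^esub> y \<in> L"
    "\<And>r x. \<lbrakk>r \<in> carrier R; x \<in> L\<rbrakk> \<Longrightarrow> r \<otimes>\<^bsub>R\<^esub> x \<in> L"
  shows "left_module R ((regular_module R)\<lparr>carrier := L\<rparr>)"
proof -
  interpret R: ring R by fact
  have neg: "\<ominus>\<^bsub>R\<^esub> x \<in> L" if "x \<in> L" for x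
    using L(4)[of "\<ominus>\<^bsub>R\<^esub> \<one>\<^bsub>R\<^esub>" x] that L(1) by (auto simp: R.l_minus subsetD)
  show ?thesis
    unfolding left_module_def left_module_axioms_def
  proof (intro conjI)
    show "abelian_group ((regular_module R)\<lparr>carrier := L\<rparr>)"
    proof (rule abelian_groupI)
      fix x assume "x \<in> carrier ((regular_module R)\<lparr>carrier := L\<rparr>)"
      then have "x \<in> L" by (simp add: regular_module_def)
      then show "\<exists>y\<in>carrier ((regular_module R)\<lparr>carrier := L\<rparr>).
        y \<oplus>\<^bsub>(regular_module R)\<lparr>carrier := L\<rparr>\<^esub> x = \<zero>\<^bsub>(regular_module R)\<lparr>carrier := L\<rparr>\<^esub>"
        using neg[of x] L(1) by (intro bexI[of _ "\<ominus>\<^bsub>R\<^esub> x"]) (auto simp: regular_module_def R.l_neg)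
    qed (use L in \<open>auto simp: regular_module_def R.a_ac subset_iff\<close>)
  qed (use L R.ring_axioms in
      \<open>auto simp: regular_module_def R.l_distr R.r_distr R.m_assoc subset_iff\<close>)
qed

lemma regular_left_module: "ring R \<Longrightarrow> left_module R (regular_module R)"
  using left_ideal_left_module[of R "carrier R"]
  by (simp add: ring.ring_simprules regular_module_def)

theorem injective_moduleD:
  fixes R :: "('a, 'c) ring_scheme" and I :: "('a, 'b) module"
    and A :: "('a, 'u) module" and B :: "('a, 'v) module"
  assumes inj: "injective_module R I"
    and "left_module R A" "left_module R B"
    and j: "j \<in> left_module_hom R A B" "inj_on j (carrier A)"
    and f: "f \<in> left_module_hom R A I"
  shows "\<exists>g \<in> left_module_hom R B I. \<forall>a\<in>carrier A. g (j a) = f a"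
proof -
  interpret I: left_module R I using inj by (simp add: injective_module_def)
  interpret A: left_module R A by fact
  interpret B: left_module R B by fact
  note jD = left_module_homD[OF j(1)] and fD = left_module_homD[OF f]
  define F where "F = {S. S \<subseteq> carrier B \<times> carrier I \<and> (\<lambda>a. (j a, f a)) ` carrier A \<subseteq> S \<and>
    single_valued S \<and>
    (\<forall>x y x' y'. (x, y) \<in> S \<and> (x', y') \<in> S \<longrightarrow> (x \<oplus>\<^bsub>B\<^esub> x', y \<oplus>\<^bsub>I\<^esub> y') \<in> S) \<and>
    (\<forall>r x y. r \<in> carrier R \<and> (x, y) \<in> S \<longrightarrow> (r \<odot>\<^bsub>B\<^esub> x, r \<odot>\<^bsub>I\<^esub> y) \<in> S)}"
  have "(\<lambda>a. (j a, f a)) ` carrier A \<in> F"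
    unfolding F_def mem_Collect_eq
  proof (intro conjI allI impI)
    show "single_valued ((\<lambda>a. (j a, f a)) ` carrier A)"
      using j(2) by (auto simp: single_valued_def inj_on_def)
  next
    fix x y x' y'
    assume "(x, y) \<in> (\<lambda>a. (j a, f a)) ` carrier A \<and> (x', y') \<in> (\<lambda>a. (j a, f a)) ` carrier A"
    then obtain a a' where "a \<in> carrier A" "a' \<in> carrier A" "x = j a" "y = f a" "x' = j a'" "y' = f a'"
      by auto
    then show "(x \<oplus>\<^bsub>B\<^esub> x', y \<oplus>\<^bsub>I\<^esub> y') \<in> (\<lambda>a. (j a, f a)) ` carrier A"
      by (intro image_eqI[of _ _ "a \<oplus>\<^bsub>A\<^esub> a'"]) (auto simp: jD fD)
  next
    fix r x y
    assume "r \<in> carrier R \<and> (x, y) \<in> (\<lambda>a. (j a, f a)) ` carrier A"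
    then obtain a where "r \<in> carrier R" "a \<in> carrier A" "x = j a" "y = f a" by auto
    then show "(r \<odot>\<^bsub>B\<^esub> x, r \<odot>\<^bsub>I\<^esub> y) \<in> (\<lambda>a. (j a, f a)) ` carrier A"
      by (intro image_eqI[of _ _ "r \<odot>\<^bsub>A\<^esub> a"]) (auto simp: jD fD)
  qed (auto simp: jD fD)
  moreover have "\<Union>C \<in> F" if "C \<noteq> {}" "subset.chain F C" for C
  proof -
    have CF: "C \<subseteq> F" and lin: "\<And>S T. \<lbrakk>S \<in> C; T \<in> C\<rbrakk> \<Longrightarrow> S \<subseteq> T \<or> T \<subseteq> S"
      using that(2) by (auto simp: subset_chain_def)
    have two: "\<exists>S\<in>C. p \<in> S \<and> q \<in> S" if "p \<in> \<Union>C" "q \<in> \<Union>C" for p q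
      using that lin by (meson UnionE subsetD)
    have CD: "\<And>S. S \<in> C \<Longrightarrow> S \<subseteq> carrier B \<times> carrier I"
      "\<And>S. S \<in> C \<Longrightarrow> (\<lambda>a. (j a, f a)) ` carrier A \<subseteq> S"
      "\<And>S. S \<in> C \<Longrightarrow> single_valued S"
      "\<And>S x y x' y'. \<lbrakk>S \<in> C; (x, y) \<in> S; (x', y') \<in> S\<rbrakk> \<Longrightarrow> (x \<oplus>\<^bsub>B\<^esub> x', y \<oplus>\<^bsub>I\<^esub> y') \<in> S"
      "\<And>S r x y. \<lbrakk>S \<in> C; r \<in> carrier R; (x, y) \<in> S\<rbrakk> \<Longrightarrow> (r \<odot>\<^bsub>B\<^esub> x, r \<odot>\<^bsub>I\<^esub> y) \<in> S"
      using CF unfolding F_def by blast+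
    show ?thesis
      unfolding F_def mem_Collect_eq
    proof (intro conjI allI impI)
      show "\<Union>C \<subseteq> carrier B \<times> carrier I" using CD(1) by blast
      show "(\<lambda>a. (j a, f a)) ` carrier A \<subseteq> \<Union>C" using CD(2) that(1) by blast
      show "single_valued (\<Union>C)"
        unfolding single_valued_def using two CD(3) by (metis single_valuedD)
    next
      fix x y x' y' assume "(x, y) \<in> \<Union>C \<and> (x', y') \<in> \<Union>C"
      then obtain S where "S \<in> C" "(x, y) \<in> S" "(x', y') \<in> S" using two by blast
      then show "(x \<oplus>\<^bsub>B\<^esub> x', y \<oplus>\<^bsub>I\<^esub> y') \<in> \<Union>C" using CD(4) by blast
    next
      fix r x y assume "r \<in> carrier R \<and> (x, y) \<in> \<Union>C"
      then show "(r \<odot>\<^bsub>B\<^esub> x, r \<odot>\<^bsub>I\<^esub> y) \<in> \<Union>C" using CD(5) by blast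
    qed
  qed
  ultimately obtain S where "S \<in> F" and max: "\<And>T. \<lbrakk>T \<in> F; S \<subseteq> T\<rbrakk> \<Longrightarrow> T = S"
    using subset_Zorn_nonempty[of F] by blast
  then have S: "S \<subseteq> carrier B \<times> carrier I" "(\<lambda>a. (j a, f a)) ` carrier A \<subseteq> S" "single_valued S"
    and add: "\<And>x y x' y'. \<lbrakk>(x, y) \<in> S; (x', y') \<in> S\<rbrakk> \<Longrightarrow> (x \<oplus>\<^bsub>B\<^esub> x', y \<oplus>\<^bsub>I\<^esub> y') \<in> S"
    and smult: "\<And>r x y. \<lbrakk>r \<in> carrier R; (x, y) \<in> S\<rbrakk> \<Longrightarrow> (r \<odot>\<^bsub>B\<^esub> x, r \<odot>\<^bsub>I\<^esub> y) \<in> S"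
    unfolding F_def by blast+
  have SB: "\<And>x y. (x, y) \<in> S \<Longrightarrow> x \<in> carrier B" and SI: "\<And>x y. (x, y) \<in> S \<Longrightarrow> y \<in> carrier I"
    using S(1) by auto
  have zero: "(\<zero>\<^bsub>B\<^esub>, \<zero>\<^bsub>I\<^esub>) \<in> S"
  proof -
    obtain x y where "(x, y) \<in> S" using S(2) A.zero_closed by blast
    then show ?thesis using smult[of "\<zero>\<^bsub>R\<^esub>" x y] SB SI by simp
  qed
  have sub: "(x \<ominus>\<^bsub>B\<^esub> x', y \<ominus>\<^bsub>I\<^esub> y') \<in> S" if "(x, y) \<in> S" "(x', y') \<in> S" for x y x' y'
    using add[OF that(1) smult[of "\<ominus>\<^bsub>R\<^esub> \<one>\<^bsub>R\<^esub>", OF _ that(2)]] SB[OF that(2)] SI[OF that(2)]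
    by (simp add: B.smult_l_minus I.smult_l_minus a_minus_def)
  have total: "x \<in> Domain S" if x: "x \<in> carrier B" for x
  proof -
    define L where "L = {r \<in> carrier R. r \<odot>\<^bsub>B\<^esub> x \<in> Domain S}"
    define \<phi> where "\<phi> r = (THE y. (r \<odot>\<^bsub>B\<^esub> x, y) \<in> S)" for r
    have \<phi>eq: "\<phi> r = y" if "(r \<odot>\<^bsub>B\<^esub> x, y) \<in> S" for r y
      unfolding \<phi>_def using that S(3) by (auto dest: single_valuedD)
    have \<phi>: "(r \<odot>\<^bsub>B\<^esub> x, \<phi> r) \<in> S" if "r \<in> L" for r
      using that \<phi>eq unfolding L_def by blast
    let ?L = "(regular_module R)\<lparr>carrier := L\<rparr>"
    have L1: "r \<oplus>\<^bsub>R\<^esub> s \<in> L" "\<phi> (r \<oplus>\<^bsub>R\<^esub> s) = \<phi> r \<oplus>\<^bsub>I\<^esub> \<phi> s" if "r \<in> L" "s \<in> L" for r s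
    proof -
      have "((r \<oplus>\<^bsub>R\<^esub> s) \<odot>\<^bsub>B\<^esub> x, \<phi> r \<oplus>\<^bsub>I\<^esub> \<phi> s) \<in> S"
        using add[OF \<phi>[OF that(1)] \<phi>[OF that(2)]] that x by (simp add: L_def B.smult_l_distr)
      then show "r \<oplus>\<^bsub>R\<^esub> s \<in> L" "\<phi> (r \<oplus>\<^bsub>R\<^esub> s) = \<phi> r \<oplus>\<^bsub>I\<^esub> \<phi> s"
        using that \<phi>eq by (auto simp: L_def)
    qed
    have L2: "r \<otimes>\<^bsub>R\<^esub> s \<in> L" "\<phi> (r \<otimes>\<^bsub>R\<^esub> s) = r \<odot>\<^bsub>I\<^esub> \<phi> s" if "r \<in> carrier R" "s \<in> L" for r s
    proof -
      have "((r \<otimes>\<^bsub>R\<^esub> s) \<odot>\<^bsub>B\<^esub> x, r \<odot>\<^bsub>I\<^esub> \<phi> s) \<in> S"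
        using smult[OF that(1) \<phi>[OF that(2)]] that x by (simp add: L_def B.smult_assoc1)
      then show "r \<otimes>\<^bsub>R\<^esub> s \<in> L" "\<phi> (r \<otimes>\<^bsub>R\<^esub> s) = r \<odot>\<^bsub>I\<^esub> \<phi> s"
        using that \<phi>eq by (auto simp: L_def)
    qed
    have "left_module R ?L"
      by (rule left_ideal_left_module[OF I.R.ring_axioms])
        (use L1(1) L2(1) zero x in \<open>auto simp: L_def intro: DomainI\<close>)
    moreover have "left_module R (regular_module R)"
      by (rule regular_left_module[OF I.R.ring_axioms])
    moreover have "id \<in> left_module_hom R ?L (regular_module R)"
      by (rule left_module_homI) (auto simp: regular_module_def L_def)
    moreover have "\<phi> \<in> left_module_hom R ?L I"
      by (rule left_module_homI) (use \<phi> SI L1 L2 in \<open>auto simp: regular_module_def\<close>)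
    ultimately obtain g where g: "g \<in> left_module_hom R (regular_module R) I"
      and g\<phi>: "\<And>r. r \<in> L \<Longrightarrow> g r = \<phi> r"
      using inj[unfolded injective_module_def, THEN conjunct2, rule_format, of ?L "regular_module R" id \<phi>]
      by auto
    define w where "w = g \<one>\<^bsub>R\<^esub>"
    note gD = left_module_homD[OF g, unfolded regular_module_def, simplified]
    have w: "w \<in> carrier I" by (simp add: w_def gD)
    have gw: "g r = r \<odot>\<^bsub>I\<^esub> w" if "r \<in> carrier R" for r
      using gD(3)[OF that I.R.one_closed] that by (simp add: w_def)
    define T where "T = {(b \<oplus>\<^bsub>B\<^esub> r \<odot>\<^bsub>B\<^esub> x, c \<oplus>\<^bsub>I\<^esub> r \<odot>\<^bsub>I\<^esub> w) |b c r. (b, c) \<in> S \<and> r \<in> carrier R}"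
    have ST: "S \<subseteq> T"
    proof clarify
      fix b c assume "(b, c) \<in> S"
      moreover have "(b, c) = (b \<oplus>\<^bsub>B\<^esub> \<zero>\<^bsub>R\<^esub> \<odot>\<^bsub>B\<^esub> x, c \<oplus>\<^bsub>I\<^esub> \<zero>\<^bsub>R\<^esub> \<odot>\<^bsub>I\<^esub> w)"
        using SB SI calculation x w by simp
      ultimately show "(b, c) \<in> T" unfolding T_def using I.R.zero_closed by blast
    qed
    have "T \<in> F"
      unfolding F_def mem_Collect_eq
    proof (intro conjI allI impI)
      show "T \<subseteq> carrier B \<times> carrier I" using SB SI x w unfolding T_def by auto
      show "(\<lambda>a. (j a, f a)) ` carrier A \<subseteq> T" using S(2) ST by blast
      show "single_valued T"
      proof (rule single_valuedI)
        fix p q q' assume "(p, q) \<in> T" "(p, q') \<in> T"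
        then obtain b c r b' c' r' where
          1: "(b, c) \<in> S" "r \<in> carrier R" "p = b \<oplus>\<^bsub>B\<^esub> r \<odot>\<^bsub>B\<^esub> x" "q = c \<oplus>\<^bsub>I\<^esub> r \<odot>\<^bsub>I\<^esub> w" and
          2: "(b', c') \<in> S" "r' \<in> carrier R" "p = b' \<oplus>\<^bsub>B\<^esub> r' \<odot>\<^bsub>B\<^esub> x" "q' = c' \<oplus>\<^bsub>I\<^esub> r' \<odot>\<^bsub>I\<^esub> w"
          unfolding T_def by blast
        note c = SB[OF 1(1)] SB[OF 2(1)] SI[OF 1(1)] SI[OF 2(1)] 1(2) 2(2) x w
        have "(r \<ominus>\<^bsub>R\<^esub> r') \<odot>\<^bsub>B\<^esub> x = r \<odot>\<^bsub>B\<^esub> x \<ominus>\<^bsub>B\<^esub> r' \<odot>\<^bsub>B\<^esub> x"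
          using c by (simp add: a_minus_def B.smult_l_distr B.smult_l_minus)
        also have "\<dots> = (p \<ominus>\<^bsub>B\<^esub> b) \<ominus>\<^bsub>B\<^esub> (p \<ominus>\<^bsub>B\<^esub> b')"
        proof -
          have "p \<ominus>\<^bsub>B\<^esub> b = r \<odot>\<^bsub>B\<^esub> x" unfolding 1(3) using c
            by (simp add: a_minus_def B.add.m_ac B.M.r_neg1 B.M.r_neg B.M.r_neg2)
          moreover have "p \<ominus>\<^bsub>B\<^esub> b' = r' \<odot>\<^bsub>B\<^esub> x" unfolding 2(3) using c
            by (simp add: a_minus_def B.add.m_ac B.M.r_neg1 B.M.r_neg B.M.r_neg2)
          ultimately show ?thesis by simp
        qed
        also have "\<dots> = b' \<ominus>\<^bsub>B\<^esub> b"
        proof -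
          have p: "p \<in> carrier B" using 1(3) c by simp
          have "(p \<ominus>\<^bsub>B\<^esub> b) \<ominus>\<^bsub>B\<^esub> (p \<ominus>\<^bsub>B\<^esub> b') = (p \<ominus>\<^bsub>B\<^esub> p) \<oplus>\<^bsub>B\<^esub> (b' \<ominus>\<^bsub>B\<^esub> b)"
            using p c by (simp add: a_minus_def B.M.minus_add B.add.m_ac)
          then show ?thesis using p c by (simp add: a_minus_def B.M.r_neg)
        qed
        finally have "((r \<ominus>\<^bsub>R\<^esub> r') \<odot>\<^bsub>B\<^esub> x, c' \<ominus>\<^bsub>I\<^esub> c) \<in> S" using sub[OF 2(1) 1(1)] by simp
        then have "r \<ominus>\<^bsub>R\<^esub> r' \<in> L" "\<phi> (r \<ominus>\<^bsub>R\<^esub> r') = c' \<ominus>\<^bsub>I\<^esub> c"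
          using c \<phi>eq by (auto simp: L_def a_minus_def)
        then have "(r \<ominus>\<^bsub>R\<^esub> r') \<odot>\<^bsub>I\<^esub> w = c' \<ominus>\<^bsub>I\<^esub> c"
          using g\<phi> gw c by (metis I.R.minus_closed)
        then have "r \<odot>\<^bsub>I\<^esub> w \<ominus>\<^bsub>I\<^esub> r' \<odot>\<^bsub>I\<^esub> w = c' \<ominus>\<^bsub>I\<^esub> c"
          using c by (simp add: a_minus_def I.smult_l_distr I.smult_l_minus)
        then have "c \<oplus>\<^bsub>I\<^esub> (r \<odot>\<^bsub>I\<^esub> w \<ominus>\<^bsub>I\<^esub> r' \<odot>\<^bsub>I\<^esub> w) \<oplus>\<^bsub>I\<^esub> r' \<odot>\<^bsub>I\<^esub> w = c \<oplus>\<^bsub>I\<^esub> (c' \<ominus>\<^bsub>I\<^esub> c) \<oplus>\<^bsub>I\<^esub> r' \<odot>\<^bsub>I\<^esub> w"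
          by simp
        moreover have "c \<oplus>\<^bsub>I\<^esub> (r \<odot>\<^bsub>I\<^esub> w \<ominus>\<^bsub>I\<^esub> r' \<odot>\<^bsub>I\<^esub> w) \<oplus>\<^bsub>I\<^esub> r' \<odot>\<^bsub>I\<^esub> w = q"
          unfolding 1(4) using c by (simp add: a_minus_def I.M.a_assoc I.M.l_neg)
        moreover have "c \<oplus>\<^bsub>I\<^esub> (c' \<ominus>\<^bsub>I\<^esub> c) = c'"
          using c by (simp add: a_minus_def I.add.m_ac I.M.r_neg I.M.r_neg1 I.M.r_neg2)
        ultimately show "q = q'" unfolding 2(4) by simp
      qed
    next
      fix p q p' q' assume "(p, q) \<in> T \<and> (p', q') \<in> T"
      then obtain b c r b' c' r' where
        1: "(b, c) \<in> S" "r \<in> carrier R" "p = b \<oplus>\<^bsub>B\<^esub> r \<odot>\<^bsub>B\<^esub> x" "q = c \<oplus>\<^bsub>I\<^esub> r \<odot>\<^bsub>I\<^esub> w" and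
        2: "(b', c') \<in> S" "r' \<in> carrier R" "p' = b' \<oplus>\<^bsub>B\<^esub> r' \<odot>\<^bsub>B\<^esub> x" "q' = c' \<oplus>\<^bsub>I\<^esub> r' \<odot>\<^bsub>I\<^esub> w"
        unfolding T_def by blast
      note c = SB[OF 1(1)] SB[OF 2(1)] SI[OF 1(1)] SI[OF 2(1)] 1(2) 2(2) x w
      have "p \<oplus>\<^bsub>B\<^esub> p' = (b \<oplus>\<^bsub>B\<^esub> b') \<oplus>\<^bsub>B\<^esub> (r \<oplus>\<^bsub>R\<^esub> r') \<odot>\<^bsub>B\<^esub> x"
        unfolding 1 2 using c by (simp add: B.smult_l_distr B.add.m_ac)
      moreover have "q \<oplus>\<^bsub>I\<^esub> q' = (c \<oplus>\<^bsub>I\<^esub> c') \<oplus>\<^bsub>I\<^esub> (r \<oplus>\<^bsub>R\<^esub> r') \<odot>\<^bsub>I\<^esub> w"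
        unfolding 1 2 using c by (simp add: I.smult_l_distr I.add.m_ac)
      ultimately show "(p \<oplus>\<^bsub>B\<^esub> p', q \<oplus>\<^bsub>I\<^esub> q') \<in> T"
        unfolding T_def using add[OF 1(1) 2(1)] I.R.a_closed[OF 1(2) 2(2)] by blast
    next
      fix s p q assume "s \<in> carrier R \<and> (p, q) \<in> T"
      then obtain b c r where s: "s \<in> carrier R" and
        1: "(b, c) \<in> S" "r \<in> carrier R" "p = b \<oplus>\<^bsub>B\<^esub> r \<odot>\<^bsub>B\<^esub> x" "q = c \<oplus>\<^bsub>I\<^esub> r \<odot>\<^bsub>I\<^esub> w"
        unfolding T_def by blast
      note c = SB[OF 1(1)] SI[OF 1(1)] 1(2) s x w
      have "s \<odot>\<^bsub>B\<^esub> p = s \<odot>\<^bsub>B\<^esub> b \<oplus>\<^bsub>B\<^esub> (s \<otimes>\<^bsub>R\<^esub> r) \<odot>\<^bsub>B\<^esub> x"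
        unfolding 1 using c by (simp add: B.smult_r_distr B.smult_assoc1)
      moreover have "s \<odot>\<^bsub>I\<^esub> q = s \<odot>\<^bsub>I\<^esub> c \<oplus>\<^bsub>I\<^esub> (s \<otimes>\<^bsub>R\<^esub> r) \<odot>\<^bsub>I\<^esub> w"
        unfolding 1 using c by (simp add: I.smult_r_distr I.smult_assoc1)
      ultimately show "(s \<odot>\<^bsub>B\<^esub> p, s \<odot>\<^bsub>I\<^esub> q) \<in> T"
        unfolding T_def using smult[OF s 1(1)] I.R.m_closed[OF s 1(2)] by blast
    qed
    then have "T = S" using max ST by blast
    moreover have "(\<zero>\<^bsub>B\<^esub> \<oplus>\<^bsub>B\<^esub> \<one>\<^bsub>R\<^esub> \<odot>\<^bsub>B\<^esub> x, \<zero>\<^bsub>I\<^esub> \<oplus>\<^bsub>I\<^esub> \<one>\<^bsub>R\<^esub> \<odot>\<^bsub>I\<^esub> w) \<in> T"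
      unfolding T_def using zero I.R.one_closed by blast
    ultimately show ?thesis using x by (auto intro: DomainI)
  qed
  define g where "g x = (THE y. (x, y) \<in> S)" for x
  have geq: "g x = y" if "(x, y) \<in> S" for x y
    unfolding g_def using that S(3) by (auto dest: single_valuedD)
  have gS: "(x, g x) \<in> S" if "x \<in> carrier B" for x
    using total[OF that] geq by blast
  show ?thesis
  proof (intro bexI[of _ g] ballI left_module_homI)
    show "g (j a) = f a" if "a \<in> carrier A" for a using S(2) that geq by blast
    show "g x \<in> carrier I" if "x \<in> carrier B" for x using gS[OF that] SI by blast
    show "g (x \<oplus>\<^bsub>B\<^esub> y) = g x \<oplus>\<^bsub>I\<^esub> g y" if "x \<in> carrier B" "y \<in> carrier B" for x y
      using add[OF gS[OF that(1)] gS[OF that(2)]] geq by blast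
    show "g (r \<odot>\<^bsub>B\<^esub> x) = r \<odot>\<^bsub>I\<^esub> g x" if "r \<in> carrier R" "x \<in> carrier B" for r x
      using smult[OF that(1) gS[OF that(2)]] geq by blast
  qed
qed


definition free_module :: "('a, 'c) ring_scheme \<Rightarrow> 'b set \<Rightarrow> ('a, 'b \<Rightarrow> 'a) module" where
  "free_module R V =
    \<lparr>carrier = {\<phi>. finite {p. \<phi> p \<noteq> \<zero>\<^bsub>R\<^esub>} \<and> {p. \<phi> p \<noteq> \<zero>\<^bsub>R\<^esub>} \<subseteq> V \<and> (\<forall>p. \<phi> p \<in> carrier R)},
     monoid.mult = (\<lambda>\<phi> \<psi>. \<phi>), one = (\<lambda>p. \<zero>\<^bsub>R\<^esub>), ring.zero = (\<lambda>p. \<zero>\<^bsub>R\<^esub>),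
     add = (\<lambda>\<phi> \<psi> p. \<phi> p \<oplus>\<^bsub>R\<^esub> \<psi> p), smult = (\<lambda>r \<phi> p. r \<otimes>\<^bsub>R\<^esub> \<phi> p)\<rparr>"

lemma free_left_module:
  fixes V :: "'b set"
  assumes "ring R" shows "left_module R (free_module R V)"
proof -
  interpret R: ring R by fact
  have fin: "finite {p. h p \<noteq> \<zero>\<^bsub>R\<^esub>} \<and> {p. h p \<noteq> \<zero>\<^bsub>R\<^esub>} \<subseteq> V"
    if "finite {p. \<phi> p \<noteq> \<zero>\<^bsub>R\<^esub>}" "finite {p. \<psi> p \<noteq> \<zero>\<^bsub>R\<^esub>}"
      "{p. \<phi> p \<noteq> \<zero>\<^bsub>R\<^esub>} \<subseteq> V" "{p. \<psi> p \<noteq> \<zero>\<^bsub>R\<^esub>} \<subseteq> V"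
      "\<And>p. \<lbrakk>\<phi> p = \<zero>\<^bsub>R\<^esub>; \<psi> p = \<zero>\<^bsub>R\<^esub>\<rbrakk> \<Longrightarrow> h p = \<zero>\<^bsub>R\<^esub>" for \<phi> \<psi> h :: "'b \<Rightarrow> 'a"
  proof -
    have "{p. h p \<noteq> \<zero>\<^bsub>R\<^esub>} \<subseteq> {p. \<phi> p \<noteq> \<zero>\<^bsub>R\<^esub>} \<union> {p. \<psi> p \<noteq> \<zero>\<^bsub>R\<^esub>}" using that(5) by blast
    then show ?thesis using that(1-4) by (meson finite_UnI finite_subset le_sup_iff order_trans)
  qed
  have add: "(\<lambda>p. \<phi> p \<oplus>\<^bsub>R\<^esub> \<psi> p) \<in> carrier (free_module R V)"
    if "\<phi> \<in> carrier (free_module R V)" "\<psi> \<in> carrier (free_module R V)" for \<phi> \<psi>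
    using that fin[of \<phi> \<psi> "\<lambda>p. \<phi> p \<oplus>\<^bsub>R\<^esub> \<psi> p"] by (auto simp: free_module_def)
  have smult: "(\<lambda>p. r \<otimes>\<^bsub>R\<^esub> \<phi> p) \<in> carrier (free_module R V)"
    if "r \<in> carrier R" "\<phi> \<in> carrier (free_module R V)" for r \<phi>
    using that fin[of \<phi> \<phi> "\<lambda>p. r \<otimes>\<^bsub>R\<^esub> \<phi> p"] by (auto simp: free_module_def)
  have C: "\<phi> p \<in> carrier R" if "\<phi> \<in> carrier (free_module R V)" for \<phi> p
    using that by (auto simp: free_module_def)
  have ops: "\<zero>\<^bsub>free_module R V\<^esub> = (\<lambda>p. \<zero>\<^bsub>R\<^esub>)"
    "\<And>\<phi> \<psi>. \<phi> \<oplus>\<^bsub>free_module R V\<^esub> \<psi> = (\<lambda>p. \<phi> p \<oplus>\<^bsub>R\<^esub> \<psi> p)"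
    "\<And>r \<phi>. r \<odot>\<^bsub>free_module R V\<^esub> \<phi> = (\<lambda>p. r \<otimes>\<^bsub>R\<^esub> \<phi> p)"
    by (simp_all add: free_module_def)
  show ?thesis
    unfolding left_module_def left_module_axioms_def
  proof (intro conjI allI impI)
    show "abelian_group (free_module R V)"
    proof (rule abelian_groupI)
      fix \<phi> assume \<phi>: "\<phi> \<in> carrier (free_module R V)"
      have "(\<lambda>p. (\<ominus>\<^bsub>R\<^esub> \<one>\<^bsub>R\<^esub>) \<otimes>\<^bsub>R\<^esub> \<phi> p) \<in> carrier (free_module R V)"
        using smult \<phi> by simp
      then show "\<exists>\<psi>\<in>carrier (free_module R V). \<psi> \<oplus>\<^bsub>free_module R V\<^esub> \<phi> = \<zero>\<^bsub>free_module R V\<^esub>"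
        by (rule bexI[rotated]) (use C[OF \<phi>] in \<open>simp add: ops R.l_minus R.l_neg\<close>)
    next
      show "\<zero>\<^bsub>free_module R V\<^esub> \<in> carrier (free_module R V)" by (auto simp: free_module_def)
    qed (use C in \<open>simp_all add: ops add R.a_ac\<close>)
  qed (use C R.ring_axioms in
      \<open>simp_all add: ops smult R.l_distr R.r_distr R.m_assoc\<close>)
qed

definition free_eval ::
    "('a, 'c) ring_scheme \<Rightarrow> ('a, 'u) module \<Rightarrow> ('b \<Rightarrow> 'u) \<Rightarrow> ('b \<Rightarrow> 'a) \<Rightarrow> 'u" where
  "free_eval R N w \<phi> = finsum N (\<lambda>p. \<phi> p \<odot>\<^bsub>N\<^esub> w p) {p. \<phi> p \<noteq> \<zero>\<^bsub>R\<^esub>}"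

lemma free_eval_eq:
  assumes "left_module R N" and w: "\<And>p. p \<in> V \<Longrightarrow> w p \<in> carrier N"
    and \<phi>: "\<phi> \<in> carrier (free_module R V)"
    and T: "finite T" "{p. \<phi> p \<noteq> \<zero>\<^bsub>R\<^esub>} \<subseteq> T" "T \<subseteq> V"
  shows "free_eval R N w \<phi> = finsum N (\<lambda>p. \<phi> p \<odot>\<^bsub>N\<^esub> w p) T"
proof -
  interpret N: left_module R N by fact
  show ?thesis
    unfolding free_eval_def
    by (rule N.M.add.finprod_mono_neutral_cong_left)
      (use T \<phi> w in \<open>auto simp: free_module_def image_subset_iff subset_iff\<close>)
qed

lemma free_eval_hom:
  assumes N: "left_module R N" and w: "\<And>p. p \<in> V \<Longrightarrow> w p \<in> carrier N"
  shows "free_eval R N w \<in> left_module_hom R (free_module R V) N"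
proof (rule left_module_homI)
  interpret N: left_module R N by fact
  interpret F: left_module R "free_module R V" by (rule free_left_module) (rule N.R.ring_axioms)
  have C: "\<phi> p \<in> carrier R" if "\<phi> \<in> carrier (free_module R V)" for \<phi> p
    using that by (auto simp: free_module_def)
  have supp: "finite {p. \<phi> p \<noteq> \<zero>\<^bsub>R\<^esub>}" "{p. \<phi> p \<noteq> \<zero>\<^bsub>R\<^esub>} \<subseteq> V"
    if "\<phi> \<in> carrier (free_module R V)" for \<phi>
    using that by (auto simp: free_module_def)
  note eq = free_eval_eq[OF N w]
  show "free_eval R N w \<phi> \<in> carrier N" if "\<phi> \<in> carrier (free_module R V)" for \<phi>
    unfolding free_eval_def using C[OF that] supp[OF that] w by (intro N.M.finsum_closed) auto
  show "free_eval R N w (\<phi> \<oplus>\<^bsub>free_module R V\<^esub> \<psi>) = free_eval R N w \<phi> \<oplus>\<^bsub>N\<^esub> free_eval R N w \<psi>"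
    if "\<phi> \<in> carrier (free_module R V)" "\<psi> \<in> carrier (free_module R V)" for \<phi> \<psi>
  proof -
    define T where "T = {p. \<phi> p \<noteq> \<zero>\<^bsub>R\<^esub>} \<union> {p. \<psi> p \<noteq> \<zero>\<^bsub>R\<^esub>}"
    have T: "finite T" "T \<subseteq> V" using supp that unfolding T_def by blast+
    have "free_eval R N w (\<phi> \<oplus>\<^bsub>free_module R V\<^esub> \<psi>) =
        finsum N (\<lambda>p. (\<phi> p \<oplus>\<^bsub>R\<^esub> \<psi> p) \<odot>\<^bsub>N\<^esub> w p) T"
      by (subst eq[where T = T]) (use T that F.M.a_closed in \<open>auto simp: T_def free_module_def\<close>)
    also have "\<dots> = finsum N (\<lambda>p. \<phi> p \<odot>\<^bsub>N\<^esub> w p \<oplus>\<^bsub>N\<^esub> \<psi> p \<odot>\<^bsub>N\<^esub> w p) T"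
      using T w C that by (intro N.M.finsum_cong') (auto simp: N.smult_l_distr subset_iff)
    also have "\<dots> = finsum N (\<lambda>p. \<phi> p \<odot>\<^bsub>N\<^esub> w p) T \<oplus>\<^bsub>N\<^esub> finsum N (\<lambda>p. \<psi> p \<odot>\<^bsub>N\<^esub> w p) T"
      using T w C that by (intro N.M.finsum_addf) (auto simp: subset_iff)
    also have "\<dots> = free_eval R N w \<phi> \<oplus>\<^bsub>N\<^esub> free_eval R N w \<psi>"
      using eq[where T = T, OF _ that(1)] eq[where T = T, OF _ that(2)] T by (simp add: T_def)
    finally show ?thesis .
  qed
  show "free_eval R N w (r \<odot>\<^bsub>free_module R V\<^esub> \<phi>) = r \<odot>\<^bsub>N\<^esub> free_eval R N w \<phi>"
    if "r \<in> carrier R" "\<phi> \<in> carrier (free_module R V)" for r \<phi>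
  proof -
    define T where "T = {p. \<phi> p \<noteq> \<zero>\<^bsub>R\<^esub>}"
    have T: "finite T" "T \<subseteq> V" using supp that unfolding T_def by blast+
    have "free_eval R N w (r \<odot>\<^bsub>free_module R V\<^esub> \<phi>) =
        finsum N (\<lambda>p. (r \<otimes>\<^bsub>R\<^esub> \<phi> p) \<odot>\<^bsub>N\<^esub> w p) T"
      by (subst eq[where T = T]) (use T that F.smult_closed in \<open>auto simp: T_def free_module_def\<close>)
    also have "\<dots> = r \<odot>\<^bsub>N\<^esub> finsum N (\<lambda>p. \<phi> p \<odot>\<^bsub>N\<^esub> w p) T"
      using T(1) T(2)
    proof (induction T rule: finite_induct)
      case empty
      have "r \<odot>\<^bsub>N\<^esub> \<zero>\<^bsub>N\<^esub> = \<zero>\<^bsub>N\<^esub>"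
        using N.smult_assoc1[of r "\<zero>\<^bsub>R\<^esub>" "\<zero>\<^bsub>N\<^esub>"] that by simp
      then show ?case by simp
    next
      case (insert p T)
      moreover have "(\<lambda>p. \<phi> p \<odot>\<^bsub>N\<^esub> w p) \<in> T \<rightarrow> carrier N"
        "(\<lambda>p. (r \<otimes>\<^bsub>R\<^esub> \<phi> p) \<odot>\<^bsub>N\<^esub> w p) \<in> T \<rightarrow> carrier N"
        using insert.prems C that w by auto
      ultimately show ?case using C that w by (simp add: N.smult_r_distr N.smult_assoc1)
    qed
    finally show ?thesis by (simp add: free_eval_def T_def)
  qed
qed

lemma hom_free_eval:
  assumes N: "left_module R N" and N': "left_module R N'" and h: "h \<in> left_module_hom R N N'"
    and w: "\<And>p. p \<in> V \<Longrightarrow> w p \<in> carrier N" and w': "\<And>p. p \<in> V \<Longrightarrow> w' p = h (w p)"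
    and \<phi>: "\<phi> \<in> carrier (free_module R V)"
  shows "h (free_eval R N w \<phi>) = free_eval R N' w' \<phi>"
proof -
  interpret N: left_module R N by fact
  interpret N': left_module R N' by fact
  note hD = left_module_homD[OF h]
  have C: "\<phi> p \<in> carrier R" for p using \<phi> by (auto simp: free_module_def)
  have "h (finsum N (\<lambda>p. \<phi> p \<odot>\<^bsub>N\<^esub> w p) T) = finsum N' (\<lambda>p. \<phi> p \<odot>\<^bsub>N'\<^esub> w' p) T"
    if "finite T" "T \<subseteq> V" for T
    using that
  proof (induction T rule: finite_induct)
    case empty
    have "h \<zero>\<^bsub>N\<^esub> = \<zero>\<^bsub>N'\<^esub>"
      using hD(3)[of "\<zero>\<^bsub>R\<^esub>" "\<zero>\<^bsub>N\<^esub>"] hD(1)[of "\<zero>\<^bsub>N\<^esub>"] by simp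
    then show ?case by simp
  next
    case (insert p T)
    moreover have "(\<lambda>p. \<phi> p \<odot>\<^bsub>N\<^esub> w p) \<in> T \<rightarrow> carrier N"
      "(\<lambda>p. \<phi> p \<odot>\<^bsub>N'\<^esub> w' p) \<in> T \<rightarrow> carrier N'"
      using insert.prems C w w' hD(1) by auto
    ultimately show ?case using C w w' hD by simp
  qed
  then show ?thesis using \<phi> by (auto simp: free_eval_def free_module_def)
qed

theorem projective_moduleD:
  fixes R :: "('a, 'c) ring_scheme" and P :: "('a, 'b) module"
    and B :: "('a, 'u) module" and C :: "('a, 'v) module"
  assumes proj: "projective_module R P"
    and B: "left_module R B" and C: "left_module R C"
    and q: "q \<in> left_module_hom R B C" "q ` carrier B = carrier C"
    and f: "f \<in> left_module_hom R P C"
  shows "\<exists>g \<in> left_module_hom R P B. \<forall>x\<in>carrier P. q (g x) = f x"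
proof -
  have P: "left_module R P" using proj by (simp add: projective_module_def)
  interpret P: left_module R P by fact
  let ?F = "free_module R (carrier P)"
  let ?e = "free_eval R P (\<lambda>p. p)"
  have F: "left_module R ?F" by (rule free_left_module) (rule P.R.ring_axioms)
  have e: "?e \<in> left_module_hom R ?F P" by (rule free_eval_hom[OF P]) simp
  have "p \<in> ?e ` carrier ?F" if p: "p \<in> carrier P" for p
  proof -
    define \<delta> where "\<delta> = (\<lambda>p'. if p' = p then \<one>\<^bsub>R\<^esub> else \<zero>\<^bsub>R\<^esub>)"
    have "\<delta> \<in> carrier ?F" using p by (auto simp: \<delta>_def free_module_def)
    moreover have "?e \<delta> = finsum P (\<lambda>p. \<delta> p \<odot>\<^bsub>P\<^esub> p) {p}"
      by (rule free_eval_eq[OF P _ calculation]) (use p in \<open>auto simp: \<delta>_def\<close>)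
    moreover have "\<dots> = p" using p by (simp add: \<delta>_def)
    ultimately show ?thesis by force
  qed
  then have "?e ` carrier ?F = carrier P" using left_module_homD(1)[OF e] by blast
  moreover have "(\<lambda>x. x) \<in> left_module_hom R P P" by (rule left_module_homI) auto
  ultimately obtain s where s: "s \<in> left_module_hom R P ?F"
    and es: "\<And>x. x \<in> carrier P \<Longrightarrow> ?e (s x) = x"
    using proj[unfolded projective_module_def, THEN conjunct2, rule_format, of ?F P ?e "\<lambda>x. x"] F P e
    by blast
  have "\<forall>p\<in>carrier P. \<exists>b. b \<in> carrier B \<and> q b = f p"
    using q(2) left_module_homD(1)[OF f] by (metis imageE)
  then obtain w where w: "\<And>p. p \<in> carrier P \<Longrightarrow> w p \<in> carrier B" "\<And>p. p \<in> carrier P \<Longrightarrow> q (w p) = f p"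
    by metis
  let ?h = "free_eval R B w"
  have h: "?h \<in> left_module_hom R ?F B" by (rule free_eval_hom[OF B]) (rule w)
  show ?thesis
  proof (intro bexI[of _ "?h \<circ> s"] ballI)
    show "?h \<circ> s \<in> left_module_hom R P B"
      by (rule left_module_homI) (simp_all add: left_module_homD[OF s] left_module_homD[OF h])
    fix x assume x: "x \<in> carrier P"
    note sx = left_module_homD(1)[OF s x]
    have "q (?h (s x)) = free_eval R C f (s x)"
      by (rule hom_free_eval[OF B C q(1) _ _ sx]) (simp_all add: w)
    also have "\<dots> = f (?e (s x))"
      by (rule hom_free_eval[OF P C f _ _ sx, symmetric]) simp_all
    finally show "q ((?h \<circ> s) x) = f x" using es[OF x] by simp
  qed
qed


section \<open>Monoid algebras, induction from the group of units\<close>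

definition basis_elt :: "'m \<Rightarrow> 'm \<Rightarrow> 'k::field" where
  "basis_elt x = (\<lambda>y. if y = x then 1 else 0)"

definition monoid_algebra :: "('m, 'c) monoid_scheme \<Rightarrow> ('m \<Rightarrow> 'k::field) ring" where
  "monoid_algebra M =
    \<lparr>carrier = {a. finite {x. a x \<noteq> 0} \<and> {x. a x \<noteq> 0} \<subseteq> carrier M},
     monoid.mult = (\<lambda>a b z. \<Sum>(x, y) \<in> {(x, y). a x \<noteq> 0 \<and> b y \<noteq> 0 \<and> x \<otimes>\<^bsub>M\<^esub> y = z}. a x * b y),
     one = basis_elt \<one>\<^bsub>M\<^esub>,
     ring.zero = (\<lambda>_. 0),
     add = (\<lambda>a b x. a x + b x)\<rparr>"

text \<open>The element \<open>a\<close> of \<open>kM\<close> acts on \<open>W\<close> through its part supported on the group of units \<open>G\<close>;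
  by linearity this says that \<open>G\<close> acts as given and every element of \<open>M - G\<close> acts as zero.\<close>

definition Ind ::
    "('m, 'c) monoid_scheme \<Rightarrow> ('m \<Rightarrow> 'k::field, 'w) module \<Rightarrow> ('m \<Rightarrow> 'k, 'w) module" where
  "Ind M W = W\<lparr>smult := \<lambda>a w. (\<lambda>x. if x \<in> Units M then a x else 0) \<odot>\<^bsub>W\<^esub> w\<rparr>"

text \<open>When the group of units \<open>G\<close> is finite, every projective indecomposable \<open>kG\<close>-module is
  isomorphic to a left ideal of \<open>kG\<close>, so fixing the element type of \<open>P\<close> is no restriction.\<close>

definition group_injective :: "'k::field itself \<Rightarrow> ('m, 'c) monoid_scheme \<Rightarrow> bool" where
  "group_injective _ M \<longleftrightarrow>
    (\<exists>P :: ('m \<Rightarrow> 'k, 'm \<Rightarrow> 'k) module.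
       projective_module (monoid_algebra (units_of M)) P \<and>
       indecomposable_module (monoid_algebra (units_of M)) P \<and>
       injective_module (monoid_algebra M) (Ind M P))"


section \<open>The Brauer monoid\<close>

datatype vertex = Top nat | Bot nat

definition vertices :: "nat \<Rightarrow> vertex set" where
  "vertices m = Top ` {1..m} \<union> Bot ` {1..m}"

definition perfect_matchings :: "nat \<Rightarrow> vertex set set set" where
  "perfect_matchings m = {x. partition_on (vertices m) x \<and> (\<forall>B\<in>x. card B = 2)}"

text \<open>To multiply \<open>x\<close> and \<open>y\<close>, place them on three rows of vertices, \<open>x\<close> on the rows \<open>Upper\<close> and
  \<open>Middle\<close>, and \<open>y\<close> on the rows \<open>Middle\<close> and \<open>Lower\<close>. The blocks of the product are the traces of
  the connected components on the two outer rows; components within the middle row disappear.\<close>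

datatype stacked_vertex = Upper nat | Middle nat | Lower nat

primrec upper_copy :: "vertex \<Rightarrow> stacked_vertex" where
  "upper_copy (Top i) = Upper i"
| "upper_copy (Bot i) = Middle i"

primrec lower_copy :: "vertex \<Rightarrow> stacked_vertex" where
  "lower_copy (Top i) = Middle i"
| "lower_copy (Bot i) = Lower i"

primrec outer_copy :: "vertex \<Rightarrow> stacked_vertex" where
  "outer_copy (Top i) = Upper i"
| "outer_copy (Bot i) = Lower i"

definition stacked_blocks :: "vertex set set \<Rightarrow> vertex set set \<Rightarrow> stacked_vertex set set" where
  "stacked_blocks x y = (`) upper_copy ` x \<union> (`) lower_copy ` y"

definition stacked_connected ::
    "vertex set set \<Rightarrow> vertex set set \<Rightarrow> (stacked_vertex \<times> stacked_vertex) set" where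
  "stacked_connected x y = {(u, v). \<exists>B\<in>stacked_blocks x y. u \<in> B \<and> v \<in> B}\<^sup>*"

definition brauer_mult :: "nat \<Rightarrow> vertex set set \<Rightarrow> vertex set set \<Rightarrow> vertex set set" where
  "brauer_mult m x y =
    {{v \<in> vertices m. (outer_copy u, outer_copy v) \<in> stacked_connected x y} |u. u \<in> vertices m}"

text \<open>With \<open>Top (p i)\<close> joined to \<open>Bot i\<close>, composition of permutations corresponds to stacking:
  the matching of \<open>p \<circ> q\<close> is that of \<open>p\<close> on top of that of \<open>q\<close>.\<close>

definition perm_matching :: "nat \<Rightarrow> (nat \<Rightarrow> nat) \<Rightarrow> vertex set set" where
  "perm_matching m p = {{Top (p i), Bot i} |i. i \<in> {1..m}}"

definition brauer_monoid :: "nat \<Rightarrow> vertex set set monoid" where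
  "brauer_monoid m =
    \<lparr>carrier = perfect_matchings m, monoid.mult = brauer_mult m, one = perm_matching m id\<rparr>"

definition antisymmetrizer :: "nat \<Rightarrow> vertex set set \<Rightarrow> complex" where
  "antisymmetrizer m =
    (\<lambda>x. (1 / fact m) *
      (\<Sum>p\<in>carrier (sym_group m). of_int (sign p) * basis_elt (perm_matching m p) x))"

text \<open>The sign representation as a module over the group algebra of the group of units of the
  Brauer monoid.\<close>

definition sign_module :: "nat \<Rightarrow> (vertex set set \<Rightarrow> complex, complex) module" where
  "sign_module m =
    \<lparr>carrier = UNIV, monoid.mult = (*), one = 1, ring.zero = 0, add = (+),
     smult = (\<lambda>a z. (\<Sum>p\<in>carrier (sym_group m). a (perm_matching m p) * of_int (sign p)) * z)\<rparr>"

end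

theory Submission imports Defs
begin

text \<open>A matching that is not a permutation contains a block \<open>{Top i, Top j}\<close> and a block
  \<open>{Bot k, Bot l}\<close>, so it is fixed by a transposition on the left and by one on the right, and
  its products with the antisymmetrizer \<open>e\<close> vanish. Hence \<open>a e = e a = \<chi>(a) e\<close> for a linear
  character \<open>\<chi>\<close> of the whole algebra \<open>A\<close>: the idempotent \<open>e\<close> is central and \<open>A e\<close> is
  one-dimensional, which gives the isomorphism with the induced sign representation. Since
  \<open>A = A e \<times> A (1 - e)\<close> as rings and \<open>A e\<close> is a field, \<open>A e\<close> is an injective module. The
  same element \<open>e\<close> generates a one-dimensional projective module \<open>P\<close> over the group algebra of
  the units, and \<open>Ind(P)\<close> is again \<open>A e\<close>.\<close>


text \<open>A matching \<open>x\<close> with \<open>x t = x\<close> for a transposition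
  \<open>t\<close> satisfies \<open>x e = x t e = -(x e)\<close>, because \<open>t e = -e\<close>. A
  block inside the bottom row gives \<open>x e = 0\<close> and a block inside the top row gives
  \<open>e x = 0\<close>; centrality of \<open>e\<close> needs both, and counting vertices shows
  that the two kinds of block occur together. Two facts that a picture makes evident carry much of
  the work: stacking again produces pairs, and stacking is associative. The first is a statement on
  the ends of paths, the second on collapsing rows of a taller stack. Injectivity is tested on
  modules of any dimension. A nonzero homomorphism into the line \<open>A e\<close> is determined by
  its kernel and one vector with value \<open>e\<close>, so it is extended by enlarging the kernel
  with Zorn's lemma. The locale \<open>division_idempotent\<close> isolates what this argument uses,
  and it is instantiated both for \<open>A\<close> and for the group algebra of the units.\<close>

section \<open>Components of the union of two matchings\<close>

text \<open>The orbit of \<open>u\<close> is its cycle under \<open>\<phi> = \<beta> \<circ> \<alpha>\<close>, of length \<open>n\<close> say, and \<open>\<alpha>\<close>, \<open>\<beta>\<close> map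
  \<open>\<phi>\<^sup>k u\<close> to \<open>\<phi>\<^sup>-\<^sup>k u\<close> and \<open>\<phi>\<^sup>1\<^sup>-\<^sup>k u\<close>. So \<open>\<phi>\<^sup>k u\<close> is fixed by one of them iff \<open>2 k\<close> is 0 or 1
  modulo \<open>n\<close>.\<close>

lemma involutions_orbit_fixed_points:
  fixes \<alpha> \<beta> :: "'a \<Rightarrow> 'a"
  assumes \<alpha>\<alpha>: "\<And>x. \<alpha> (\<alpha> x) = x" and \<beta>\<beta>: "\<And>x. \<beta> (\<beta> x) = x"
    and perm: "permutation (\<beta> \<circ> \<alpha>)" and \<alpha>u: "\<alpha> u = u" and \<beta>u: "\<beta> u \<noteq> u"
  shows "card {v. (u, v) \<in> {(x, y). y = \<alpha> x \<or> y = \<beta> x}\<^sup>* \<and> (\<alpha> v = v \<or> \<beta> v = v)} = 2"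
proof -
  define \<phi> where "\<phi> = \<beta> \<circ> \<alpha>"
  define n where "n = least_power \<phi> u"
  define w where "w k = (\<phi> ^^ k) u" for k
  have perm\<phi>: "permutation \<phi>" using perm by (simp add: \<phi>_def)
  then have inj: "inj (\<phi> ^^ k)" for k
    by (intro inj_fn) (simp add: permutation_bijective bij_is_inj)
  have n: "n > 1"
    using least_power_gt_one[OF perm\<phi>, of u] \<alpha>u \<beta>u by (simp add: n_def \<phi>_def)
  have wn: "w n = u" unfolding w_def n_def by (rule least_power_of_permutation(1)[OF perm\<phi>])
  have w_mod: "w (k mod n) = w k" for k
    using wn unfolding w_def by (rule funpow_mod_eq)
  have w_add: "(\<phi> ^^ k) (w l) = w (k + l)" for k l by (simp add: w_def funpow_add)
  have w_inj: "inj_on w {..<n}"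
  proof (rule linorder_inj_onI)
    fix i j assume ij: "i < j" "i \<in> {..<n}" "j \<in> {..<n}"
    show "w i \<noteq> w j"
    proof
      assume "w i = w j"
      then have "(\<phi> ^^ i) u = (\<phi> ^^ i) (w (j - i))" using ij w_add[of i "j - i"] by (simp add: w_def)
      then have "(\<phi> ^^ (j - i)) u = u" using inj by (simp add: w_def inj_eq)
      then have "n dvd j - i" using least_power_dvd[OF perm\<phi>] by (simp add: n_def)
      then show False using ij by (auto dest: dvd_imp_le)
    qed
  qed auto
  have w_eq: "w i = w j \<longleftrightarrow> i mod n = j mod n" for i j
    using w_inj n w_mod[of i] w_mod[of j] by (metis inj_on_eq_iff lessThan_iff mod_less_divisor gr_implies_not_zero gr0I)
  have w\<alpha>: "\<alpha> (w k) = w (n - k)" if "k \<le> n" for k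
  proof -
    \<comment> \<open>\<open>\<alpha>\<close> conjugates \<open>\<phi>\<close> to its inverse.
      Iterating gives \<open>\<phi>^k \<alpha> \<phi>^k = \<alpha>\<close>, and the exponent
      \<open>-k\<close> is written as \<open>n - k\<close> to stay in the naturals.\<close>
    have "\<phi> (\<alpha> (\<phi> x)) = \<alpha> x" for x by (simp add: \<phi>_def \<alpha>\<alpha> \<beta>\<beta>)
    then have "(\<phi> ^^ k) (\<alpha> (w k)) = \<alpha> u"
      by (induction k) (simp_all add: w_def funpow_Suc_right del: funpow.simps(2), simp add: funpow_swap1[symmetric] w_def funpow_Suc_right)
    also have "\<dots> = (\<phi> ^^ k) (w (n - k))" using that by (simp add: w_add wn \<alpha>u)
    finally show ?thesis using inj by (simp add: inj_eq)
  qed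
  have w\<beta>: "\<beta> (w k) = w (Suc (n - k))" if "k \<le> n" for k
    using w\<alpha>[OF that] by (metis \<phi>_def \<alpha>\<alpha> comp_apply funpow.simps(2) w_def)
  have orbit: "(u, v) \<in> {(x, y). y = \<alpha> x \<or> y = \<beta> x}\<^sup>* \<longleftrightarrow> (\<exists>k<n. v = w k)" for v
  proof
    assume "(u, v) \<in> {(x, y). y = \<alpha> x \<or> y = \<beta> x}\<^sup>*"
    then show "\<exists>k<n. v = w k"
    proof induction
      case base
      show ?case using n by (intro exI[of _ 0]) (simp add: w_def)
    next
      case (step y z)
      then obtain k where k: "k < n" "y = w k" by blast
      then have "z = w (n - k) \<or> z = w (Suc (n - k))" using step(2) w\<alpha>[of k] w\<beta>[of k] by auto
      then show ?case using w_mod n by (metis mod_less_divisor gr_implies_not_zero gr0I)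
    qed
  next
    assume "\<exists>k<n. v = w k"
    moreover have "(u, w k) \<in> {(x, y). y = \<alpha> x \<or> y = \<beta> x}\<^sup>*" for k
    proof (induction k)
      case 0 show ?case by (simp add: w_def)
    next
      case (Suc k)
      have "(w k, \<alpha> (w k)) \<in> {(x, y). y = \<alpha> x \<or> y = \<beta> x}"
        "(\<alpha> (w k), w (Suc k)) \<in> {(x, y). y = \<alpha> x \<or> y = \<beta> x}"
        by (simp_all add: w_def \<phi>_def)
      then show ?case using Suc by (meson rtrancl.rtrancl_into_rtrancl)
    qed
    ultimately show "(u, v) \<in> {(x, y). y = \<alpha> x \<or> y = \<beta> x}\<^sup>*" by blast
  qed
  have fix\<alpha>: "\<alpha> (w k) = w k \<longleftrightarrow> k = 0 \<or> 2 * k = n" if "k < n" for k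
  proof (cases "k = 0")
    case False
    then show ?thesis using that w\<alpha>[of k] by (auto simp: w_eq)
  qed (use \<alpha>u in \<open>simp add: w_def\<close>)
  have fix\<beta>: "\<beta> (w k) = w k \<longleftrightarrow> 2 * k = n + 1" if "k < n" for k
  proof -
    \<comment> \<open>\<open>Suc (n - k)\<close> is already reduced modulo \<open>n\<close> only for
      \<open>k > 1\<close>; for 0 and 1 the index wraps around.\<close>
    consider "k = 0" | "k = 1" | "k > 1" by linarith
    then show ?thesis
    proof cases
      case 1
      then show ?thesis using n w\<beta>[of k] by (simp add: w_eq mod_Suc)
    next
      case 2
      then show ?thesis using n w\<beta>[of k] by (simp add: w_eq)
    next
      case 3
      then show ?thesis using that w\<beta>[of k] by (auto simp: w_eq)
    qed
  qed
  have "{v. (u, v) \<in> {(x, y). y = \<alpha> x \<or> y = \<beta> x}\<^sup>* \<and> (\<alpha> v = v \<or> \<beta> v = v)} =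
      w ` {k. k < n \<and> (\<alpha> (w k) = w k \<or> \<beta> (w k) = w k)}"
    unfolding orbit by blast
  also have "{k. k < n \<and> (\<alpha> (w k) = w k \<or> \<beta> (w k) = w k)} = {k. k < n \<and> (k = 0 \<or> 2 * k = n \<or> 2 * k = n + 1)}"
    using fix\<alpha> fix\<beta> by blast
  \<comment> \<open>Exactly one of \<open>2 * k = n\<close> and \<open>2 * k = n + 1\<close> is
    solvable, depending on the parity of \<open>n\<close>. In both cases
    \<open>(n + 1) div 2\<close> is the solution, and it is below \<open>n\<close> because
    \<open>n > 1\<close>.\<close>
  also have "\<dots> = {0, (n + 1) div 2}" using n by auto
  finally have "{v. (u, v) \<in> {(x, y). y = \<alpha> x \<or> y = \<beta> x}\<^sup>* \<and> (\<alpha> v = v \<or> \<beta> v = v)} =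
      w ` {0, (n + 1) div 2}" .
  moreover have "card (w ` {0, (n + 1) div 2}) = 2"
  proof -
    have "(n + 1) div 2 mod n = (n + 1) div 2" "(n + 1) div 2 \<noteq> 0" using n by auto
    then have "w 0 \<noteq> w ((n + 1) div 2)" unfolding w_eq by (metis mod_0)
    then show ?thesis by simp
  qed
  ultimately show ?thesis by simp
qed

text \<open>The value \<open>w\<close> outside the blocks makes the map of a matching a total
  involution whose fixed points are exactly the uncovered vertices. Path ends thereby become fixed
  points.\<close>

definition partner :: "'a set set \<Rightarrow> 'a \<Rightarrow> 'a" where
  "partner P w = (if w \<in> \<Union>P then THE v. v \<noteq> w \<and> {w, v} \<in> P else w)"

lemma partner_eqI:
  assumes "disjoint P" "{w, v} \<in> P" "v \<noteq> w"
  shows "partner P w = v"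
proof -
  have "v' = v" if "v' \<noteq> w" "{w, v'} \<in> P" for v'
    using disjointD[OF assms(1,2) that(2)] that(1) assms(3) by (auto simp: doubleton_eq_iff)
  then have "(THE v. v \<noteq> w \<and> {w, v} \<in> P) = v"
    using assms(2,3) by (intro the_equality) blast+
  moreover have "w \<in> \<Union>P" using assms(2) by blast
  ultimately show ?thesis by (simp only: partner_def if_True)
qed

lemma partner_outside: "w \<notin> \<Union>P \<Longrightarrow> partner P w = w"
  by (simp add: partner_def)

lemma partner_block:
  assumes "disjoint P" "\<forall>B\<in>P. card B = 2" "B \<in> P" "w \<in> B"
  shows "B = {w, partner P w}" "partner P w \<noteq> w"
proof -
  obtain v where "B = {w, v}" "v \<noteq> w"
    using assms by (metis card_2_iff doubleton_eq_iff insertE singletonD)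
  moreover from this have "partner P w = v" using assms(1,3) by (intro partner_eqI) auto
  ultimately show "B = {w, partner P w}" "partner P w \<noteq> w" by auto
qed

lemma partner_partner:
  assumes "disjoint P" "\<forall>B\<in>P. card B = 2"
  shows "partner P (partner P w) = w"
proof (cases "w \<in> \<Union>P")
  case True
  then obtain B where "B \<in> P" "w \<in> B" by blast
  note block = partner_block[OF assms this]
  have "{partner P w, w} \<in> P" using block(1) \<open>B \<in> P\<close> by (metis insert_commute)
  then show ?thesis using block(2) by (intro partner_eqI[OF assms(1)]) auto
qed (simp add: partner_outside)

lemma partner_permutation:
  assumes "disjoint P" "\<forall>B\<in>P. card B = 2" "finite (\<Union>P)"
  shows "permutation (partner P)"
proof -
  have "bij (partner P)" by (intro o_bij[of "partner P"]) (auto simp: partner_partner[OF assms(1,2)])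
  moreover have "{x. partner P x \<noteq> x} \<subseteq> \<Union>P" using partner_outside by fastforce
  ultimately show ?thesis using assms(3) finite_subset unfolding permutation by blast
qed

text \<open>The union of two matchings is a graph of degree at most two. A vertex covered by just
  one of them is an end of a path, and the other end is the only further vertex of this kind in its
  component. Steps inside blocks and steps along the two partner involutions have the same reflexive
  transitive closure, which reduces the claim to
  \<open>involutions_orbit_fixed_points\<close>.\<close>

lemma two_matchings_component_aux:
  fixes P Q :: "'a set set"
  assumes P: "disjoint P" "\<forall>B\<in>P. card B = 2" "finite (\<Union>P)"
    and Q: "disjoint Q" "\<forall>B\<in>Q. card B = 2" "finite (\<Union>Q)"
    and u: "u \<in> \<Union>Q" "u \<notin> \<Union>P"
  shows "card {v \<in> \<Union>P \<union> \<Union>Q - \<Union>P \<inter> \<Union>Q. (u, v) \<in> {(a, b). \<exists>B\<in>P \<union> Q. a \<in> B \<and> b \<in> B}\<^sup>*} = 2"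
proof -
  let ?E = "{(a, b). \<exists>B\<in>P \<union> Q. a \<in> B \<and> b \<in> B}"
  let ?F = "{(a, b). b = partner P a \<or> b = partner Q a}"
  have "(a, b) \<in> ?F\<^sup>=" if "B \<in> P \<union> Q" "a \<in> B" "b \<in> B" for a b B
  proof -
    have "B = {a, partner P a} \<or> B = {a, partner Q a}"
      using that(1,2) partner_block(1)[OF P(1,2)] partner_block(1)[OF Q(1,2)] by blast
    then show ?thesis using that(3) by auto
  qed
  then have "?E \<subseteq> ?F\<^sup>=" by blast
  moreover have "?F \<subseteq> ?E\<^sup>="
  proof (rule subrelI)
    fix a b assume ab: "(a, b) \<in> ?F"
    have "\<exists>B\<in>P \<union> Q. a \<in> B \<and> b \<in> B" if "a \<noteq> b"
      using ab unfolding mem_Collect_eq prod.case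
    proof
      assume b: "b = partner P a"
      then obtain B where B: "B \<in> P" "a \<in> B"
        using \<open>a \<noteq> b\<close> partner_outside[of a P] by auto
      show ?thesis using partner_block(1)[OF P(1,2) B] B b by (intro bexI[of _ B]) auto
    next
      assume b: "b = partner Q a"
      then obtain B where B: "B \<in> Q" "a \<in> B"
        using \<open>a \<noteq> b\<close> partner_outside[of a Q] by auto
      show ?thesis using partner_block(1)[OF Q(1,2) B] B b by (intro bexI[of _ B]) auto
    qed
    then show "(a, b) \<in> ?E\<^sup>=" by blast
  qed
  ultimately have EF: "?E\<^sup>* = ?F\<^sup>*"
    using rtrancl_mono[of ?E "?F\<^sup>="] rtrancl_mono[of ?F "?E\<^sup>="] unfolding rtrancl_reflcl by simp
  \<comment> \<open>A vertex covered by neither matching is a fixed point too, so such vertices must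
    be excluded from the component before fixed points are counted.\<close>
  have reach: "v \<in> \<Union>P \<union> \<Union>Q" if "(u, v) \<in> ?E\<^sup>*" for v
    using that u(1) by induction auto
  have fixed: "partner P v = v \<longleftrightarrow> v \<notin> \<Union>P" "partner Q v = v \<longleftrightarrow> v \<notin> \<Union>Q" for v
    using partner_outside partner_block(2)[OF P(1,2)] partner_block(2)[OF Q(1,2)] by (metis UnionE)+
  have "{v \<in> \<Union>P \<union> \<Union>Q - \<Union>P \<inter> \<Union>Q. (u, v) \<in> ?E\<^sup>*} =
      {v. (u, v) \<in> ?F\<^sup>* \<and> (partner P v = v \<or> partner Q v = v)}"
    unfolding fixed EF[symmetric] using reach by blast
  moreover have "card \<dots> = 2"
  proof (rule involutions_orbit_fixed_points)
    show "permutation (partner Q \<circ> partner P)"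
      by (rule permutation_compose) (intro partner_permutation P Q)+
    show "partner P u = u" "partner Q u \<noteq> u" using u unfolding fixed by blast+
  qed (intro partner_partner P Q)+
  ultimately show ?thesis by simp
qed

lemma two_matchings_component:
  fixes P Q :: "'a set set"
  assumes P: "disjoint P" "\<forall>B\<in>P. card B = 2" "finite (\<Union>P)"
    and Q: "disjoint Q" "\<forall>B\<in>Q. card B = 2" "finite (\<Union>Q)"
    and u: "u \<in> \<Union>P \<union> \<Union>Q - \<Union>P \<inter> \<Union>Q"
  shows "card {v \<in> \<Union>P \<union> \<Union>Q - \<Union>P \<inter> \<Union>Q. (u, v) \<in> {(a, b). \<exists>B\<in>P \<union> Q. a \<in> B \<and> b \<in> B}\<^sup>*} = 2"
proof (cases "u \<in> \<Union>Q")
  case True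
  then show ?thesis using u by (intro two_matchings_component_aux[OF P Q]) auto
next
  case False
  then show ?thesis
    unfolding Un_commute[of P Q] Un_commute[of "\<Union>P"] Int_commute[of "\<Union>P"]
    using u by (intro two_matchings_component_aux[OF Q P]) auto
qed

section \<open>The Brauer monoid\<close>

text \<open>Cut a walk into maximal runs of \<open>E\<close>-steps. Each run starts and ends in
  \<open>V\<close>, since \<open>F\<close>-steps and the two ends of the walk lie there, so a run
  can be replaced by one edge of the trace of \<open>E\<close> on \<open>U\<close>. This allows two
  adjacent diagrams of a stack to be replaced by their product.\<close>

lemma rtrancl_coarsen:
  fixes E F :: "('a \<times> 'a) set"
  assumes V: "Field F \<subseteq> V" and U: "V \<inter> Field E \<subseteq> U" "U \<subseteq> V"
    and uv: "u \<in> V" "v \<in> V"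
  shows "(u, v) \<in> (E \<union> F)\<^sup>* \<longleftrightarrow> (u, v) \<in> ({(a, b). a \<in> U \<and> b \<in> U \<and> (a, b) \<in> E\<^sup>*} \<union> F)\<^sup>*"
    (is "_ \<longleftrightarrow> _ \<in> ?C\<^sup>*")
proof
  have trace: "(a, b) \<in> ?C\<^sup>*" if "a \<in> V" "b \<in> V" "(a, b) \<in> E\<^sup>*" for a b
  proof (cases "a = b")
    case False
    then have "a \<in> Field E" "b \<in> Field E"
      using that(3) by (meson FieldI1 FieldI2 converse_rtranclE rtranclE)+
    then show ?thesis using that U by (intro r_into_rtrancl) auto
  qed simp
  \<comment> \<open>\<open>w\<close> is where the current run of \<open>E\<close>-steps began;
    everything before it is already translated into coarse edges.\<close>
  have "\<exists>w\<in>V. (u, w) \<in> ?C\<^sup>* \<and> (w, x) \<in> E\<^sup>*" if "(u, x) \<in> (E \<union> F)\<^sup>*" for x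
    using that
  proof induction
    case base
    show ?case using uv by blast
  next
    case (step x y)
    then obtain w where w: "w \<in> V" "(u, w) \<in> ?C\<^sup>*" "(w, x) \<in> E\<^sup>*" by blast
    show ?case
    proof (cases "(x, y) \<in> E")
      case False
      then have xy: "(x, y) \<in> F" using step by blast
      then have y: "y \<in> V" using V by (auto simp: Field_def)
      have "x \<in> V" using xy V by (auto simp: Field_def)
      then have "(u, y) \<in> ?C\<^sup>*" using w trace xy by (meson UnI2 rtrancl.rtrancl_into_rtrancl rtrancl_trans)
      then show ?thesis using y by blast
    qed (use w in \<open>meson rtrancl.rtrancl_into_rtrancl\<close>)
  qed
  then show "(u, v) \<in> ?C\<^sup>*" if "(u, v) \<in> (E \<union> F)\<^sup>*"
    using that uv trace by (meson rtrancl_trans)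
next
  have "?C \<subseteq> (E \<union> F)\<^sup>*" using rtrancl_mono[of E "E \<union> F"] by auto
  then show "(u, v) \<in> (E \<union> F)\<^sup>*" if "(u, v) \<in> ?C\<^sup>*"
    using that rtrancl_subset_rtrancl by blast
qed
text \<open>Rows are numbered so that stacks of any height live in one type: associativity follows by
  comparing both bracketings with the stack of \<open>x\<close>, \<open>y\<close>, \<open>z\<close> on four rows.\<close>

primrec row_copy :: "nat \<Rightarrow> nat \<Rightarrow> vertex \<Rightarrow> nat \<times> nat" where
  "row_copy a b (Top i) = (a, i)"
| "row_copy a b (Bot i) = (b, i)"

definition row_edges :: "nat \<Rightarrow> nat \<Rightarrow> vertex set set \<Rightarrow> ((nat \<times> nat) \<times> (nat \<times> nat)) set" where
  "row_edges a b x = {(row_copy a b u, row_copy a b v) |u v. \<exists>B\<in>x. u \<in> B \<and> v \<in> B}"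

primrec stacked_row :: "nat \<Rightarrow> nat \<Rightarrow> nat \<Rightarrow> stacked_vertex \<Rightarrow> nat \<times> nat" where
  "stacked_row a b c (Upper i) = (a, i)"
| "stacked_row a b c (Middle i) = (b, i)"
| "stacked_row a b c (Lower i) = (c, i)"

lemma stacked_row_copy [simp]:
  "stacked_row a b c (upper_copy v) = row_copy a b v"
  "stacked_row a b c (lower_copy v) = row_copy b c v"
  "stacked_row a b c (outer_copy v) = row_copy a c v"
  by (cases v; simp)+

lemma inj_stacked_row: "distinct [a, b, c] \<Longrightarrow> inj (stacked_row a b c)"
  by (rule injI, case_tac x; case_tac y) auto

lemma stacked_edges_rows:
  "map_prod (stacked_row a b c) (stacked_row a b c) ` {(u, v). \<exists>B\<in>stacked_blocks x y. u \<in> B \<and> v \<in> B}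
    = row_edges a b x \<union> row_edges b c y" (is "?L = ?R")
proof
  show "?L \<subseteq> ?R"
  proof
    fix e assume "e \<in> ?L"
    then obtain u v B where e: "e = (stacked_row a b c u, stacked_row a b c v)"
      and B: "B \<in> stacked_blocks x y" "u \<in> B" "v \<in> B" by auto
    from B(1) consider C where "C \<in> x" "B = upper_copy ` C" | C where "C \<in> y" "B = lower_copy ` C"
      by (auto simp: stacked_blocks_def)
    then show "e \<in> ?R"
      by cases (use B(2,3) e in \<open>auto simp: row_edges_def\<close>)
  qed
  have "(row_copy a b u, row_copy a b v) \<in> ?L" if "B \<in> x" "u \<in> B" "v \<in> B" for u v B
    using that by (intro image_eqI[of _ _ "(upper_copy u, upper_copy v)"]) (auto simp: stacked_blocks_def)
  moreover have "(row_copy b c u, row_copy b c v) \<in> ?L" if "B \<in> y" "u \<in> B" "v \<in> B" for u v B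
    using that by (intro image_eqI[of _ _ "(lower_copy u, lower_copy v)"]) (auto simp: stacked_blocks_def)
  ultimately show "?R \<subseteq> ?L" by (auto simp: row_edges_def)
qed

lemma rtrancl_map_prod_inj:
  assumes "inj f"
  shows "(f u, f v) \<in> (map_prod f f ` E)\<^sup>* \<longleftrightarrow> (u, v) \<in> E\<^sup>*"
proof
  have "\<exists>w. z = f w \<and> (u, w) \<in> E\<^sup>*" if "(f u, z) \<in> (map_prod f f ` E)\<^sup>*" for z
    using that
  proof induction
    case (step y z)
    then show ?case using assms by (auto simp: inj_eq intro: rtrancl.rtrancl_into_rtrancl)
  qed blast
  then show "(u, v) \<in> E\<^sup>*" if "(f u, f v) \<in> (map_prod f f ` E)\<^sup>*"
    using that assms by (metis injD)
next
  show "(f u, f v) \<in> (map_prod f f ` E)\<^sup>*" if "(u, v) \<in> E\<^sup>*"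
    using that
  proof induction
    case (step y z)
    then have "(f y, f z) \<in> map_prod f f ` E" by force
    with step.IH show ?case by (rule rtrancl.rtrancl_into_rtrancl)
  qed simp
qed

lemma stacked_connected_rows:
  assumes "distinct [a, b, c]"
  shows "(outer_copy u, outer_copy v) \<in> stacked_connected x y \<longleftrightarrow>
    (row_copy a c u, row_copy a c v) \<in> (row_edges a b x \<union> row_edges b c y)\<^sup>*"
  using rtrancl_map_prod_inj[OF inj_stacked_row[OF assms], of "outer_copy u" "outer_copy v"
      "{(u, v). \<exists>B\<in>stacked_blocks x y. u \<in> B \<and> v \<in> B}"]
  unfolding stacked_connected_def stacked_row_copy
  by (simp only: stacked_edges_rows[of a b c x y, symmetric])

lemma equiv_stacked_connected: "equiv UNIV (stacked_connected x y)"
proof -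
  have "sym {(u, v). \<exists>B\<in>stacked_blocks x y. u \<in> B \<and> v \<in> B}" by (auto intro: symI)
  then show ?thesis
    unfolding stacked_connected_def
    by (intro equivI) (auto intro: sym_rtrancl refl_rtrancl trans_rtrancl)
qed

lemma brauer_mult_block:
  assumes "u \<in> vertices m" "v \<in> vertices m"
  shows "(\<exists>B\<in>brauer_mult m x y. u \<in> B \<and> v \<in> B) \<longleftrightarrow> (outer_copy u, outer_copy v) \<in> stacked_connected x y"
    (is "?L \<longleftrightarrow> ?R")
proof
  have E: "sym (stacked_connected x y)" "trans (stacked_connected x y)" "refl (stacked_connected x y)"
    using equiv_stacked_connected[of x y] by (auto simp: equiv_def)
  assume ?L
  then obtain w where "(outer_copy w, outer_copy u) \<in> stacked_connected x y"
    "(outer_copy w, outer_copy v) \<in> stacked_connected x y"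
    unfolding brauer_mult_def by blast
  then show ?R using E by (meson symD transD)
next
  assume ?R
  moreover have "(outer_copy u, outer_copy u) \<in> stacked_connected x y"
    by (simp add: stacked_connected_def)
  ultimately show ?L
    using assms by (intro bexI[of _ "{v \<in> vertices m. (outer_copy u, outer_copy v) \<in> stacked_connected x y}"])
      (auto simp: brauer_mult_def)
qed

lemma Union_brauer_mult: "\<Union> (brauer_mult m x y) = vertices m"
  by (auto simp: brauer_mult_def stacked_connected_def)

lemma row_copy_image_vertices: "row_copy a b ` vertices m = {a, b} \<times> {1..m}"
  by (auto simp: vertices_def image_Un image_image)

lemma Field_row_edges:
  assumes "\<Union>x = vertices m"
  shows "Field (row_edges a b x) = {a, b} \<times> {1..m}"
proof -
  have "Field (row_edges a b x) = row_copy a b ` \<Union>x"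
    by (auto simp: Field_def row_edges_def image_iff)
  then show ?thesis using assms by (simp add: row_copy_image_vertices)
qed

text \<open>The right-hand side is a trace as it occurs in \<open>rtrancl_coarsen\<close>: a product
  placed on rows \<open>a\<close> and \<open>c\<close> is the two-layer stack with row
  \<open>b\<close> forgotten.\<close>

lemma row_edges_brauer_mult:
  assumes "distinct [a, b, c]"
  shows "row_edges a c (brauer_mult m x y) =
    {(p, q). p \<in> {a, c} \<times> {1..m} \<and> q \<in> {a, c} \<times> {1..m} \<and>
     (p, q) \<in> (row_edges a b x \<union> row_edges b c y)\<^sup>*}" (is "?L = ?R")
proof -
  have block: "(\<exists>B\<in>brauer_mult m x y. u \<in> B \<and> v \<in> B) \<longleftrightarrow> u \<in> vertices m \<and> v \<in> vertices m \<and>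
      (row_copy a c u, row_copy a c v) \<in> (row_edges a b x \<union> row_edges b c y)\<^sup>*" for u v
    using brauer_mult_block[of u m v x y] stacked_connected_rows[OF assms, of u v x y]
      Union_brauer_mult[of m x y] by auto
  show ?thesis
    unfolding row_edges_def[of a c] block row_copy_image_vertices[of a c m, symmetric] by auto blast
qed

lemma brauer_mult_assoc:
  assumes "\<Union>x = vertices m" "\<Union>y = vertices m" "\<Union>z = vertices m"
  shows "brauer_mult m (brauer_mult m x y) z = brauer_mult m x (brauer_mult m y z)"
proof -
  let ?E = "row_edges 1 2 x" and ?F = "row_edges 2 3 y" and ?G = "row_edges 3 4 z"
  have "(outer_copy u, outer_copy v) \<in> stacked_connected (brauer_mult m x y) z \<longleftrightarrow>
      (outer_copy u, outer_copy v) \<in> stacked_connected x (brauer_mult m y z)"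
    if "u \<in> vertices m" "v \<in> vertices m" for u v
  proof -
    let ?u = "row_copy 1 4 u" and ?v = "row_copy 1 4 v"
    have uv: "?u \<in> {1, 4} \<times> {1..m}" "?v \<in> {1, 4} \<times> {1..m}"
      using that row_copy_image_vertices[of 1 4 m] by blast+
    have "(outer_copy u, outer_copy v) \<in> stacked_connected (brauer_mult m x y) z \<longleftrightarrow>
        (?u, ?v) \<in> (row_edges 1 3 (brauer_mult m x y) \<union> ?G)\<^sup>*"
      by (rule stacked_connected_rows) simp
    \<comment> \<open>Row 2 is interior to the product of \<open>x\<close> and \<open>y\<close>, so
      the rows kept are 1, 3 and 4, of which the product touches 1 and 3. For the other bracketing
      row 3 is the interior one.\<close>
    also have "\<dots> \<longleftrightarrow> (?u, ?v) \<in> (?E \<union> ?F \<union> ?G)\<^sup>*"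
      by (subst row_edges_brauer_mult[of 1 2 3], simp,
          rule rtrancl_coarsen[where V = "{1, 3, 4} \<times> {1..m}", symmetric])
        (use uv in \<open>auto simp: Field_row_edges assms\<close>)
    also have "\<dots> \<longleftrightarrow> (?u, ?v) \<in> (?F \<union> ?G \<union> ?E)\<^sup>*" by (simp only: Un_ac)
    also have "\<dots> \<longleftrightarrow> (?u, ?v) \<in> (row_edges 2 4 (brauer_mult m y z) \<union> ?E)\<^sup>*"
      by (subst row_edges_brauer_mult[of 2 3 4], simp,
          rule rtrancl_coarsen[where V = "{1, 2, 4} \<times> {1..m}"])
        (use uv in \<open>auto simp: Field_row_edges assms\<close>)
    also have "\<dots> \<longleftrightarrow> (?u, ?v) \<in> (?E \<union> row_edges 2 4 (brauer_mult m y z))\<^sup>*" by (simp only: Un_ac)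
    also have "\<dots> \<longleftrightarrow> (outer_copy u, outer_copy v) \<in> stacked_connected x (brauer_mult m y z)"
      by (rule stacked_connected_rows[symmetric]) simp
    finally show ?thesis .
  qed
  then have eq: "{v \<in> vertices m. (outer_copy u, outer_copy v) \<in> stacked_connected (brauer_mult m x y) z} =
      {v \<in> vertices m. (outer_copy u, outer_copy v) \<in> stacked_connected x (brauer_mult m y z)}"
    if "u \<in> vertices m" for u
    using that by blast
  show ?thesis
    unfolding brauer_mult_def[of m "brauer_mult m x y"] brauer_mult_def[of m x "brauer_mult m y z"]
      setcompr_eq_image
    using eq by (intro image_cong) auto
qed

section \<open>Closure of perfect matchings under stacking\<close>

lemma finite_vertices [simp]: "finite (vertices m)"
  by (simp add: vertices_def)

lemma perfect_matchingsD:
  assumes "x \<in> perfect_matchings m"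
  shows "partition_on (vertices m) x" "\<Union>x = vertices m" "disjoint x" "\<forall>B\<in>x. card B = 2"
  using assms by (auto simp: perfect_matchings_def partition_on_def)

text \<open>The point is that blocks have two elements. The middle row is covered by both copies,
  hence the vertices covered by exactly one copy are the outer ones, and
  \<open>two_matchings_component\<close> counts two of them in each component that reaches an outer
  row.\<close>

lemma brauer_mult_closed:
  assumes x: "x \<in> perfect_matchings m" and y: "y \<in> perfect_matchings m"
  shows "brauer_mult m x y \<in> perfect_matchings m"
proof -
  note xD = perfect_matchingsD[OF x] and yD = perfect_matchingsD[OF y]
  let ?P = "(`) upper_copy ` x" and ?Q = "(`) lower_copy ` y"
  let ?class = "\<lambda>u. {v \<in> vertices m. (outer_copy u, outer_copy v) \<in> stacked_connected x y}"
  have inj: "inj_on upper_copy A" "inj_on lower_copy A" "inj_on outer_copy A" for A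
    by (rule inj_onI, case_tac x; case_tac y; simp)+
  have UP: "\<Union>?P = Upper ` {1..m} \<union> Middle ` {1..m}"
  proof -
    have "\<Union>?P = upper_copy ` \<Union>x" by blast
    then show ?thesis by (simp add: xD(2) vertices_def image_Un image_image)
  qed
  have UQ: "\<Union>?Q = Middle ` {1..m} \<union> Lower ` {1..m}"
  proof -
    have "\<Union>?Q = lower_copy ` \<Union>y" by blast
    then show ?thesis by (simp add: yD(2) vertices_def image_Un image_image)
  qed
  have outer: "\<Union>?P \<union> \<Union>?Q - \<Union>?P \<inter> \<Union>?Q = outer_copy ` vertices m"
  proof -
    have "outer_copy ` vertices m = Upper ` {1..m} \<union> Lower ` {1..m}"
      by (simp add: vertices_def image_Un image_image)
    then show ?thesis unfolding UP UQ by auto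
  qed
  have P: "disjoint ?P" "\<forall>B\<in>?P. card B = 2" "finite (\<Union>?P)"
    using xD by (auto simp: UP card_image inj intro!: disjoint_image)
  have Q: "disjoint ?Q" "\<forall>B\<in>?Q. card B = 2" "finite (\<Union>?Q)"
    using yD by (auto simp: UQ card_image inj intro!: disjoint_image)
  have "card (?class u) = 2" if u: "u \<in> vertices m" for u
  proof -
    have "card (?class u) = card (outer_copy ` ?class u)"
      by (intro card_image[symmetric] inj)
    also have "outer_copy ` ?class u = {v \<in> outer_copy ` vertices m. (outer_copy u, v) \<in> stacked_connected x y}"
      by blast
    also have "card \<dots> = 2"
      using two_matchings_component[OF P Q, of "outer_copy u"] u
      unfolding outer stacked_connected_def stacked_blocks_def by blast
    finally show ?thesis .
  qed
  moreover have "?class u = ?class v" if "w \<in> ?class u" "w \<in> ?class v" for u v w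
    using that equiv_stacked_connected[of x y] by (auto simp: equiv_def dest: symD transD) 
  then have "disjoint (brauer_mult m x y)"
    unfolding brauer_mult_def by (intro disjointI) blast
  moreover have "{} \<notin> brauer_mult m x y"
    by (auto simp: brauer_mult_def stacked_connected_def)
  ultimately show ?thesis
    using Union_brauer_mult[of m x y]
    by (auto simp: perfect_matchings_def partition_on_def brauer_mult_def)
qed

section \<open>Stacking with the matching of a permutation\<close>

primrec relabel :: "(nat \<Rightarrow> nat) \<Rightarrow> (nat \<Rightarrow> nat) \<Rightarrow> vertex \<Rightarrow> vertex" where
  "relabel p q (Top i) = Top (p i)"
| "relabel p q (Bot i) = Bot (q i)"

lemma relabel_id [simp]: "relabel id id = id"
  by (rule ext, case_tac x) auto

lemma relabel_relabel: "relabel p q (relabel p' q' v) = relabel (p \<circ> p') (q \<circ> q') v"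
  by (cases v) auto

lemma perm_matching_image: "perm_matching m p = (\<lambda>i. {Top (p i), Bot i}) ` {1..m}"
  by (auto simp: perm_matching_def)

lemma perm_matching_relabel:
  "perm_matching m p = (`) (relabel p id) ` perm_matching m id"
  by (simp add: perm_matching_image image_image)

lemma relabel_vertices:
  assumes "p permutes {1..m}" "q permutes {1..m}"
  shows "relabel p q ` vertices m = vertices m"
  using permutes_image[OF assms(1)] permutes_image[OF assms(2)]
  by (simp add: vertices_def image_Un image_image flip: image_image[of Top p] image_image[of Bot q])

lemma relabel_matching:
  assumes x: "x \<in> perfect_matchings m" and pq: "p permutes {1..m}" "q permutes {1..m}"
  shows "(`) (relabel p q) ` x \<in> perfect_matchings m"
proof -
  note xD = perfect_matchingsD[OF x]
  have "inj (relabel p q)"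
    using permutes_inj[OF pq(1)] permutes_inj[OF pq(2)]
    by (intro injI, case_tac x; case_tac y) (auto dest: injD)
  then have inj: "inj_on (relabel p q) A" for A by (rule inj_on_subset) simp
  have "\<Union> ((`) (relabel p q) ` x) = vertices m"
    using relabel_vertices[OF pq] xD(2) by (metis image_Union)
  moreover have "disjoint ((`) (relabel p q) ` x)"
    by (intro disjoint_image inj xD)
  moreover have "card (relabel p q ` B) = 2" if "B \<in> x" for B
    using xD(4) that by (simp add: card_image inj)
  moreover have "{} \<notin> x" using xD(1) by (simp add: partition_on_def)
  ultimately show ?thesis by (auto simp: perfect_matchings_def partition_on_def)
qed

lemma perm_matching_closed:
  assumes "p permutes {1..m}"
  shows "perm_matching m p \<in> perfect_matchings m"
proof -
  have "\<Union> (perm_matching m id) = vertices m" by (auto simp: perm_matching_image vertices_def)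
  moreover have "disjoint (perm_matching m id)"
    by (intro disjointI) (auto simp: perm_matching_def)
  ultimately have "perm_matching m id \<in> perfect_matchings m"
    by (auto simp: perfect_matchings_def partition_on_def perm_matching_def)
  then show ?thesis
    unfolding perm_matching_relabel[of m p] using assms by (intro relabel_matching permutes_id)
qed

lemma partition_on_eqI:
  assumes P: "partition_on A P" and Q: "partition_on A Q"
    and eq: "\<And>u v. \<lbrakk>u \<in> A; v \<in> A\<rbrakk> \<Longrightarrow> (\<exists>B\<in>P. u \<in> B \<and> v \<in> B) \<longleftrightarrow> (\<exists>B\<in>Q. u \<in> B \<and> v \<in> B)"
  shows "P = Q"
proof -
  have "P \<subseteq> Q"
    if P: "partition_on A P" and Q: "partition_on A Q"
      and eq: "\<And>u v. \<lbrakk>u \<in> A; v \<in> A\<rbrakk> \<Longrightarrow> (\<exists>B\<in>P. u \<in> B \<and> v \<in> B) \<longleftrightarrow> (\<exists>B\<in>Q. u \<in> B \<and> v \<in> B)" for P Q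
  proof
    fix B assume B: "B \<in> P"
    then obtain u where u: "u \<in> B" using P by (metis all_not_in_conv partition_on_def)
    have BA: "B \<subseteq> A" using P B by (auto simp: partition_on_def)
    then obtain C where C: "C \<in> Q" "u \<in> C" using u Q by (auto simp: partition_on_def)
    have CA: "C \<subseteq> A" using Q C by (auto simp: partition_on_def)
    have "v \<in> B \<longleftrightarrow> (\<exists>B\<in>P. u \<in> B \<and> v \<in> B)" for v
      using P B u by (auto simp: partition_on_def dest: disjointD)
    moreover have "v \<in> C \<longleftrightarrow> (\<exists>B\<in>Q. u \<in> B \<and> v \<in> B)" for v
      using Q C by (auto simp: partition_on_def dest: disjointD)
    ultimately have "v \<in> B \<longleftrightarrow> v \<in> C" if "v \<in> A" for v using eq[OF _ that, of u] BA u by blast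
    then have "B = C" using BA CA by blast
    then show "B \<in> Q" using C by simp
  qed
  from this[OF P Q eq] this[OF Q P eq[symmetric]] show ?thesis by blast
qed

text \<open>A retraction argument: \<open>c\<close> maps the stack to a single diagram and respects
  edges, \<open>d\<close> puts the diagram back into the stack, and \<open>u\<close>,
  \<open>v\<close> are connected to their images. Connectivity in the stack can then be read off in
  the diagram.\<close>

lemma rtrancl_collapse:
  assumes edge: "\<And>w w'. (w, w') \<in> E \<Longrightarrow> (c w, c w') \<in> r" and r: "refl r" "trans r"
    and d: "\<And>a b. (a, b) \<in> r \<Longrightarrow> (d a, d b) \<in> E\<^sup>*"
    and uv: "(u, d (c u)) \<in> E\<^sup>*" "(d (c v), v) \<in> E\<^sup>*"
  shows "(u, v) \<in> E\<^sup>* \<longleftrightarrow> (c u, c v) \<in> r"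
proof
  assume "(u, v) \<in> E\<^sup>*"
  then show "(c u, c v) \<in> r"
  proof induction
    case base
    show ?case using r(1) by (simp add: refl_on_def)
  next
    case (step y z)
    then show ?case using edge r(2) by (meson transD)
  qed
next
  assume "(c u, c v) \<in> r"
  then show "(u, v) \<in> E\<^sup>*" using d uv by (meson rtrancl_trans)
qed

lemma image_blocks:
  assumes "\<And>v. f (g v) = v" "\<And>v. g (f v) = v"
  shows "(\<exists>B\<in>(`) f ` x. u \<in> B \<and> v \<in> B) \<longleftrightarrow> (\<exists>B\<in>x. g u \<in> B \<and> g v \<in> B)"
proof -
  have "u \<in> f ` B \<longleftrightarrow> g u \<in> B" for u B
    using assms by (metis image_iff)
  then show ?thesis by simp
qed

text \<open>Sharing a block is reflexive only on covered vertices. The reflexive closure makes it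
  reflexive on the whole type, as \<open>rtrancl_collapse\<close> demands.\<close>

lemma trans_same_block:
  assumes "disjoint x"
  shows "trans ({(a, b). \<exists>B\<in>x. a \<in> B \<and> b \<in> B}\<^sup>=)"
proof (rule transI)
  fix a b c
  assume ab: "(a, b) \<in> {(a, b). \<exists>B\<in>x. a \<in> B \<and> b \<in> B}\<^sup>="
    and bc: "(b, c) \<in> {(a, b). \<exists>B\<in>x. a \<in> B \<and> b \<in> B}\<^sup>="
  show "(a, c) \<in> {(a, b). \<exists>B\<in>x. a \<in> B \<and> b \<in> B}\<^sup>="
  proof (cases "a = b \<or> b = c")
    case False
    then obtain B C where "B \<in> x" "a \<in> B" "b \<in> B" "C \<in> x" "b \<in> C" "c \<in> C" using ab bc by auto
    moreover from this have "B = C" using disjointD[OF assms, of B C] by blast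
    ultimately show ?thesis by blast
  qed (use ab bc in auto)
qed

lemma stacked_connectedI:
  shows "\<lbrakk>B \<in> x; u \<in> B; v \<in> B\<rbrakk> \<Longrightarrow> (upper_copy u, upper_copy v) \<in> stacked_connected x y"
    and "\<lbrakk>B \<in> y; u \<in> B; v \<in> B\<rbrakk> \<Longrightarrow> (lower_copy u, lower_copy v) \<in> stacked_connected x y"
  unfolding stacked_connected_def stacked_blocks_def
  by (rule r_into_rtrancl, rule CollectI, rule case_prodI, blast)+

text \<open>The upper layer consists of strands from \<open>Upper (p i)\<close> to
  \<open>Middle i\<close>. Sliding the upper row down along them contracts the stack to
  \<open>x\<close>, with the top row renamed by \<open>p\<close>.\<close>

lemma brauer_mult_perm_left:
  assumes p: "p permutes {1..m}" and x: "x \<in> perfect_matchings m"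
  shows "brauer_mult m (perm_matching m p) x = (`) (relabel p id) ` x"
proof (rule partition_on_eqI[of "vertices m"])
  show "partition_on (vertices m) (brauer_mult m (perm_matching m p) x)"
    by (intro perfect_matchingsD(1) brauer_mult_closed perm_matching_closed p x)
  show "partition_on (vertices m) ((`) (relabel p id) ` x)"
    by (intro perfect_matchingsD(1) relabel_matching permutes_id p x)
  fix u v assume uv: "u \<in> vertices m" "v \<in> vertices m"
  define p' where "p' = Hilbert_Choice.inv p"
  have inv: "p' (p i) = i" "p (p' i) = i" for i
    using permutes_inverses[OF p] by (auto simp: p'_def)
  have p': "p' permutes {1..m}" unfolding p'_def by (rule permutes_inv[OF p])
  let ?E = "{(u, v). \<exists>B\<in>stacked_blocks (perm_matching m p) x. u \<in> B \<and> v \<in> B}"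
  let ?r = "{(a, b). \<exists>B\<in>x. a \<in> B \<and> b \<in> B}"
  \<comment> \<open>The inverse \<open>p'\<close> appears because the strand starting at
    \<open>Upper j\<close> ends at \<open>Middle (p' j)\<close>.\<close>
  define c where "c = case_stacked_vertex (Top \<circ> p') Top Bot"
  have c_simps: "c (outer_copy w) = relabel p' id w" "c (lower_copy w) = w" for w
    by (cases w; simp add: c_def)+
  have block: "(outer_copy w, lower_copy (relabel p' id w)) \<in> ?E\<^sup>* \<and> (lower_copy (relabel p' id w), outer_copy w) \<in> ?E\<^sup>*"
    if "w \<in> vertices m" for w
  proof (cases w)
    case (Top i)
    then have "i \<in> {1..m}" using that by (auto simp: vertices_def)
    then have "p' i \<in> {1..m}" by (simp only: permutes_in_image[OF p'])
    then have "{Top (p (p' i)), Bot (p' i)} \<in> perm_matching m p"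
      by (simp add: perm_matching_image image_eqI[of _ _ "p' i"])
    note stacked_connectedI(1)[OF this, where y = x, unfolded stacked_connected_def]
    from this[of "Top i" "Bot (p' i)"] this[of "Bot (p' i)" "Top i"] show ?thesis using Top inv by simp
  qed auto
  have "(outer_copy u, outer_copy v) \<in> ?E\<^sup>* \<longleftrightarrow> (c (outer_copy u), c (outer_copy v)) \<in> ?r\<^sup>="
  proof (rule rtrancl_collapse[where d = lower_copy])
    show "trans (?r\<^sup>=)" by (rule trans_same_block[OF perfect_matchingsD(3)[OF x]])
    show "(lower_copy a, lower_copy b) \<in> ?E\<^sup>*" if "(a, b) \<in> ?r\<^sup>=" for a b
      using that stacked_connectedI(2)[of _ x, unfolded stacked_connected_def] by auto
    show "(c w, c w') \<in> ?r\<^sup>=" if E: "(w, w') \<in> ?E" for w w'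
    proof -
      obtain B where "B \<in> stacked_blocks (perm_matching m p) x" and w: "w \<in> B" "w' \<in> B" using E by blast
      then consider i where "B = {Upper (p i), Middle i}" | C where "C \<in> x" "B = lower_copy ` C"
        by (auto simp: stacked_blocks_def perm_matching_def)
      then show ?thesis
      proof cases
        case 1
        then show ?thesis using w inv by (auto simp: c_def)
      next
        case 2
        then show ?thesis using w by (auto simp: c_simps)
      qed
    qed
  qed (use block uv in \<open>auto simp: c_simps\<close>)
  also have "\<dots> \<longleftrightarrow> (relabel p' id u, relabel p' id v) \<in> ?r"
  proof -
    have "relabel p' id u \<in> \<Union>x"
      using relabel_vertices[OF p' permutes_id] uv(1) perfect_matchingsD(2)[OF x] by blast
    then show ?thesis by (auto simp: c_simps)
  qed
  also have "\<dots> \<longleftrightarrow> (\<exists>B\<in>(`) (relabel p id) ` x. u \<in> B \<and> v \<in> B)"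
    by (subst image_blocks[of "relabel p id" "relabel p' id"])
      (simp_all add: relabel_relabel inv comp_def flip: id_def)
  finally show "(\<exists>B\<in>brauer_mult m (perm_matching m p) x. u \<in> B \<and> v \<in> B) \<longleftrightarrow>
      (\<exists>B\<in>(`) (relabel p id) ` x. u \<in> B \<and> v \<in> B)"
    unfolding brauer_mult_block[OF uv] stacked_connected_def .
qed

text \<open>The mirror image. \<open>Lower i\<close> is joined to \<open>Middle (p i)\<close>, so a
  bottom vertex \<open>k\<close> of \<open>x\<close> emerges at position \<open>inv p k\<close>;
  this is why the inverse appears on this side only.\<close>

lemma brauer_mult_perm_right:
  assumes p: "p permutes {1..m}" and x: "x \<in> perfect_matchings m"
  shows "brauer_mult m x (perm_matching m p) = (`) (relabel id (Hilbert_Choice.inv p)) ` x"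
proof (rule partition_on_eqI[of "vertices m"])
  show "partition_on (vertices m) (brauer_mult m x (perm_matching m p))"
    by (intro perfect_matchingsD(1) brauer_mult_closed perm_matching_closed p x)
  show "partition_on (vertices m) ((`) (relabel id (Hilbert_Choice.inv p)) ` x)"
    by (intro perfect_matchingsD(1) relabel_matching permutes_id permutes_inv p x)
  fix u v assume uv: "u \<in> vertices m" "v \<in> vertices m"
  let ?E = "{(u, v). \<exists>B\<in>stacked_blocks x (perm_matching m p). u \<in> B \<and> v \<in> B}"
  let ?r = "{(a, b). \<exists>B\<in>x. a \<in> B \<and> b \<in> B}"
  define c where "c = case_stacked_vertex Top Bot (Bot \<circ> p)"
  have c_simps: "c (outer_copy w) = relabel id p w" "c (upper_copy w) = w" for w
    by (cases w; simp add: c_def)+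
  have block: "(outer_copy w, upper_copy (relabel id p w)) \<in> ?E\<^sup>* \<and> (upper_copy (relabel id p w), outer_copy w) \<in> ?E\<^sup>*"
    if "w \<in> vertices m" for w
  proof (cases w)
    case (Bot i)
    then have "{Top (p i), Bot i} \<in> perm_matching m p" using that by (auto simp: vertices_def perm_matching_image)
    note stacked_connectedI(2)[OF this, where x = x, unfolded stacked_connected_def]
    from this[of "Top (p i)" "Bot i"] this[of "Bot i" "Top (p i)"] show ?thesis using Bot by simp
  qed auto
  have "(outer_copy u, outer_copy v) \<in> ?E\<^sup>* \<longleftrightarrow> (c (outer_copy u), c (outer_copy v)) \<in> ?r\<^sup>="
  proof (rule rtrancl_collapse[where d = upper_copy])
    show "trans (?r\<^sup>=)" by (rule trans_same_block[OF perfect_matchingsD(3)[OF x]])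
    show "(upper_copy a, upper_copy b) \<in> ?E\<^sup>*" if "(a, b) \<in> ?r\<^sup>=" for a b
      using that stacked_connectedI(1)[of _ x, unfolded stacked_connected_def] by auto
    show "(c w, c w') \<in> ?r\<^sup>=" if E: "(w, w') \<in> ?E" for w w'
    proof -
      obtain B where "B \<in> stacked_blocks x (perm_matching m p)" and w: "w \<in> B" "w' \<in> B" using E by blast
      then consider i where "B = {Middle (p i), Lower i}" | C where "C \<in> x" "B = upper_copy ` C"
        by (auto simp: stacked_blocks_def perm_matching_def)
      then show ?thesis
      proof cases
        case 1
        then show ?thesis using w by (auto simp: c_def)
      next
        case 2
        then show ?thesis using w by (auto simp: c_simps)
      qed
    qed
  qed (use block uv in \<open>auto simp: c_simps\<close>)
  also have "\<dots> \<longleftrightarrow> (relabel id p u, relabel id p v) \<in> ?r"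
  proof -
    have "relabel id p u \<in> \<Union>x"
      using relabel_vertices[OF permutes_id p] uv(1) perfect_matchingsD(2)[OF x] by blast
    then show ?thesis by (auto simp: c_simps)
  qed
  also have "\<dots> \<longleftrightarrow> (\<exists>B\<in>(`) (relabel id (Hilbert_Choice.inv p)) ` x. u \<in> B \<and> v \<in> B)"
    by (subst image_blocks[of "relabel id (Hilbert_Choice.inv p)" "relabel id p"])
      (simp_all add: relabel_relabel permutes_inv_o[OF p])
  finally show "(\<exists>B\<in>brauer_mult m x (perm_matching m p). u \<in> B \<and> v \<in> B) \<longleftrightarrow>
      (\<exists>B\<in>(`) (relabel id (Hilbert_Choice.inv p)) ` x. u \<in> B \<and> v \<in> B)"
    unfolding brauer_mult_block[OF uv] stacked_connected_def .
qed

lemma perm_matching_comp: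
  assumes "p permutes {1..m}" "q permutes {1..m}"
  shows "brauer_mult m (perm_matching m p) (perm_matching m q) = perm_matching m (p \<circ> q)"
proof -
  have "(`) (relabel p id) ` perm_matching m q = perm_matching m (p \<circ> q)"
    by (simp add: perm_matching_image image_image)
  then show ?thesis using assms by (simp add: brauer_mult_perm_left perm_matching_closed)
qed

section \<open>The monoid structure and its units\<close>

lemma brauer_monoid_simps [simp]:
  "carrier (brauer_monoid m) = perfect_matchings m"
  "x \<otimes>\<^bsub>brauer_monoid m\<^esub> y = brauer_mult m x y"
  "\<one>\<^bsub>brauer_monoid m\<^esub> = perm_matching m id"
  by (simp_all add: brauer_monoid_def)

lemma monoid_brauer_monoid: "monoid (brauer_monoid m)"
proof (rule monoidI)
  fix x y z
  assume "x \<in> carrier (brauer_monoid m)" "y \<in> carrier (brauer_monoid m)" "z \<in> carrier (brauer_monoid m)"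
  then show "x \<otimes>\<^bsub>brauer_monoid m\<^esub> y \<otimes>\<^bsub>brauer_monoid m\<^esub> z =
      x \<otimes>\<^bsub>brauer_monoid m\<^esub> (y \<otimes>\<^bsub>brauer_monoid m\<^esub> z)"
    by (simp add: brauer_mult_assoc perfect_matchingsD(2))
qed (simp_all add: brauer_mult_closed perm_matching_closed brauer_mult_perm_left brauer_mult_perm_right
    permutes_id inv_id)

lemma inj_perm_matching: "inj_on (perm_matching m) {p. p permutes {1..m}}"
proof (rule inj_onI, unfold mem_Collect_eq)
  fix p q assume p: "p permutes {1..m}" and q: "q permutes {1..m}"
    and eq: "perm_matching m p = perm_matching m q"
  have "p i = q i" if "i \<in> {1..m}" for i
  proof -
    have "{Top (p i), Bot i} \<in> perm_matching m q" unfolding eq[symmetric] using that by (auto simp: perm_matching_def)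
    then show ?thesis by (auto simp: perm_matching_def doubleton_eq_iff)
  qed
  then show "p = q" using p q by (metis ext permutes_not_in)
qed

lemma perm_matching_Units:
  assumes p: "p permutes {1..m}"
  shows "perm_matching m p \<in> Units (brauer_monoid m)"
  unfolding Units_def
  using p permutes_inv[OF p]
  by (auto simp: perm_matching_comp perm_matching_closed permutes_inv_o[OF p]
      intro!: bexI[of _ "perm_matching m (Hilbert_Choice.inv p)"])

text \<open>If all bottom vertices have partners in the top row, the partner map is a permutation.
  Otherwise some block \<open>{Bot k, Bot l}\<close> exists. If all top vertices had bottom
  partners, these would exhaust the bottom row by finiteness, \<open>Bot k\<close> included, which
  is absurd; so there is a block inside the top row as well. Both blocks are delivered together
  because products with the antisymmetrizer must vanish on both sides.\<close>

lemma matching_cases: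
  assumes x: "x \<in> perfect_matchings m"
  obtains (perm) p where "p permutes {1..m}" "x = perm_matching m p"
  | (nonperm) i j k l where "i \<in> {1..m}" "j \<in> {1..m}" "i \<noteq> j" "{Top i, Top j} \<in> x"
    "k \<in> {1..m}" "l \<in> {1..m}" "k \<noteq> l" "{Bot k, Bot l} \<in> x"
proof -
  note xD = perfect_matchingsD[OF x]
  have block: "{v, partner x v} \<in> x" "partner x v \<in> vertices m" "partner x v \<noteq> v" if v: "v \<in> vertices m" for v
  proof -
    obtain B where B: "B \<in> x" "v \<in> B" using v xD(2) by blast
    note partner_block[OF xD(3,4) B]
    then show "{v, partner x v} \<in> x" "partner x v \<in> vertices m" "partner x v \<noteq> v"
      using B xD(2) by auto
  qed
  have inj: "partner x v = partner x w \<longleftrightarrow> v = w" for v w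
    using partner_partner[OF xD(3,4)] by metis
  \<comment> \<open>Used for \<open>Bot\<close>, \<open>Top\<close> in either order: an injective
    self-map of a finite set is a permutation.\<close>
  have bij: "\<exists>q. q permutes {1..m} \<and> (\<forall>i\<in>{1..m}. partner x (f i) = g (q i))"
    if f: "inj f" "f ` {1..m} \<subseteq> vertices m" and g: "\<forall>i\<in>{1..m}. partner x (f i) \<in> g ` {1..m}"
    for f g :: "nat \<Rightarrow> vertex"
  proof -
    have "\<forall>i\<in>{1..m}. \<exists>k. k \<in> {1..m} \<and> partner x (f i) = g k" using g by blast
    then obtain q where q: "\<forall>i\<in>{1..m}. q i \<in> {1..m} \<and> partner x (f i) = g (q i)"
      by (rule bchoice[THEN exE])
    define q' where "q' i = (if i \<in> {1..m} then q i else i)" for i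
    have "inj_on q' {1..m}"
    proof (rule inj_onI)
      fix i k assume ik: "i \<in> {1..m}" "k \<in> {1..m}" "q' i = q' k"
      then have "partner x (f i) = partner x (f k)" using q by (simp add: q'_def)
      then show "i = k" using inj f(1) by (simp add: inj_eq)
    qed
    moreover have "q' ` {1..m} \<subseteq> {1..m}" using q by (auto simp: q'_def)
    ultimately have "bij_betw q' {1..m} {1..m}"
      by (metis bij_betw_def endo_inj_surj finite_atLeastAtMost)
    then have "q' permutes {1..m}" by (rule bij_imp_permutes) (auto simp: q'_def)
    then show ?thesis using q by (intro exI[of _ q']) (auto simp: q'_def)
  qed
  show thesis
  proof (cases "\<forall>i\<in>{1..m}. partner x (Bot i) \<in> Top ` {1..m}")
    case True
    have "inj Bot" by (auto intro: injI)
    moreover have "Bot ` {1..m} \<subseteq> vertices m" by (auto simp: vertices_def)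
    ultimately obtain q where q: "q permutes {1..m}" "\<forall>i\<in>{1..m}. partner x (Bot i) = Top (q i)"
      using bij[of Bot Top] True by blast
    have "{Top (q i), Bot i} \<in> x" if "i \<in> {1..m}" for i
      using block(1)[of "Bot i"] q(2) that by (auto simp: vertices_def insert_commute)
    then have sub: "perm_matching m q \<subseteq> x" by (auto simp: perm_matching_def)
    have "x \<subseteq> perm_matching m q"
    proof
      fix B assume B: "B \<in> x"
      then obtain v where v: "v \<in> B" "v \<in> vertices m" using xD(2,4) by (metis UnionI card.empty equals0I zero_neq_numeral)
      then obtain C where "C \<in> perm_matching m q" "v \<in> C"
        using perfect_matchingsD(2)[OF perm_matching_closed[OF q(1)]] by blast
      then show "B \<in> perm_matching m q" using sub B v disjointD[OF xD(3), of B C] by blast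
    qed
    then show thesis using perm[OF q(1)] sub by blast
  next
    case False
    then obtain k where k: "k \<in> {1..m}" "partner x (Bot k) \<notin> Top ` {1..m}" by blast
    then obtain l where l: "l \<in> {1..m}" "partner x (Bot k) = Bot l"
      using block(2)[of "Bot k"] by (auto simp: vertices_def)
    have kl: "{Bot k, Bot l} \<in> x" "k \<noteq> l"
      using block[of "Bot k"] k l by (auto simp: vertices_def)
    have "\<not> (\<forall>i\<in>{1..m}. partner x (Top i) \<in> Bot ` {1..m})"
    proof
      assume *: "\<forall>i\<in>{1..m}. partner x (Top i) \<in> Bot ` {1..m}"
      have "inj Top" by (auto intro: injI)
      moreover have "Top ` {1..m} \<subseteq> vertices m" by (auto simp: vertices_def)
      ultimately obtain q where q: "q permutes {1..m}" "\<forall>i\<in>{1..m}. partner x (Top i) = Bot (q i)"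
        using bij[of Top Bot] * by blast
      obtain i where "i \<in> {1..m}" "q i = k" using permutes_image[OF q(1)] k(1) by (metis imageE)
      then have "partner x (Bot k) = Top i" using q(2) partner_partner[OF xD(3,4)] by metis
      then show False using l(2) by simp
    qed
    then obtain i where i: "i \<in> {1..m}" "partner x (Top i) \<notin> Bot ` {1..m}" by blast
    then obtain j where j: "j \<in> {1..m}" "partner x (Top i) = Top j"
      using block(2)[of "Top i"] by (auto simp: vertices_def)
    have "{Top i, Top j} \<in> x" "i \<noteq> j"
      using block[of "Top i"] i j by (auto simp: vertices_def)
    then show thesis using nonperm i(1) j(1) k(1) l(1) kl by blast
  qed
qed

lemma image_swap_block:
  assumes "disjoint x" "{a, b} \<in> x" "f a = b" "f b = a" "\<And>v. v \<notin> {a, b} \<Longrightarrow> f v = v"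
  shows "(`) f ` x = x"
proof -
  have "f ` B = B" if "B \<in> x" for B
  proof (cases "B = {a, b}")
    case False
    then have "B \<inter> {a, b} = {}" using disjointD[OF assms(1) that assms(2)] by blast
    then have "f v = v" if "v \<in> B" for v using assms(5) that by blast
    then show ?thesis by simp
  qed (use assms(3,4) in auto)
  then show ?thesis by simp
qed

text \<open>The transposition exchanges the two ends of a single block and fixes all other vertices,
  which an unordered block does not notice.\<close>

lemma brauer_mult_swap:
  assumes x: "x \<in> perfect_matchings m" and ij: "i \<in> {1..m}" "j \<in> {1..m}"
  shows "{Top i, Top j} \<in> x \<Longrightarrow> brauer_mult m (perm_matching m (transpose i j)) x = x"
    and "{Bot i, Bot j} \<in> x \<Longrightarrow> brauer_mult m x (perm_matching m (transpose i j)) = x"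
proof -
  note p = permutes_swap_id[OF ij]
  note d = perfect_matchingsD(3)[OF x]
  show "brauer_mult m (perm_matching m (transpose i j)) x = x" if "{Top i, Top j} \<in> x"
    unfolding brauer_mult_perm_left[OF p x]
    by (rule image_swap_block[OF d that]) (auto, case_tac v, auto simp: transpose_def)
  show "brauer_mult m x (perm_matching m (transpose i j)) = x" if "{Bot i, Bot j} \<in> x"
    unfolding brauer_mult_perm_right[OF p x] inv_transpose_eq
    by (rule image_swap_block[OF d that]) (auto, case_tac v, auto simp: transpose_def)
qed

text \<open>A matching \<open>x\<close> with a block inside the bottom row satisfies
  \<open>x t = x\<close> for a transposition \<open>t\<close>. If \<open>x\<close> were a unit,
  cancelling it would give \<open>t = id\<close>.\<close>

lemma Units_brauer_monoid: "Units (brauer_monoid m) = perm_matching m ` {p. p permutes {1..m}}"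
proof
  show "perm_matching m ` {p. p permutes {1..m}} \<subseteq> Units (brauer_monoid m)"
    using perm_matching_Units by blast
  interpret monoid "brauer_monoid m" by (rule monoid_brauer_monoid)
  show "Units (brauer_monoid m) \<subseteq> perm_matching m ` {p. p permutes {1..m}}"
  proof
    fix x assume U: "x \<in> Units (brauer_monoid m)"
    then have x: "x \<in> perfect_matchings m" using Units_closed by simp
    then show "x \<in> perm_matching m ` {p. p permutes {1..m}}"
    proof (cases rule: matching_cases)
      case (nonperm i j k l)
      let ?t = "perm_matching m (transpose k l)"
      have t: "?t \<in> perfect_matchings m" by (intro perm_matching_closed permutes_swap_id nonperm)
      have "brauer_mult m x ?t = brauer_mult m x (perm_matching m id)"
        using brauer_mult_swap(2)[OF x nonperm(5,6,8)] r_one x by simp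
      then have "?t = perm_matching m id" using Units_l_cancel[OF U, of ?t "\<one>\<^bsub>brauer_monoid m\<^esub>"] t one_closed by simp
      then have "transpose k l = id"
        using inj_onD[OF inj_perm_matching, of m "transpose k l" id] permutes_swap_id[OF nonperm(5,6)] permutes_id by blast
      then show ?thesis using nonperm(7) by (metis id_apply transpose_apply_first)
    qed blast
  qed
qed

section \<open>Central idempotents generating a division ring\<close>

lemma principal_left_ideal_simps [simp]:
  "carrier (principal_left_ideal R a) = {r \<otimes>\<^bsub>R\<^esub> a |r. r \<in> carrier R}"
  "\<zero>\<^bsub>principal_left_ideal R a\<^esub> = \<zero>\<^bsub>R\<^esub>"
  "x \<oplus>\<^bsub>principal_left_ideal R a\<^esub> y = x \<oplus>\<^bsub>R\<^esub> y"
  "r \<odot>\<^bsub>principal_left_ideal R a\<^esub> x = r \<otimes>\<^bsub>R\<^esub> x"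
  by (simp_all add: principal_left_ideal_def regular_module_def)

lemma (in ring) left_module_principal_left_ideal:
  assumes "a \<in> carrier R"
  shows "left_module R (principal_left_ideal R a)"
  unfolding principal_left_ideal_def
proof (rule left_ideal_left_module[OF ring_axioms])
  show "\<zero> \<in> {r \<otimes> a |r. r \<in> carrier R}"
    using assms by (auto intro!: exI[of _ \<zero>])
  show "x \<oplus> y \<in> {r \<otimes> a |r. r \<in> carrier R}"
    if xy: "x \<in> {r \<otimes> a |r. r \<in> carrier R}" "y \<in> {r \<otimes> a |r. r \<in> carrier R}" for x y
  proof -
    obtain r s where "r \<in> carrier R" "x = r \<otimes> a" "s \<in> carrier R" "y = s \<otimes> a" using xy by blast
    then show ?thesis using assms by (auto simp: l_distr intro!: exI[of _ "r \<oplus> s"])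
  qed
  show "r \<otimes> x \<in> {r \<otimes> a |r. r \<in> carrier R}"
    if rx: "r \<in> carrier R" "x \<in> {r \<otimes> a |r. r \<in> carrier R}" for r x
  proof -
    obtain s where "s \<in> carrier R" "x = s \<otimes> a" using rx by blast
    then show ?thesis using assms rx(1) by (auto simp: m_assoc intro!: exI[of _ "r \<otimes> s"])
  qed
qed (use assms in auto)

text \<open>A homomorphism \<open>f\<close> on \<open>R e\<close> satisfies
  \<open>f x = f (x e) = x (f e)\<close>. So it suffices to lift \<open>f e\<close> to some
  \<open>b\<close> and to send \<open>x\<close> to \<open>x b\<close>.\<close>

lemma (in ring) projective_principal_left_ideal:
  fixes e :: 'a
  assumes e: "e \<in> carrier R" "e \<otimes> e = e"
  shows "projective_module R (principal_left_ideal R e)"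
  unfolding projective_module_def
proof (intro conjI allI impI, rule left_module_principal_left_ideal[OF e(1)], elim conjE)
  fix B :: "('a, 'a \<Rightarrow> 'a) module" and C :: "('a, 'a) module" and q f
  assume B: "left_module R B" and C: "left_module R C"
    and q: "q \<in> left_module_hom R B C" "q ` carrier B = carrier C"
    and f: "f \<in> left_module_hom R (principal_left_ideal R e) C"
  interpret B: left_module R B by fact
  have ePe: "e \<in> carrier (principal_left_ideal R e)" using e by (auto intro!: exI[of _ e])
  have "f e \<in> q ` carrier B" using left_module_homD(1)[OF f ePe] q(2) by simp
  then obtain b where b: "b \<in> carrier B" "q b = f e" by (metis imageE)
  have x: "x \<in> carrier R" "x \<otimes> e = x" if "x \<in> carrier (principal_left_ideal R e)" for x
    using that e by (auto simp: m_assoc)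
  show "\<exists>g\<in>left_module_hom R (principal_left_ideal R e) B.
      \<forall>x\<in>carrier (principal_left_ideal R e). q (g x) = f x"
  proof (intro bexI[of _ "\<lambda>x. x \<odot>\<^bsub>B\<^esub> b"] ballI)
    show "(\<lambda>x. x \<odot>\<^bsub>B\<^esub> b) \<in> left_module_hom R (principal_left_ideal R e) B"
    proof (rule left_module_homI)
      fix x y assume "x \<in> carrier (principal_left_ideal R e)" "y \<in> carrier (principal_left_ideal R e)"
      then show "(x \<oplus>\<^bsub>principal_left_ideal R e\<^esub> y) \<odot>\<^bsub>B\<^esub> b = x \<odot>\<^bsub>B\<^esub> b \<oplus>\<^bsub>B\<^esub> y \<odot>\<^bsub>B\<^esub> b"
        using x(1) b by (simp only: principal_left_ideal_simps(3) B.smult_l_distr)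
    next
      fix r x assume "r \<in> carrier R" "x \<in> carrier (principal_left_ideal R e)"
      then show "(r \<odot>\<^bsub>principal_left_ideal R e\<^esub> x) \<odot>\<^bsub>B\<^esub> b = r \<odot>\<^bsub>B\<^esub> (x \<odot>\<^bsub>B\<^esub> b)"
        using x(1) b by (simp only: principal_left_ideal_simps(4) B.smult_assoc1)
    qed (use x b in blast)
  next
    fix y assume y: "y \<in> carrier (principal_left_ideal R e)"
    have "q (y \<odot>\<^bsub>B\<^esub> b) = y \<odot>\<^bsub>C\<^esub> f e"
      using left_module_homD(3)[OF q(1) x(1)[OF y] b(1)] b(2) by simp
    also have "\<dots> = f y"
      using left_module_homD(3)[OF f x(1)[OF y] ePe] x(2)[OF y] by simp
    finally show "q (y \<odot>\<^bsub>B\<^esub> b) = f y" .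
  qed
qed

text \<open>The last assumption says that \<open>R e\<close>, with identity \<open>e\<close>, is a
  division ring: nonzero elements have left inverses. The inverse \<open>s\<close> is sought in
  \<open>R\<close>; by centrality \<open>s e\<close> then does the same inside
  \<open>R e\<close>.\<close>

locale division_idempotent = ring +
  fixes e :: 'a
  assumes e_closed [simp]: "e \<in> carrier R" and e_nonzero: "e \<noteq> \<zero>" and e_idem [simp]: "e \<otimes> e = e"
    and e_central: "r \<in> carrier R \<Longrightarrow> r \<otimes> e = e \<otimes> r"
    and e_division: "\<lbrakk>r \<in> carrier R; r \<otimes> e \<noteq> \<zero>\<rbrakk> \<Longrightarrow> \<exists>s\<in>carrier R. s \<otimes> (r \<otimes> e) = e"
begin

lemma block_elt:
  assumes "x \<in> carrier (principal_left_ideal R e)"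
  shows "x \<in> carrier R" "x \<otimes> e = x" "e \<otimes> x = x"
  using assms by (auto simp: m_assoc e_central[symmetric])

lemma block_division:
  assumes "x \<in> carrier (principal_left_ideal R e)" "x \<noteq> \<zero>"
  shows "\<exists>s\<in>carrier R. s \<otimes> x = e"
  using e_division[of x] block_elt[OF assms(1)] assms(2) by simp

text \<open>Dividing by a nonzero element shows that every nonzero submodule contains
  \<open>e\<close>, so two nonzero submodules never meet in zero.\<close>

lemma indecomposable_block: "indecomposable_module R (principal_left_ideal R e)"
  unfolding indecomposable_module_def
proof (intro conjI allI impI)
  have e: "e \<in> carrier (principal_left_ideal R e)" by (auto intro!: exI[of _ e])
  then show "carrier (principal_left_ideal R e) \<noteq> {\<zero>\<^bsub>principal_left_ideal R e\<^esub>}"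
    using e_nonzero by (metis principal_left_ideal_simps(2) singletonD)
  fix H K
  assume HK: "submodule H R (principal_left_ideal R e) \<and> submodule K R (principal_left_ideal R e) \<and>
    H \<inter> K = {\<zero>\<^bsub>principal_left_ideal R e\<^esub>} \<and> H <+>\<^bsub>principal_left_ideal R e\<^esub> K = carrier (principal_left_ideal R e)"
  have "e \<in> L" if L: "submodule L R (principal_left_ideal R e)" "L \<noteq> {\<zero>}" for L
  proof -
    interpret L: submodule L R "principal_left_ideal R e" by fact
    \<comment> \<open>The locale \<open>submodule\<close> treats \<open>L\<close> as a subgroup of
      the additive group written multiplicatively, so its \<open>one\<close> is the zero of the
      module.\<close>
    have "\<zero> \<in> L" using L.one_closed by simp
    then obtain x where x: "x \<in> L" "x \<noteq> \<zero>" using L(2) by blast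
    then have "x \<in> carrier (principal_left_ideal R e)" using L.subset by (metis partial_object.select_convs(1) subsetD)
    then show ?thesis using block_division x L.smult_closed by (metis principal_left_ideal_simps(4))
  qed
  then show "H = {\<zero>\<^bsub>principal_left_ideal R e\<^esub>} \<or> K = {\<zero>\<^bsub>principal_left_ideal R e\<^esub>}"
    using HK e_nonzero unfolding principal_left_ideal_simps by blast
qed (simp add: left_module_principal_left_ideal)

text \<open>If \<open>f a0 = e\<close>, take a submodule \<open>K\<close> of \<open>B\<close> maximal among those that contain \<open>j (ker f)\<close> but
  not \<open>b0 = j a0\<close>. Since \<open>R e\<close> is a division ring, \<open>e b \<in> q b0 + K\<close> for a unique \<open>q \<in> R e\<close>, and
  \<open>b \<mapsto> q\<close> is the extension.\<close>

lemma injective_block: "injective_module R (principal_left_ideal R e)"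
  unfolding injective_module_def
proof (intro conjI allI impI, simp add: left_module_principal_left_ideal, elim conjE)
  let ?I = "principal_left_ideal R e"
  fix A B :: "('a, 'a) module" and j f
  assume A: "left_module R A" and B: "left_module R B"
    and j: "j \<in> left_module_hom R A B" "inj_on j (carrier A)"
    and f: "f \<in> left_module_hom R A ?I"
  interpret A: left_module R A by fact
  interpret B: left_module R B by fact
  interpret I: left_module R ?I by (simp add: left_module_principal_left_ideal)
  note jD = left_module_homD[OF j(1)] and fD = left_module_homD[OF f, unfolded principal_left_ideal_simps(3,4)]
  have f0: "f \<zero>\<^bsub>A\<^esub> = \<zero>"
    using fD(3)[of \<zero> "\<zero>\<^bsub>A\<^esub>"] block_elt(1)[OF fD(1)[of "\<zero>\<^bsub>A\<^esub>"]] by simp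
  show "\<exists>g\<in>left_module_hom R B ?I. \<forall>a\<in>carrier A. g (j a) = f a"
  proof (cases "\<forall>a\<in>carrier A. f a = \<zero>")
    case True
    then show ?thesis
      by (intro bexI[of _ "\<lambda>_. \<zero>"] left_module_homI) (auto intro!: exI[of _ \<zero>])
  next
    case False
    then obtain a where a: "a \<in> carrier A" "f a \<noteq> \<zero>" by blast
    then obtain s where s: "s \<in> carrier R" "s \<otimes> f a = e" using block_division fD(1) by metis
    \<comment> \<open>The scalar \<open>s\<close> normalizes the value of \<open>f\<close> to
      \<open>e\<close>. The additional factor \<open>e\<close> gives \<open>e a0 = a0\<close>, and
      hence \<open>e b0 = b0\<close>.\<close>
    define a0 where "a0 = e \<odot>\<^bsub>A\<^esub> (s \<odot>\<^bsub>A\<^esub> a)"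
    define b0 where "b0 = j a0"
    have a0: "a0 \<in> carrier A" "f a0 = e" "e \<odot>\<^bsub>A\<^esub> a0 = a0"
      using a(1) s A.smult_assoc1[of e e "s \<odot>\<^bsub>A\<^esub> a"] by (simp_all add: a0_def fD)
    have b0: "b0 \<in> carrier B" "e \<odot>\<^bsub>B\<^esub> b0 = b0"
      using a0 jD(3)[of e a0] by (simp_all add: b0_def jD)
    define F where "F = {K. K \<subseteq> carrier B \<and> j ` {a \<in> carrier A. f a = \<zero>} \<subseteq> K \<and> b0 \<notin> K \<and>
      (\<forall>x\<in>K. \<forall>y\<in>K. x \<oplus>\<^bsub>B\<^esub> y \<in> K) \<and> (\<forall>r\<in>carrier R. \<forall>x\<in>K. r \<odot>\<^bsub>B\<^esub> x \<in> K)}"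
    have "j ` {a \<in> carrier A. f a = \<zero>} \<in> F"
      unfolding F_def mem_Collect_eq
    proof (intro conjI ballI)
      show "b0 \<notin> j ` {a \<in> carrier A. f a = \<zero>}"
        using a0 e_nonzero j(2) by (auto simp: b0_def dest: inj_onD)
    next
      fix x y assume "x \<in> j ` {a \<in> carrier A. f a = \<zero>}" "y \<in> j ` {a \<in> carrier A. f a = \<zero>}"
      then obtain c d where "c \<in> carrier A" "d \<in> carrier A" "f c = \<zero>" "f d = \<zero>" "x = j c" "y = j d" by blast
      then show "x \<oplus>\<^bsub>B\<^esub> y \<in> j ` {a \<in> carrier A. f a = \<zero>}"
        by (intro image_eqI[of _ _ "c \<oplus>\<^bsub>A\<^esub> d"]) (auto simp: jD fD)
    next
      fix r x assume "r \<in> carrier R" "x \<in> j ` {a \<in> carrier A. f a = \<zero>}"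
      then obtain c where "r \<in> carrier R" "c \<in> carrier A" "f c = \<zero>" "x = j c" by blast
      then show "r \<odot>\<^bsub>B\<^esub> x \<in> j ` {a \<in> carrier A. f a = \<zero>}"
        by (intro image_eqI[of _ _ "r \<odot>\<^bsub>A\<^esub> c"]) (auto simp: jD fD)
    qed (auto simp: jD)
    moreover have "\<Union>C \<in> F" if "C \<noteq> {}" "subset.chain F C" for C
    proof -
      have CF: "C \<subseteq> F" and lin: "\<And>S T. \<lbrakk>S \<in> C; T \<in> C\<rbrakk> \<Longrightarrow> S \<subseteq> T \<or> T \<subseteq> S"
        using that(2) by (auto simp: subset_chain_def)
      have "x \<oplus>\<^bsub>B\<^esub> y \<in> \<Union>C" if "x \<in> \<Union>C" "y \<in> \<Union>C" for x y
      proof -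
        obtain S where "S \<in> C" "x \<in> S" "y \<in> S" using \<open>x \<in> \<Union>C\<close> \<open>y \<in> \<Union>C\<close> lin by (meson UnionE subsetD)
        then show ?thesis using CF by (auto simp: F_def)
      qed
      moreover have "\<Union>C \<subseteq> carrier B" "b0 \<notin> \<Union>C" using CF by (auto simp: F_def)
      moreover have "j ` {a \<in> carrier A. f a = \<zero>} \<subseteq> \<Union>C" using CF that(1) unfolding F_def by blast
      moreover have "\<forall>r\<in>carrier R. \<forall>x\<in>\<Union>C. r \<odot>\<^bsub>B\<^esub> x \<in> \<Union>C" using CF unfolding F_def by blast
      ultimately show ?thesis by (simp only: F_def mem_Collect_eq) blast
    qed
    ultimately obtain K where "K \<in> F" and max: "\<And>L. \<lbrakk>L \<in> F; K \<subseteq> L\<rbrakk> \<Longrightarrow> L = K"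
      using subset_Zorn_nonempty[of F] by blast
    then have KB: "\<And>x. x \<in> K \<Longrightarrow> x \<in> carrier B" and Kj: "\<And>a. \<lbrakk>a \<in> carrier A; f a = \<zero>\<rbrakk> \<Longrightarrow> j a \<in> K"
      and b0K: "b0 \<notin> K" and Kadd: "\<And>x y. \<lbrakk>x \<in> K; y \<in> K\<rbrakk> \<Longrightarrow> x \<oplus>\<^bsub>B\<^esub> y \<in> K"
      and Ksmult: "\<And>r x. \<lbrakk>r \<in> carrier R; x \<in> K\<rbrakk> \<Longrightarrow> r \<odot>\<^bsub>B\<^esub> x \<in> K"
      unfolding F_def by blast+
    have Kneg: "\<ominus>\<^bsub>B\<^esub> x \<in> K" if "x \<in> K" for x
      using Ksmult[of "\<ominus> \<one>" x] that KB[OF that] by (simp add: B.smult_l_minus)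
    have K0: "\<zero>\<^bsub>B\<^esub> \<in> K" using Kneg Kadd Kj[OF A.zero_closed f0] KB by (metis B.r_neg)
    have ex: "\<exists>q\<in>carrier ?I. \<exists>k\<in>K. e \<odot>\<^bsub>B\<^esub> b = q \<odot>\<^bsub>B\<^esub> b0 \<oplus>\<^bsub>B\<^esub> k" if b: "b \<in> carrier B" for b
    proof (cases "e \<odot>\<^bsub>B\<^esub> b \<in> K")
      case True
      then show ?thesis using b b0 KB
        by (intro bexI[of _ \<zero>] bexI[of _ "e \<odot>\<^bsub>B\<^esub> b"]) (auto intro!: exI[of _ \<zero>])
    next
      case False
      \<comment> \<open>\<open>L\<close> is \<open>K + R e b\<close>. By maximality of
        \<open>K\<close> it contains \<open>b0\<close>, say \<open>b0 = k + r e b\<close>. Here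
        \<open>r e\<close> is nonzero because \<open>b0\<close> is not in \<open>K\<close>, so it
        can be inverted and the equation solved for \<open>e b\<close>.\<close>
      define L where "L = {k \<oplus>\<^bsub>B\<^esub> r \<odot>\<^bsub>B\<^esub> (e \<odot>\<^bsub>B\<^esub> b) |k r. k \<in> K \<and> r \<in> carrier R}"
      have KL: "K \<subseteq> L"
      proof
        fix k assume k: "k \<in> K"
        then have "k = k \<oplus>\<^bsub>B\<^esub> \<zero> \<odot>\<^bsub>B\<^esub> (e \<odot>\<^bsub>B\<^esub> b)" using b KB by simp
        then show "k \<in> L" unfolding L_def using k by blast
      qed
      have "e \<odot>\<^bsub>B\<^esub> b = \<zero>\<^bsub>B\<^esub> \<oplus>\<^bsub>B\<^esub> \<one> \<odot>\<^bsub>B\<^esub> (e \<odot>\<^bsub>B\<^esub> b)" using b by simp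
      then have "e \<odot>\<^bsub>B\<^esub> b \<in> L" unfolding L_def using K0 by blast
      then have "L \<notin> F" using max KL False by blast
      moreover have "L \<subseteq> carrier B" using KB b by (auto simp: L_def)
      moreover have "x \<oplus>\<^bsub>B\<^esub> y \<in> L" if xy: "x \<in> L" "y \<in> L" for x y
      proof -
        obtain k r l t where kr: "k \<in> K" "r \<in> carrier R" "x = k \<oplus>\<^bsub>B\<^esub> r \<odot>\<^bsub>B\<^esub> (e \<odot>\<^bsub>B\<^esub> b)"
          "l \<in> K" "t \<in> carrier R" "y = l \<oplus>\<^bsub>B\<^esub> t \<odot>\<^bsub>B\<^esub> (e \<odot>\<^bsub>B\<^esub> b)" using xy unfolding L_def by blast
        then have "x \<oplus>\<^bsub>B\<^esub> y = (k \<oplus>\<^bsub>B\<^esub> l) \<oplus>\<^bsub>B\<^esub> (r \<oplus> t) \<odot>\<^bsub>B\<^esub> (e \<odot>\<^bsub>B\<^esub> b)"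
          using KB b by (simp add: B.smult_l_distr B.add.m_ac)
        then show ?thesis unfolding L_def using kr Kadd by blast
      qed
      moreover have "r \<odot>\<^bsub>B\<^esub> x \<in> L" if rx: "r \<in> carrier R" "x \<in> L" for r x
      proof -
        obtain k t where kt: "k \<in> K" "t \<in> carrier R" "x = k \<oplus>\<^bsub>B\<^esub> t \<odot>\<^bsub>B\<^esub> (e \<odot>\<^bsub>B\<^esub> b)"
          using rx unfolding L_def by blast
        then have "r \<odot>\<^bsub>B\<^esub> x = r \<odot>\<^bsub>B\<^esub> k \<oplus>\<^bsub>B\<^esub> (r \<otimes> t) \<odot>\<^bsub>B\<^esub> (e \<odot>\<^bsub>B\<^esub> b)"
          using rx(1) KB b by (simp add: B.smult_r_distr B.smult_assoc1)
        then show ?thesis unfolding L_def using kt rx(1) Ksmult by blast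
      qed
      ultimately have "b0 \<in> L" using KL Kj unfolding F_def by blast
      then obtain k r where k: "k \<in> K" and r: "r \<in> carrier R" and b0_eq: "b0 = k \<oplus>\<^bsub>B\<^esub> (r \<otimes> e) \<odot>\<^bsub>B\<^esub> b"
        unfolding L_def using b by (auto simp: B.smult_assoc1)
      have "r \<otimes> e \<noteq> \<zero>" using b0_eq b0K k KB b by auto
      then obtain s where s: "s \<in> carrier R" "s \<otimes> (r \<otimes> e) = e" using e_division r by blast
      have "s \<odot>\<^bsub>B\<^esub> b0 = s \<odot>\<^bsub>B\<^esub> k \<oplus>\<^bsub>B\<^esub> e \<odot>\<^bsub>B\<^esub> b"
        using b0_eq s r k KB b B.smult_assoc1[of s "r \<otimes> e" b] by (simp add: B.smult_r_distr)
      \<comment> \<open>The coefficient of \<open>b0\<close> must lie in \<open>R e\<close>; since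
        \<open>e b0 = b0\<close>, the scalar \<open>s\<close> may be replaced by
        \<open>s e\<close>.\<close>
      moreover have "(s \<otimes> e) \<odot>\<^bsub>B\<^esub> b0 = s \<odot>\<^bsub>B\<^esub> b0" using s b0 by (simp add: B.smult_assoc1)
      ultimately have "e \<odot>\<^bsub>B\<^esub> b = (s \<otimes> e) \<odot>\<^bsub>B\<^esub> b0 \<oplus>\<^bsub>B\<^esub> \<ominus>\<^bsub>B\<^esub> (s \<odot>\<^bsub>B\<^esub> k)"
        using s k KB b by (simp add: B.add.m_ac B.r_neg B.M.r_neg1 B.M.r_neg2)
      then show ?thesis using s Kneg[OF Ksmult[OF s(1) k]] by auto
    qed
    \<comment> \<open>Two different coefficients would put \<open>(q - q') b0\<close> into
      \<open>K\<close>; dividing by \<open>q - q'\<close> would put \<open>e b0 = b0\<close>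
      there.\<close>
    have unique: "q = q'"
      if "q \<in> carrier ?I" "q' \<in> carrier ?I" "k \<in> K" "k' \<in> K" and
        eq: "q \<odot>\<^bsub>B\<^esub> b0 \<oplus>\<^bsub>B\<^esub> k = q' \<odot>\<^bsub>B\<^esub> b0 \<oplus>\<^bsub>B\<^esub> k'" for q q' k k'
    proof (rule ccontr)
      assume "q \<noteq> q'"
      note q = block_elt(1)[OF that(1)] block_elt(1)[OF that(2)] and k = KB[OF that(3)] KB[OF that(4)]
      have "q \<ominus> q' \<in> carrier ?I"
        using block_elt(2)[OF that(1)] block_elt(2)[OF that(2)] q
        by (auto simp: a_minus_def l_distr l_minus intro!: exI[of _ "q \<ominus> q'"])
      moreover have "q \<ominus> q' \<noteq> \<zero>" using q \<open>q \<noteq> q'\<close> by simp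
      ultimately obtain s where s: "s \<in> carrier R" "s \<otimes> (q \<ominus> q') = e" using block_division by blast
      have "(q \<ominus> q') \<odot>\<^bsub>B\<^esub> b0 = (q \<odot>\<^bsub>B\<^esub> b0 \<oplus>\<^bsub>B\<^esub> k) \<oplus>\<^bsub>B\<^esub> \<ominus>\<^bsub>B\<^esub> (q' \<odot>\<^bsub>B\<^esub> b0) \<oplus>\<^bsub>B\<^esub> \<ominus>\<^bsub>B\<^esub> k"
        using q k b0 by (simp add: a_minus_def B.smult_l_distr B.smult_l_minus B.add.m_ac B.M.r_neg1 B.M.r_neg2 B.r_neg)
      also have "\<dots> = k' \<oplus>\<^bsub>B\<^esub> \<ominus>\<^bsub>B\<^esub> k"
        unfolding eq using q k b0 by (simp add: B.add.m_ac B.M.r_neg1 B.M.r_neg2 B.r_neg)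
      finally have "(q \<ominus> q') \<odot>\<^bsub>B\<^esub> b0 \<in> K" using that Kadd Kneg by simp
      then have "s \<odot>\<^bsub>B\<^esub> ((q \<ominus> q') \<odot>\<^bsub>B\<^esub> b0) \<in> K" by (rule Ksmult[OF s(1)])
      then show False using b0 b0K s q by (simp flip: B.smult_assoc1)
    qed
    define g where "g b = (SOME q. q \<in> carrier ?I \<and> (\<exists>k\<in>K. e \<odot>\<^bsub>B\<^esub> b = q \<odot>\<^bsub>B\<^esub> b0 \<oplus>\<^bsub>B\<^esub> k))" for b
    have g: "g b \<in> carrier ?I" "\<exists>k\<in>K. e \<odot>\<^bsub>B\<^esub> b = g b \<odot>\<^bsub>B\<^esub> b0 \<oplus>\<^bsub>B\<^esub> k" if "b \<in> carrier B" for b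
      using someI_ex[of "\<lambda>q. q \<in> carrier ?I \<and> (\<exists>k\<in>K. e \<odot>\<^bsub>B\<^esub> b = q \<odot>\<^bsub>B\<^esub> b0 \<oplus>\<^bsub>B\<^esub> k)"] ex[OF that]
      unfolding g_def by blast+
    have g_eq: "g b = q" if "b \<in> carrier B" "q \<in> carrier ?I" "k \<in> K" "e \<odot>\<^bsub>B\<^esub> b = q \<odot>\<^bsub>B\<^esub> b0 \<oplus>\<^bsub>B\<^esub> k" for b q k
      using unique g[OF that(1)] that(2-) by metis
    show ?thesis
    proof (intro bexI[of _ g] ballI left_module_homI)
      fix b c assume bc: "b \<in> carrier B" "c \<in> carrier B"
      obtain k l where kl: "k \<in> K" "e \<odot>\<^bsub>B\<^esub> b = g b \<odot>\<^bsub>B\<^esub> b0 \<oplus>\<^bsub>B\<^esub> k" "l \<in> K" "e \<odot>\<^bsub>B\<^esub> c = g c \<odot>\<^bsub>B\<^esub> b0 \<oplus>\<^bsub>B\<^esub> l"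
        using g(2) bc by metis
      have "e \<odot>\<^bsub>B\<^esub> (b \<oplus>\<^bsub>B\<^esub> c) = (g b \<oplus> g c) \<odot>\<^bsub>B\<^esub> b0 \<oplus>\<^bsub>B\<^esub> (k \<oplus>\<^bsub>B\<^esub> l)"
        using kl bc KB b0 block_elt(1)[OF g(1)] by (simp add: B.smult_l_distr B.smult_r_distr B.add.m_ac)
      then show "g (b \<oplus>\<^bsub>B\<^esub> c) = g b \<oplus>\<^bsub>?I\<^esub> g c"
        using g_eq[of "b \<oplus>\<^bsub>B\<^esub> c" "g b \<oplus>\<^bsub>?I\<^esub> g c" "k \<oplus>\<^bsub>B\<^esub> l"] bc kl Kadd I.M.a_closed[OF g(1)[OF bc(1)] g(1)[OF bc(2)]] by simp
    next
      fix r b assume rb: "r \<in> carrier R" "b \<in> carrier B"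
      obtain k where k: "k \<in> K" "e \<odot>\<^bsub>B\<^esub> b = g b \<odot>\<^bsub>B\<^esub> b0 \<oplus>\<^bsub>B\<^esub> k"
        using g(2) rb by metis
      \<comment> \<open>Centrality makes \<open>b \<mapsto> e b\<close> linear over all of
        \<open>R\<close>, so that \<open>g\<close> respects every scalar.\<close>
      have "e \<odot>\<^bsub>B\<^esub> (r \<odot>\<^bsub>B\<^esub> b) = r \<odot>\<^bsub>B\<^esub> (e \<odot>\<^bsub>B\<^esub> b)"
        using rb e_central by (simp flip: B.smult_assoc1)
      also have "\<dots> = (r \<otimes> g b) \<odot>\<^bsub>B\<^esub> b0 \<oplus>\<^bsub>B\<^esub> r \<odot>\<^bsub>B\<^esub> k"
        using k rb KB b0 block_elt(1)[OF g(1)] by (simp add: B.smult_assoc1 B.smult_r_distr)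
      finally show "g (r \<odot>\<^bsub>B\<^esub> b) = r \<odot>\<^bsub>?I\<^esub> g b"
        using g_eq[of "r \<odot>\<^bsub>B\<^esub> b" "r \<odot>\<^bsub>?I\<^esub> g b" "r \<odot>\<^bsub>B\<^esub> k"] rb k Ksmult I.smult_closed[OF rb(1) g(1)[OF rb(2)]] by simp
    next
      fix c assume c: "c \<in> carrier A"
      note fc = fD(1)[OF c] block_elt[OF fD(1)[OF c]]
      \<comment> \<open>The kernel part of \<open>e c\<close>: both \<open>e c\<close> and
        \<open>(f c) a0\<close> have value \<open>f c\<close> under \<open>f\<close>. So
        \<open>e (j c)\<close> decomposes as \<open>(f c) b0\<close> plus an element of
        \<open>K\<close>, which determines \<open>g (j c)\<close>.\<close>
      define d where "d = e \<odot>\<^bsub>A\<^esub> c \<oplus>\<^bsub>A\<^esub> (\<ominus> f c) \<odot>\<^bsub>A\<^esub> a0"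
      have d: "d \<in> carrier A" using c a0 fc by (simp add: d_def)
      have "f d = \<zero>" using c a0 fc by (simp add: d_def fD l_minus r_neg)
      then have "j d \<in> K" using d Kj by blast
      moreover have "e \<odot>\<^bsub>A\<^esub> c = f c \<odot>\<^bsub>A\<^esub> a0 \<oplus>\<^bsub>A\<^esub> d"
        using c a0 fc by (simp add: d_def A.smult_l_minus A.add.m_ac A.M.r_neg1 A.M.r_neg2 A.r_neg)
      then have "e \<odot>\<^bsub>B\<^esub> j c = f c \<odot>\<^bsub>B\<^esub> b0 \<oplus>\<^bsub>B\<^esub> j d"
        using jD c a0 fc d by (metis A.smult_closed b0_def e_closed)
      ultimately show "g (j c) = f c" using g_eq jD(1)[OF c] fc(1) by blast
    qed (use g in auto)
  qed
qed

end

section \<open>Monoid algebras\<close>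

lemma monoid_algebra_simps [simp]:
  "carrier (monoid_algebra M) = {a. finite {x. a x \<noteq> 0} \<and> {x. a x \<noteq> 0} \<subseteq> carrier M}"
  "\<one>\<^bsub>monoid_algebra M\<^esub> = basis_elt \<one>\<^bsub>M\<^esub>"
  "\<zero>\<^bsub>monoid_algebra M\<^esub> = (\<lambda>_. 0)"
  "a \<oplus>\<^bsub>monoid_algebra M\<^esub> b = (\<lambda>x. a x + b x)"
  by (simp_all add: monoid_algebra_def)

text \<open>Allowing any finite sets that contain the supports lets several products be expanded
  over common index sets, as distributivity requires.\<close>

lemma monoid_algebra_mult:
  assumes A: "finite A" "{x. a x \<noteq> 0} \<subseteq> A" and B: "finite B" "{y. b y \<noteq> 0} \<subseteq> B"
  shows "(a \<otimes>\<^bsub>monoid_algebra M\<^esub> b) z = (\<Sum>x\<in>A. \<Sum>y\<in>B. if x \<otimes>\<^bsub>M\<^esub> y = z then a x * b y else 0)"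
proof -
  have "(a \<otimes>\<^bsub>monoid_algebra M\<^esub> b) z =
      (\<Sum>(x, y)\<in>{(x, y). a x \<noteq> 0 \<and> b y \<noteq> 0 \<and> x \<otimes>\<^bsub>M\<^esub> y = z}. a x * b y)"
    by (simp add: monoid_algebra_def)
  also have "\<dots> = (\<Sum>(x, y)\<in>A \<times> B. if x \<otimes>\<^bsub>M\<^esub> y = z then a x * b y else 0)"
    by (rule sum.mono_neutral_cong_left) (use A B in \<open>auto split: if_splits\<close>)
  also have "\<dots> = (\<Sum>x\<in>A. \<Sum>y\<in>B. if x \<otimes>\<^bsub>M\<^esub> y = z then a x * b y else 0)"
    by (simp add: sum.cartesian_product)
  finally show ?thesis .
qed

lemma monoid_algebra_mult_support:
  "{z. (a \<otimes>\<^bsub>monoid_algebra M\<^esub> b) z \<noteq> 0} \<subseteq> (\<lambda>(x, y). x \<otimes>\<^bsub>M\<^esub> y) ` ({x. a x \<noteq> 0} \<times> {y. b y \<noteq> 0})"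
proof
  fix z assume "z \<in> {z. (a \<otimes>\<^bsub>monoid_algebra M\<^esub> b) z \<noteq> 0}"
  then have "(\<Sum>(x, y)\<in>{(x, y). a x \<noteq> 0 \<and> b y \<noteq> 0 \<and> x \<otimes>\<^bsub>M\<^esub> y = z}. a x * b y) \<noteq> 0"
    by (simp add: monoid_algebra_def)
  then obtain p where "p \<in> {(x, y). a x \<noteq> 0 \<and> b y \<noteq> 0 \<and> x \<otimes>\<^bsub>M\<^esub> y = z}"
    by (rule sum.not_neutral_contains_not_neutral)
  then show "z \<in> (\<lambda>(x, y). x \<otimes>\<^bsub>M\<^esub> y) ` ({x. a x \<noteq> 0} \<times> {y. b y \<noteq> 0})" by force
qed

text \<open>Summation of a product against a weight \<open>F\<close>. Choosing \<open>F\<close> to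
  absorb the third factor turns both bracketings of a triple product into the same triple
  sum.\<close>

lemma sum_monoid_algebra_mult:
  assumes A: "finite A" "{x. a x \<noteq> 0} \<subseteq> A" and B: "finite B" "{y. b y \<noteq> 0} \<subseteq> B"
    and C: "finite C" "(\<lambda>(x, y). x \<otimes>\<^bsub>M\<^esub> y) ` (A \<times> B) \<subseteq> C"
  shows "(\<Sum>z\<in>C. (a \<otimes>\<^bsub>monoid_algebra M\<^esub> b) z * F z) = (\<Sum>x\<in>A. \<Sum>y\<in>B. a x * b y * F (x \<otimes>\<^bsub>M\<^esub> y))"
proof -
  have "(\<Sum>z\<in>C. (a \<otimes>\<^bsub>monoid_algebra M\<^esub> b) z * F z) =
      (\<Sum>z\<in>C. \<Sum>x\<in>A. \<Sum>y\<in>B. if x \<otimes>\<^bsub>M\<^esub> y = z then a x * b y * F z else 0)"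
    by (simp add: monoid_algebra_mult[OF A B] sum_distrib_right if_distrib[of "\<lambda>t. t * _"] cong: if_cong)
  also have "\<dots> = (\<Sum>x\<in>A. \<Sum>z\<in>C. \<Sum>y\<in>B. if x \<otimes>\<^bsub>M\<^esub> y = z then a x * b y * F z else 0)"
    by (rule sum.swap)
  also have "\<dots> = (\<Sum>x\<in>A. \<Sum>y\<in>B. \<Sum>z\<in>C. if x \<otimes>\<^bsub>M\<^esub> y = z then a x * b y * F z else 0)"
    by (intro sum.cong refl sum.swap)
  also have "\<dots> = (\<Sum>x\<in>A. \<Sum>y\<in>B. a x * b y * F (x \<otimes>\<^bsub>M\<^esub> y))"
    using C by (intro sum.cong refl) (auto simp: image_subset_iff)
  finally show ?thesis .
qed

lemma monoid_algebra_assoc: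
  assumes "monoid M"
    and abc: "a \<in> carrier (monoid_algebra M)" "b \<in> carrier (monoid_algebra M)" "c \<in> carrier (monoid_algebra M)"
  shows "a \<otimes>\<^bsub>monoid_algebra M\<^esub> b \<otimes>\<^bsub>monoid_algebra M\<^esub> c = a \<otimes>\<^bsub>monoid_algebra M\<^esub> (b \<otimes>\<^bsub>monoid_algebra M\<^esub> c)"
proof
  interpret M: monoid M by fact
  fix z
  define A B C where "A = {x. a x \<noteq> 0}" and "B = {x. b x \<noteq> 0}" and "C = {x. c x \<noteq> 0}"
  define AB BC where "AB = (\<lambda>(x, y). x \<otimes>\<^bsub>M\<^esub> y) ` (A \<times> B)" and "BC = (\<lambda>(x, y). x \<otimes>\<^bsub>M\<^esub> y) ` (B \<times> C)"
  have fin: "finite A" "finite B" "finite C" and sub: "A \<subseteq> carrier M" "B \<subseteq> carrier M" "C \<subseteq> carrier M"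
    using abc by (auto simp: A_def B_def C_def)
  then have fin2: "finite AB" "finite BC" by (auto simp: AB_def BC_def)
  have supp: "{x. (a \<otimes>\<^bsub>monoid_algebra M\<^esub> b) x \<noteq> 0} \<subseteq> AB" "{x. (b \<otimes>\<^bsub>monoid_algebra M\<^esub> c) x \<noteq> 0} \<subseteq> BC"
    unfolding AB_def BC_def A_def B_def C_def by (rule monoid_algebra_mult_support)+
  have "(a \<otimes>\<^bsub>monoid_algebra M\<^esub> b \<otimes>\<^bsub>monoid_algebra M\<^esub> c) z =
      (\<Sum>w\<in>AB. (a \<otimes>\<^bsub>monoid_algebra M\<^esub> b) w * (\<Sum>t\<in>C. if w \<otimes>\<^bsub>M\<^esub> t = z then c t else 0))"
    by (subst monoid_algebra_mult[OF fin2(1) supp(1) fin(3)])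
      (auto simp: C_def sum_distrib_left if_distrib[of "\<lambda>t. _ * t"] cong: if_cong)
  also have "\<dots> = (\<Sum>x\<in>A. \<Sum>y\<in>B. a x * b y * (\<Sum>t\<in>C. if x \<otimes>\<^bsub>M\<^esub> y \<otimes>\<^bsub>M\<^esub> t = z then c t else 0))"
    by (rule sum_monoid_algebra_mult) (use fin fin2 in \<open>auto simp: A_def B_def AB_def\<close>)
  also have "\<dots> = (\<Sum>x\<in>A. \<Sum>y\<in>B. \<Sum>t\<in>C. b y * c t * (if x \<otimes>\<^bsub>M\<^esub> (y \<otimes>\<^bsub>M\<^esub> t) = z then a x else 0))"
    unfolding sum_distrib_left by (intro sum.cong refl) (use sub in \<open>auto simp: M.m_assoc subset_iff\<close>)
  also have "\<dots> = (\<Sum>x\<in>A. \<Sum>w\<in>BC. (b \<otimes>\<^bsub>monoid_algebra M\<^esub> c) w * (if x \<otimes>\<^bsub>M\<^esub> w = z then a x else 0))"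
    by (intro sum.cong refl sum_monoid_algebra_mult[symmetric]) (use fin fin2 in \<open>auto simp: B_def C_def BC_def\<close>)
  also have "\<dots> = (a \<otimes>\<^bsub>monoid_algebra M\<^esub> (b \<otimes>\<^bsub>monoid_algebra M\<^esub> c)) z"
    by (subst monoid_algebra_mult[OF fin(1) _ fin2(2) supp(2)])
      (auto simp: A_def mult.commute intro!: sum.cong)
  finally show "(a \<otimes>\<^bsub>monoid_algebra M\<^esub> b \<otimes>\<^bsub>monoid_algebra M\<^esub> c) z =
    (a \<otimes>\<^bsub>monoid_algebra M\<^esub> (b \<otimes>\<^bsub>monoid_algebra M\<^esub> c)) z" .
qed

lemma ring_monoid_algebra:
  fixes M :: "('m, 'c) monoid_scheme"
  assumes "monoid M"
  shows "ring (monoid_algebra M :: ('m \<Rightarrow> 'k::field) ring)" (is "ring ?R")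
proof (rule ringI)
  interpret M: monoid M by fact
  have finsupp: "finite {x. a x + b x \<noteq> 0}" "{x. a x + b x \<noteq> 0} \<subseteq> carrier M"
    if "a \<in> carrier ?R" "b \<in> carrier ?R" for a b
  proof -
    have "{x. a x + b x \<noteq> 0} \<subseteq> {x. a x \<noteq> 0} \<union> {x. b x \<noteq> 0}" by auto
    then show "finite {x. a x + b x \<noteq> 0}" "{x. a x + b x \<noteq> 0} \<subseteq> carrier M"
      using that by (auto intro: finite_subset)
  qed
  have mult: "a \<otimes>\<^bsub>?R\<^esub> b \<in> carrier ?R" if "a \<in> carrier ?R" "b \<in> carrier ?R" for a b
  proof -
    let ?S = "(\<lambda>(x, y). x \<otimes>\<^bsub>M\<^esub> y) ` ({x. a x \<noteq> 0} \<times> {y. b y \<noteq> 0})"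
    have "finite ?S" "?S \<subseteq> carrier M" using that by (auto simp: subset_iff)
    then show ?thesis
      using monoid_algebra_mult_support[of M a b] by (auto simp only: monoid_algebra_simps(1) mem_Collect_eq intro: finite_subset)
  qed
  show "abelian_group ?R"
  proof (rule abelian_groupI)
    fix a assume "a \<in> carrier ?R"
    then show "\<exists>b\<in>carrier ?R. b \<oplus>\<^bsub>?R\<^esub> a = \<zero>\<^bsub>?R\<^esub>"
      by (intro bexI[of _ "\<lambda>x. - a x"]) auto
  qed (use finsupp in \<open>auto simp: ac_simps\<close>)
  show "Group.monoid ?R"
  proof (rule monoidI)
    show "\<one>\<^bsub>?R\<^esub> \<in> carrier ?R" by (auto simp: basis_elt_def)
    fix a assume a: "a \<in> carrier ?R"
    show "\<one>\<^bsub>?R\<^esub> \<otimes>\<^bsub>?R\<^esub> a = a"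
    proof
      fix z
      have "(\<one>\<^bsub>?R\<^esub> \<otimes>\<^bsub>?R\<^esub> a) z = (\<Sum>x\<in>{\<one>\<^bsub>M\<^esub>}. \<Sum>y\<in>{y. a y \<noteq> 0}. if x \<otimes>\<^bsub>M\<^esub> y = z then basis_elt \<one>\<^bsub>M\<^esub> x * a y else 0)"
        unfolding monoid_algebra_simps(2) using a by (subst monoid_algebra_mult[of "{\<one>\<^bsub>M\<^esub>}" _ "{y. a y \<noteq> 0}"]) (auto simp: basis_elt_def)
      also have "\<dots> = (\<Sum>y\<in>{y. a y \<noteq> 0}. if y = z then a y else 0)"
        using a by (auto simp: basis_elt_def subset_iff intro!: sum.cong)
      also have "\<dots> = a z" using a by simp
      finally show "(\<one>\<^bsub>?R\<^esub> \<otimes>\<^bsub>?R\<^esub> a) z = a z" .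
    qed
    show "a \<otimes>\<^bsub>?R\<^esub> \<one>\<^bsub>?R\<^esub> = a"
    proof
      fix z
      have "(a \<otimes>\<^bsub>?R\<^esub> \<one>\<^bsub>?R\<^esub>) z = (\<Sum>y\<in>{y. a y \<noteq> 0}. \<Sum>x\<in>{\<one>\<^bsub>M\<^esub>}. if y \<otimes>\<^bsub>M\<^esub> x = z then a y * basis_elt \<one>\<^bsub>M\<^esub> x else 0)"
        unfolding monoid_algebra_simps(2) using a by (subst monoid_algebra_mult[of "{y. a y \<noteq> 0}" _ "{\<one>\<^bsub>M\<^esub>}"]) (auto simp: basis_elt_def)
      also have "\<dots> = (\<Sum>y\<in>{y. a y \<noteq> 0}. if y = z then a y else 0)"
        using a by (auto simp: basis_elt_def subset_iff intro!: sum.cong)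
      also have "\<dots> = a z" using a by simp
      finally show "(a \<otimes>\<^bsub>?R\<^esub> \<one>\<^bsub>?R\<^esub>) z = a z" .
    qed
  qed (rule mult monoid_algebra_assoc[OF assms]; assumption)+
  have distr: "{x. (a \<oplus>\<^bsub>?R\<^esub> b) x \<noteq> 0} \<subseteq> {x. a x \<noteq> 0} \<union> {x. b x \<noteq> 0}" for a b by auto
  fix a b c assume abc: "a \<in> carrier ?R" "b \<in> carrier ?R" "c \<in> carrier ?R"
  show "(a \<oplus>\<^bsub>?R\<^esub> b) \<otimes>\<^bsub>?R\<^esub> c = a \<otimes>\<^bsub>?R\<^esub> c \<oplus>\<^bsub>?R\<^esub> b \<otimes>\<^bsub>?R\<^esub> c"
  proof
    fix z
    note eq = monoid_algebra_mult[of "{x. a x \<noteq> 0} \<union> {x. b x \<noteq> 0}" _ "{x. c x \<noteq> 0}" c M z]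
    show "((a \<oplus>\<^bsub>?R\<^esub> b) \<otimes>\<^bsub>?R\<^esub> c) z = (a \<otimes>\<^bsub>?R\<^esub> c \<oplus>\<^bsub>?R\<^esub> b \<otimes>\<^bsub>?R\<^esub> c) z"
      unfolding monoid_algebra_simps(4)[of M "a \<otimes>\<^bsub>?R\<^esub> c"]
      using abc distr[of a b]
      by (subst (1 2 3) eq) (auto simp: distrib_right sum.distrib[symmetric] intro!: sum.cong)
  qed
  show "c \<otimes>\<^bsub>?R\<^esub> (a \<oplus>\<^bsub>?R\<^esub> b) = c \<otimes>\<^bsub>?R\<^esub> a \<oplus>\<^bsub>?R\<^esub> c \<otimes>\<^bsub>?R\<^esub> b"
  proof
    fix z
    note eq = monoid_algebra_mult[of "{x. c x \<noteq> 0}" c "{x. a x \<noteq> 0} \<union> {x. b x \<noteq> 0}" _ M z]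
    show "(c \<otimes>\<^bsub>?R\<^esub> (a \<oplus>\<^bsub>?R\<^esub> b)) z = (c \<otimes>\<^bsub>?R\<^esub> a \<oplus>\<^bsub>?R\<^esub> c \<otimes>\<^bsub>?R\<^esub> b) z"
      unfolding monoid_algebra_simps(4)[of M "c \<otimes>\<^bsub>?R\<^esub> a"]
      using abc distr[of a b]
      by (subst (1 2 3) eq) (auto simp: distrib_left sum.distrib[symmetric] intro!: sum.cong)
  qed
qed

section \<open>The antisymmetrizer\<close>

lemma monoid_algebra_smult_right:
  assumes "a \<in> carrier (monoid_algebra M)" "b \<in> carrier (monoid_algebra M)"
  shows "a \<otimes>\<^bsub>monoid_algebra M\<^esub> (\<lambda>y. c * b y) = (\<lambda>z. c * (a \<otimes>\<^bsub>monoid_algebra M\<^esub> b) z)"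
proof
  fix z
  have "(a \<otimes>\<^bsub>monoid_algebra M\<^esub> (\<lambda>y. c * b y)) z =
      (\<Sum>x\<in>{x. a x \<noteq> 0}. \<Sum>y\<in>{y. b y \<noteq> 0}. if x \<otimes>\<^bsub>M\<^esub> y = z then a x * (c * b y) else 0)"
    by (rule monoid_algebra_mult) (use assms in auto)
  also have "\<dots> = c * (\<Sum>x\<in>{x. a x \<noteq> 0}. \<Sum>y\<in>{y. b y \<noteq> 0}. if x \<otimes>\<^bsub>M\<^esub> y = z then a x * b y else 0)"
    unfolding sum_distrib_left by (intro sum.cong refl) auto
  also have "\<dots> = c * (a \<otimes>\<^bsub>monoid_algebra M\<^esub> b) z"
    by (subst monoid_algebra_mult[where A = "{x. a x \<noteq> 0}" and B = "{y. b y \<noteq> 0}"]) (use assms in auto)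
  finally show "(a \<otimes>\<^bsub>monoid_algebra M\<^esub> (\<lambda>y. c * b y)) z = c * (a \<otimes>\<^bsub>monoid_algebra M\<^esub> b) z" .
qed

text \<open>The convolution refers to the product of \<open>M\<close> but not to its carrier, so it
  is the same operation on functions. Products in the group algebra can thus be computed in the
  monoid algebra.\<close>

lemma monoid_algebra_units_of_mult:
  "a \<otimes>\<^bsub>monoid_algebra (units_of M)\<^esub> b = a \<otimes>\<^bsub>monoid_algebra M\<^esub> b"
  by (simp add: monoid_algebra_def units_of_mult)

lemma carrier_units_algebra_subset:
  "carrier (monoid_algebra (units_of M)) \<subseteq> carrier (monoid_algebra M)"
  by (auto simp: units_of_carrier Units_def)

text \<open>The character \<open>\<chi>\<close> of the overview: the sign on units, zero on all
  other matchings, extended linearly.\<close>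

definition sign_char :: "nat \<Rightarrow> (vertex set set \<Rightarrow> complex) \<Rightarrow> complex" where
  "sign_char m a = (\<Sum>p | p permutes {1..m}. a (perm_matching m p) * of_int (sign p))"

lemma finite_perfect_matchings [simp]: "finite (perfect_matchings m)"
proof (rule finite_subset)
  show "perfect_matchings m \<subseteq> Pow (Pow (vertices m))"
    by (auto simp: perfect_matchings_def partition_on_def)
qed simp

declare finite_permutations [simp]

lemma sign_perm_comp:
  fixes p q :: "nat \<Rightarrow> nat"
  assumes "p permutes {1..m}" "q permutes {1..m}"
  shows "sign (p \<circ> q) = sign p * sign q"
  by (rule sign_compose) (use assms permutation_permutes in blast)+

lemma antisymmetrizer_eq:
  "antisymmetrizer m z =
    (\<Sum>p | p permutes {1..m}. if perm_matching m p = z then of_int (sign p) / fact m else 0)"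
  unfolding antisymmetrizer_def sum_distrib_left
  by (intro sum.cong) (auto simp: sym_group_def basis_elt_def)

lemma antisymmetrizer_perm_matching:
  assumes "p permutes {1..m}"
  shows "antisymmetrizer m (perm_matching m p) = of_int (sign p) / fact m"
proof -
  have "antisymmetrizer m (perm_matching m p) =
      (\<Sum>q | q permutes {1..m}. if q = p then of_int (sign q) / fact m else 0)"
    unfolding antisymmetrizer_eq using assms inj_onD[OF inj_perm_matching]
    by (intro sum.cong) auto
  then show ?thesis using assms by simp
qed

lemma antisymmetrizer_support:
  "{x. antisymmetrizer m x \<noteq> 0} \<subseteq> perm_matching m ` {p. p permutes {1..m}}"
proof
  fix x assume "x \<in> {x. antisymmetrizer m x \<noteq> 0}"
  then have "(\<Sum>p | p permutes {1..m}. if perm_matching m p = x then of_int (sign p) / fact m else 0) \<noteq> (0::complex)"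
    by (simp add: antisymmetrizer_eq)
  then obtain p where "p \<in> {p. p permutes {1..m}}"
    "(if perm_matching m p = x then of_int (sign p) / fact m else 0) \<noteq> (0::complex)"
    by (rule sum.not_neutral_contains_not_neutral)
  then show "x \<in> perm_matching m ` {p. p permutes {1..m}}" by (auto split: if_splits)
qed

lemma antisymmetrizer_closed_units:
  "antisymmetrizer m \<in> carrier (monoid_algebra (units_of (brauer_monoid m)))"
  using antisymmetrizer_support[of m] finite_subset[OF antisymmetrizer_support[of m]]
  by (simp add: units_of_carrier Units_brauer_monoid)

lemma antisymmetrizer_closed: "antisymmetrizer m \<in> carrier (monoid_algebra (brauer_monoid m))"
  using antisymmetrizer_closed_units carrier_units_algebra_subset by blast

lemma sign_char_antisymmetrizer: "sign_char m (antisymmetrizer m) = 1"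
proof -
  have "sign_char m (antisymmetrizer m) = (\<Sum>p | p permutes {1..m::nat}. 1 / fact m)"
    unfolding sign_char_def
    by (intro sum.cong refl) (simp add: antisymmetrizer_perm_matching sign_idempotent flip: of_int_mult)
  also have "\<dots> = 1" using card_permutations[of "{1..m}" m] by simp
  finally show ?thesis .
qed

text \<open>The inner sum is the value of the character at the single matching \<open>x\<close>. In
  this form it can be compared term by term with the expansion of \<open>a\<close> over all
  matchings.\<close>

lemma sign_char_eq_sum:
  assumes "a \<in> carrier (monoid_algebra (brauer_monoid m))"
  shows "sign_char m a = (\<Sum>x\<in>perfect_matchings m.
    a x * (\<Sum>p | p permutes {1..m}. if perm_matching m p = x then of_int (sign p) else 0))"
proof -
  have "(\<Sum>x\<in>perfect_matchings m. a x * (\<Sum>p | p permutes {1..m}. if perm_matching m p = x then of_int (sign p) else 0)) =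
      (\<Sum>x\<in>perfect_matchings m. \<Sum>p | p permutes {1..m}. if perm_matching m p = x then a x * of_int (sign p) else 0)"
    unfolding sum_distrib_left by (intro sum.cong refl) auto
  also have "\<dots> = (\<Sum>p | p permutes {1..m}. \<Sum>x\<in>perfect_matchings m. if perm_matching m p = x then a x * of_int (sign p) else 0)"
    by (rule sum.swap)
  also have "\<dots> = sign_char m a"
    unfolding sign_char_def by (intro sum.cong refl) (auto simp: perm_matching_closed)
  finally show ?thesis ..
qed

text \<open>The coefficient at \<open>z\<close> of \<open>x e = \<chi>(x) e\<close>, for a single
  matching \<open>x\<close>. If \<open>x\<close> comes from a permutation \<open>q\<close>,
  reindexing by \<open>p \<mapsto> q \<circ> p\<close> produces the sign of \<open>q\<close>.
  Otherwise \<open>x\<close> absorbs the transposition \<open>t\<close> of a bottom block, and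
  reindexing by \<open>p \<mapsto> t \<circ> p\<close> shows that the sum equals its
  negative.\<close>

lemma sum_sign_mult_left:
  assumes x: "x \<in> perfect_matchings m"
  shows "(\<Sum>p | p permutes {1..m}. if brauer_mult m x (perm_matching m p) = z then of_int (sign p) / fact m else 0) =
    (\<Sum>p | p permutes {1..m}. if perm_matching m p = x then of_int (sign p) else 0) * antisymmetrizer m z"
    (is "?S = ?c * _")
  using x
proof (cases rule: matching_cases)
  case (perm q)
  have c: "?c = of_int (sign q)"
  proof -
    have "?c = (\<Sum>p | p permutes {1..m}. if p = q then of_int (sign p) else 0)"
      using perm inj_onD[OF inj_perm_matching] by (intro sum.cong) auto
    then show ?thesis using perm by simp
  qed
  have "of_int (sign q) * antisymmetrizer m z =
      (\<Sum>p | p permutes {1..m}. of_int (sign q) * (if perm_matching m (q \<circ> p) = z then of_int (sign (q \<circ> p)) / fact m else 0))"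
    unfolding antisymmetrizer_eq sum_distrib_left by (rule setum_permutations_compose_left[OF perm(1)])
  also have "\<dots> = ?S"
    using perm by (intro sum.cong refl)
      (auto simp: perm_matching_comp sign_perm_comp sign_idempotent simp flip: of_int_mult mult.assoc)
  finally show ?thesis using c by simp
next
  case (nonperm i j k l)
  let ?t = "transpose k l"
  have t: "?t permutes {1..m}" by (intro permutes_swap_id nonperm)
  have "?S = (\<Sum>p | p permutes {1..m}. if brauer_mult m x (perm_matching m (?t \<circ> p)) = z
      then of_int (sign (?t \<circ> p)) / fact m else 0)"
    by (rule setum_permutations_compose_left[OF t])
  also have "\<dots> = (\<Sum>p | p permutes {1..m}. - (if brauer_mult m x (perm_matching m p) = z then of_int (sign p) / fact m else 0))"
  proof (intro sum.cong refl)
    fix p assume "p \<in> {p. p permutes {1..m}}"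
    then have p: "p permutes {1..m}" by simp
    have "brauer_mult m x (perm_matching m (?t \<circ> p)) = brauer_mult m (brauer_mult m x (perm_matching m ?t)) (perm_matching m p)"
      unfolding perm_matching_comp[OF t p, symmetric]
      by (rule brauer_mult_assoc[symmetric]) (intro perfect_matchingsD(2) x perm_matching_closed t p)+
    also have "\<dots> = brauer_mult m x (perm_matching m p)"
      using brauer_mult_swap(2)[OF x nonperm(5,6,8)] by simp
    finally show "(if brauer_mult m x (perm_matching m (?t \<circ> p)) = z then of_int (sign (?t \<circ> p)) / fact m else 0) =
        - (if brauer_mult m x (perm_matching m p) = z then of_int (sign p) / fact m else (0::complex))"
      using sign_perm_comp[OF t p] nonperm(7) by (simp add: sign_swap_id)
  qed
  finally have "?S = 0" by (simp add: sum_negf)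
  moreover have "?c = 0"
  proof (intro sum.neutral ballI)
    fix p assume "p \<in> {p. p permutes {1..m}}"
    have "\<not> {Bot k, Bot l} \<in> perm_matching m p" by (auto simp: perm_matching_def doubleton_eq_iff)
    then show "(if perm_matching m p = x then of_int (sign p) else 0) = (0::complex)" using nonperm(8) by auto
  qed
  ultimately show ?thesis by simp
qed

text \<open>The mirror image, for \<open>e x\<close>: the transposition now belongs to a top block
  and is absorbed from the left, so the reindexing is
  \<open>p \<mapsto> p \<circ> t\<close>.\<close>

lemma sum_sign_mult_right:
  assumes x: "x \<in> perfect_matchings m"
  shows "(\<Sum>p | p permutes {1..m}. if brauer_mult m (perm_matching m p) x = z then of_int (sign p) / fact m else 0) =
    (\<Sum>p | p permutes {1..m}. if perm_matching m p = x then of_int (sign p) else 0) * antisymmetrizer m z"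
    (is "?S = ?c * _")
  using x
proof (cases rule: matching_cases)
  case (perm q)
  have c: "?c = of_int (sign q)"
  proof -
    have "?c = (\<Sum>p | p permutes {1..m}. if p = q then of_int (sign p) else 0)"
      using perm inj_onD[OF inj_perm_matching] by (intro sum.cong) auto
    then show ?thesis using perm by simp
  qed
  have "of_int (sign q) * antisymmetrizer m z =
      (\<Sum>p | p permutes {1..m}. of_int (sign q) * (if perm_matching m (p \<circ> q) = z then of_int (sign (p \<circ> q)) / fact m else 0))"
    unfolding antisymmetrizer_eq sum_distrib_left by (rule sum_permutations_compose_right[OF perm(1)])
  also have "\<dots> = ?S"
    using perm by (intro sum.cong refl)
      (auto simp: perm_matching_comp sign_perm_comp sign_idempotent mult.left_commute[of "of_int (sign q)"] simp flip: of_int_mult)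
  finally show ?thesis using c by simp
next
  case (nonperm i j k l)
  let ?t = "transpose i j"
  have t: "?t permutes {1..m}" by (intro permutes_swap_id nonperm)
  have "?S = (\<Sum>p | p permutes {1..m}. if brauer_mult m (perm_matching m (p \<circ> ?t)) x = z
      then of_int (sign (p \<circ> ?t)) / fact m else 0)"
    by (rule sum_permutations_compose_right[OF t])
  also have "\<dots> = (\<Sum>p | p permutes {1..m}. - (if brauer_mult m (perm_matching m p) x = z then of_int (sign p) / fact m else 0))"
  proof (intro sum.cong refl)
    fix p assume "p \<in> {p. p permutes {1..m}}"
    then have p: "p permutes {1..m}" by simp
    have "brauer_mult m (perm_matching m (p \<circ> ?t)) x = brauer_mult m (perm_matching m p) (brauer_mult m (perm_matching m ?t) x)"
      unfolding perm_matching_comp[OF p t, symmetric]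
      by (rule brauer_mult_assoc) (intro perfect_matchingsD(2) x perm_matching_closed t p)+
    also have "\<dots> = brauer_mult m (perm_matching m p) x"
      using brauer_mult_swap(1)[OF x nonperm(1,2,4)] by simp
    finally show "(if brauer_mult m (perm_matching m (p \<circ> ?t)) x = z then of_int (sign (p \<circ> ?t)) / fact m else 0) =
        - (if brauer_mult m (perm_matching m p) x = z then of_int (sign p) / fact m else (0::complex))"
      using sign_perm_comp[OF p t] nonperm(3) by (simp add: sign_swap_id)
  qed
  finally have "?S = 0" by (simp add: sum_negf)
  moreover have "?c = 0"
  proof (intro sum.neutral ballI)
    fix p assume "p \<in> {p. p permutes {1..m}}"
    have "\<not> {Bot k, Bot l} \<in> perm_matching m p" by (auto simp: perm_matching_def doubleton_eq_iff)
    then show "(if perm_matching m p = x then of_int (sign p) else 0) = (0::complex)" using nonperm(8) by auto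
  qed
  ultimately show ?thesis by simp
qed

text \<open>Linear extension of the two preceding sums. The agreement of both sides is centrality of
  the antisymmetrizer.\<close>

lemma mult_antisymmetrizer:
  assumes a: "a \<in> carrier (monoid_algebra (brauer_monoid m))"
  shows "a \<otimes>\<^bsub>monoid_algebra (brauer_monoid m)\<^esub> antisymmetrizer m = (\<lambda>z. sign_char m a * antisymmetrizer m z)"
    and "antisymmetrizer m \<otimes>\<^bsub>monoid_algebra (brauer_monoid m)\<^esub> a = (\<lambda>z. sign_char m a * antisymmetrizer m z)"
proof -
  let ?S = "{p. p permutes {1..m}}"
  have suppa: "{x. a x \<noteq> 0} \<subseteq> perfect_matchings m" using a by simp
  have suppe: "finite (perm_matching m ` ?S)" by simp
  show "a \<otimes>\<^bsub>monoid_algebra (brauer_monoid m)\<^esub> antisymmetrizer m = (\<lambda>z. sign_char m a * antisymmetrizer m z)"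
  proof
    fix z
    have "(a \<otimes>\<^bsub>monoid_algebra (brauer_monoid m)\<^esub> antisymmetrizer m) z =
      (\<Sum>x\<in>perfect_matchings m. \<Sum>y\<in>perm_matching m ` ?S. if brauer_mult m x y = z then a x * antisymmetrizer m y else 0)"
      by (subst monoid_algebra_mult[OF finite_perfect_matchings suppa suppe antisymmetrizer_support]) simp
    also have "\<dots> = (\<Sum>x\<in>perfect_matchings m. a x *
        (\<Sum>p\<in>?S. if brauer_mult m x (perm_matching m p) = z then of_int (sign p) / fact m else 0))"
      unfolding sum_distrib_left sum.reindex[OF inj_perm_matching]
      by (intro sum.cong refl) (auto simp: antisymmetrizer_perm_matching)
    also have "\<dots> = sign_char m a * antisymmetrizer m z"
      unfolding sign_char_eq_sum[OF a] sum_distrib_right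
      by (intro sum.cong refl) (simp only: sum_sign_mult_left mult.assoc)
    finally show "(a \<otimes>\<^bsub>monoid_algebra (brauer_monoid m)\<^esub> antisymmetrizer m) z = sign_char m a * antisymmetrizer m z" .
  qed
  show "antisymmetrizer m \<otimes>\<^bsub>monoid_algebra (brauer_monoid m)\<^esub> a = (\<lambda>z. sign_char m a * antisymmetrizer m z)"
  proof
    fix z
    have "(antisymmetrizer m \<otimes>\<^bsub>monoid_algebra (brauer_monoid m)\<^esub> a) z =
      (\<Sum>y\<in>perm_matching m ` ?S. \<Sum>x\<in>perfect_matchings m. if brauer_mult m y x = z then antisymmetrizer m y * a x else 0)"
      by (subst monoid_algebra_mult[OF suppe antisymmetrizer_support finite_perfect_matchings suppa]) simp
    also have "\<dots> = (\<Sum>x\<in>perfect_matchings m. \<Sum>y\<in>perm_matching m ` ?S. if brauer_mult m y x = z then antisymmetrizer m y * a x else 0)"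
      by (rule sum.swap)
    also have "\<dots> = (\<Sum>x\<in>perfect_matchings m. a x *
        (\<Sum>p\<in>?S. if brauer_mult m (perm_matching m p) x = z then of_int (sign p) / fact m else 0))"
      unfolding sum_distrib_left sum.reindex[OF inj_perm_matching]
      by (intro sum.cong refl) (auto simp: antisymmetrizer_perm_matching)
    also have "\<dots> = sign_char m a * antisymmetrizer m z"
      unfolding sign_char_eq_sum[OF a] sum_distrib_right
      by (intro sum.cong refl) (simp only: sum_sign_mult_right mult.assoc)
    finally show "(antisymmetrizer m \<otimes>\<^bsub>monoid_algebra (brauer_monoid m)\<^esub> a) z = sign_char m a * antisymmetrizer m z" .
  qed
qed

section \<open>The line spanned by the antisymmetrizer, as a module\<close>

lemma left_module_cong:
  assumes I: "left_module R I" and carrier: "carrier J = carrier I" and zero: "\<zero>\<^bsub>J\<^esub> = \<zero>\<^bsub>I\<^esub>"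
    and add: "\<And>x y. \<lbrakk>x \<in> carrier I; y \<in> carrier I\<rbrakk> \<Longrightarrow> x \<oplus>\<^bsub>J\<^esub> y = x \<oplus>\<^bsub>I\<^esub> y"
    and smult: "\<And>r x. \<lbrakk>r \<in> carrier R; x \<in> carrier I\<rbrakk> \<Longrightarrow> r \<odot>\<^bsub>J\<^esub> x = r \<odot>\<^bsub>I\<^esub> x"
  shows "left_module R J"
proof -
  interpret I: left_module R I by fact
  have "abelian_group J"
  proof (rule abelian_groupI)
    fix x assume "x \<in> carrier J"
    then show "\<exists>y\<in>carrier J. y \<oplus>\<^bsub>J\<^esub> x = \<zero>\<^bsub>J\<^esub>"
      by (intro bexI[of _ "\<ominus>\<^bsub>I\<^esub> x"]) (simp_all add: carrier zero add I.l_neg)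
  qed (simp_all add: carrier zero add I.M.a_ac)
  then show ?thesis
    using I.R.ring_axioms
    by (simp add: left_module_def left_module_axioms_def carrier add smult
        I.smult_l_distr I.smult_r_distr I.smult_assoc1)
qed

text \<open>Injectivity depends only on the operations on the carrier, since homomorphisms into
  \<open>I\<close> and \<open>J\<close> are then the same functions. It is used for an induced
  module and an ideal that are different records but agree on their common carrier.\<close>

lemma injective_module_cong:
  assumes I: "injective_module R I" and carrier: "carrier J = carrier I" and zero: "\<zero>\<^bsub>J\<^esub> = \<zero>\<^bsub>I\<^esub>"
    and add: "\<And>x y. \<lbrakk>x \<in> carrier I; y \<in> carrier I\<rbrakk> \<Longrightarrow> x \<oplus>\<^bsub>J\<^esub> y = x \<oplus>\<^bsub>I\<^esub> y"
    and smult: "\<And>r x. \<lbrakk>r \<in> carrier R; x \<in> carrier I\<rbrakk> \<Longrightarrow> r \<odot>\<^bsub>J\<^esub> x = r \<odot>\<^bsub>I\<^esub> x"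
  shows "injective_module R J"
proof -
  have hom: "left_module_hom R A J = left_module_hom R A I" for A :: "('a, 'd) module"
  proof -
    have "h \<in> left_module_hom R A J \<longleftrightarrow> h \<in> left_module_hom R A I" for h
    proof (cases "h \<in> carrier A \<rightarrow> carrier I")
      case True
      then show ?thesis
        using add smult by (auto simp: left_module_hom_def carrier Pi_iff)
    qed (simp add: left_module_hom_def carrier)
    then show ?thesis by blast
  qed
  have "left_module R J"
    using I by (intro left_module_cong[of R I J]) (simp_all add: injective_module_def carrier zero add smult)
  then show ?thesis
    using I unfolding injective_module_def hom by blast
qed

lemma monoid_units_of_brauer: "monoid (units_of (brauer_monoid m))"
  using monoid.units_group[OF monoid_brauer_monoid] by (rule group.is_monoid)

text \<open>The character has value 1 at the antisymmetrizer, so it reads off the coordinate on the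
  line that the latter spans.\<close>

lemma sign_char_scaled: "sign_char m (\<lambda>z. c * antisymmetrizer m z) = c"
  using sign_char_antisymmetrizer[of m] by (simp add: sign_char_def mult.assoc flip: sum_distrib_left)

text \<open>Both algebras give the same line, which is why inducing the ideal of the group algebra
  can give back the ideal of the monoid algebra.\<close>

lemma antisymmetrizer_block_carrier:
  assumes "R = monoid_algebra (brauer_monoid m) \<or> R = monoid_algebra (units_of (brauer_monoid m))"
  shows "carrier (principal_left_ideal R (antisymmetrizer m)) = {(\<lambda>z. c * antisymmetrizer m z) |c. True}"
proof -
  have R: "carrier R \<subseteq> carrier (monoid_algebra (brauer_monoid m))"
    "r \<otimes>\<^bsub>R\<^esub> a = r \<otimes>\<^bsub>monoid_algebra (brauer_monoid m)\<^esub> a" "antisymmetrizer m \<in> carrier R" for r a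
    using assms carrier_units_algebra_subset antisymmetrizer_closed antisymmetrizer_closed_units
    by (auto simp only: monoid_algebra_units_of_mult)
  show ?thesis
  proof (intro subset_antisym subsetI)
    fix x assume "x \<in> carrier (principal_left_ideal R (antisymmetrizer m))"
    then show "x \<in> {(\<lambda>z. c * antisymmetrizer m z) |c. True}"
      unfolding principal_left_ideal_simps R(2) using mult_antisymmetrizer(1) R(1) by blast
  next
    fix x assume "x \<in> {(\<lambda>z. c * antisymmetrizer m z) |c. True}"
    then obtain c where x: "x = (\<lambda>z. c * antisymmetrizer m z)" by blast
    have "x \<in> carrier R"
      using assms antisymmetrizer_closed[of m] antisymmetrizer_closed_units[of m]
      by (auto simp: x elim: finite_subset[rotated])
    moreover have "sign_char m x = c" by (simp add: x sign_char_scaled)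
    ultimately have "x = x \<otimes>\<^bsub>R\<^esub> antisymmetrizer m"
      using mult_antisymmetrizer(1)[of x m] R(1) unfolding R(2) by (auto simp: x)
    then show "x \<in> carrier (principal_left_ideal R (antisymmetrizer m))"
      unfolding principal_left_ideal_simps using \<open>x \<in> carrier R\<close> by blast
  qed
qed

lemma antisymmetrizer_nonzero: "antisymmetrizer m \<noteq> (\<lambda>_. 0)"
  using antisymmetrizer_perm_matching[OF permutes_id, of m]
  by (metis div_0 divide_eq_0_iff fact_nonzero of_int_1 sign_id zero_neq_one)

lemma division_idempotent_antisymmetrizer:
  assumes R: "R = monoid_algebra (brauer_monoid m) \<or> R = monoid_algebra (units_of (brauer_monoid m))"
  shows "division_idempotent R (antisymmetrizer m)"
proof -
  let ?e = "antisymmetrizer m" and ?A = "monoid_algebra (brauer_monoid m) :: (vertex set set \<Rightarrow> complex) ring"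
  have RA: "carrier R \<subseteq> carrier ?A" "r \<otimes>\<^bsub>R\<^esub> a = r \<otimes>\<^bsub>?A\<^esub> a" "?e \<in> carrier R" "\<zero>\<^bsub>R\<^esub> = (\<lambda>_. 0)" for r a
    using R carrier_units_algebra_subset antisymmetrizer_closed antisymmetrizer_closed_units
    by (auto simp only: monoid_algebra_units_of_mult monoid_algebra_simps(3))
  have ring: "ring R"
    using R ring_monoid_algebra monoid_brauer_monoid monoid_units_of_brauer by blast
  have e: "?e \<in> carrier ?A" using RA by blast
  have idem: "?e \<otimes>\<^bsub>?A\<^esub> ?e = ?e" using mult_antisymmetrizer(1)[OF e] by (simp add: sign_char_antisymmetrizer)
  show ?thesis
    unfolding division_idempotent_def division_idempotent_axioms_def RA(2,4)
  proof (intro conjI allI impI)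
    fix r assume r: "r \<in> carrier R"
    then have rA: "r \<in> carrier ?A" using RA(1) by blast
    show "r \<otimes>\<^bsub>?A\<^esub> ?e = ?e \<otimes>\<^bsub>?A\<^esub> r" using mult_antisymmetrizer[OF rA] by simp
    assume "r \<otimes>\<^bsub>?A\<^esub> ?e \<noteq> (\<lambda>_. 0)"
    then have c: "sign_char m r \<noteq> 0" unfolding mult_antisymmetrizer(1)[OF rA] by auto
    \<comment> \<open>Since \<open>s (r e) = \<chi>(s) \<chi>(r) e\<close>, the scalar
      \<open>\<chi>(s)\<close> has to be the inverse of \<open>\<chi>(r)\<close>.\<close>
    let ?s = "\<lambda>z. inverse (sign_char m r) * ?e z"
    have s: "?s \<in> carrier R"
      using R antisymmetrizer_closed[of m] antisymmetrizer_closed_units[of m] c by auto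
    then have sA: "?s \<in> carrier ?A" using RA(1) by blast
    have "?s \<otimes>\<^bsub>?A\<^esub> (r \<otimes>\<^bsub>?A\<^esub> ?e) = ?e"
      unfolding mult_antisymmetrizer(1)[OF rA] monoid_algebra_smult_right[OF sA e]
        mult_antisymmetrizer(1)[OF sA] sign_char_scaled mult.assoc[symmetric]
      using c by simp
    then show "\<exists>s\<in>carrier R. s \<otimes>\<^bsub>?A\<^esub> (r \<otimes>\<^bsub>?A\<^esub> ?e) = ?e" using s by blast
  qed (use ring RA(3) idem antisymmetrizer_nonzero in auto)
qed

text \<open>Compare the coefficients of \<open>e\<close> in \<open>(a b) e = a (b e)\<close>:
  associativity of the algebra makes the character multiplicative.\<close>

lemma sign_char_mult:
  assumes "a \<in> carrier (monoid_algebra (brauer_monoid m))" "b \<in> carrier (monoid_algebra (brauer_monoid m))"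
  shows "sign_char m (a \<otimes>\<^bsub>monoid_algebra (brauer_monoid m)\<^esub> b) = sign_char m a * sign_char m b"
proof -
  let ?A = "monoid_algebra (brauer_monoid m) :: (vertex set set \<Rightarrow> complex) ring" and ?e = "antisymmetrizer m"
  interpret ring ?A by (intro ring_monoid_algebra monoid_brauer_monoid)
  have ab: "a \<otimes>\<^bsub>?A\<^esub> b \<in> carrier ?A" using assms by (rule m_closed)
  have "(\<lambda>z. sign_char m (a \<otimes>\<^bsub>?A\<^esub> b) * ?e z) = a \<otimes>\<^bsub>?A\<^esub> (b \<otimes>\<^bsub>?A\<^esub> ?e)"
    unfolding mult_antisymmetrizer(1)[OF ab, symmetric] by (rule m_assoc[OF assms antisymmetrizer_closed])
  also have "\<dots> = (\<lambda>z. sign_char m a * sign_char m b * ?e z)"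
    unfolding mult_antisymmetrizer(1)[OF assms(2)] monoid_algebra_smult_right[OF assms(1) antisymmetrizer_closed]
      mult_antisymmetrizer(1)[OF assms(1)] by (simp add: ac_simps)
  finally have "sign_char m (\<lambda>z. sign_char m (a \<otimes>\<^bsub>?A\<^esub> b) * ?e z) = sign_char m (\<lambda>z. sign_char m a * sign_char m b * ?e z)"
    by simp
  then show ?thesis unfolding sign_char_scaled .
qed

lemma sign_char_one: "sign_char m (basis_elt (perm_matching m id)) = 1"
proof -
  have "sign_char m (basis_elt (perm_matching m id)) = (\<Sum>p | p permutes {1..m}. if p = id then of_int (sign p) else 0)"
    unfolding sign_char_def basis_elt_def using inj_onD[OF inj_perm_matching] permutes_id
    by (intro sum.cong) auto
  also have "\<dots> = 1" by (simp add: permutes_id)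
  finally show ?thesis .
qed

text \<open>The character evaluates its argument at units only, so the truncation to units in
  \<open>Ind\<close> leaves the scalar unchanged.\<close>

lemma Ind_sign_module_simps:
  "carrier (Ind (brauer_monoid m) (sign_module m)) = UNIV"
  "\<zero>\<^bsub>Ind (brauer_monoid m) (sign_module m)\<^esub> = 0"
  "w \<oplus>\<^bsub>Ind (brauer_monoid m) (sign_module m)\<^esub> z = w + z"
  "a \<odot>\<^bsub>Ind (brauer_monoid m) (sign_module m)\<^esub> z = sign_char m a * z"
proof -
  have "(\<Sum>p | p permutes {1..m}. (if perm_matching m p \<in> Units (brauer_monoid m) then a (perm_matching m p) else 0) * of_int (sign p)) =
      sign_char m a"
    unfolding sign_char_def by (intro sum.cong) (auto simp: Units_brauer_monoid)
  then show "a \<odot>\<^bsub>Ind (brauer_monoid m) (sign_module m)\<^esub> z = sign_char m a * z"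
    by (simp add: Ind_def sign_module_def sym_group_def)
qed (simp_all add: Ind_def sign_module_def)

lemma left_module_Ind_sign_module:
  "left_module (monoid_algebra (brauer_monoid m)) (Ind (brauer_monoid m) (sign_module m))"
proof -
  let ?I = "Ind (brauer_monoid m) (sign_module m)"
  have "abelian_group ?I"
  proof (rule abelian_groupI)
    show "\<exists>y\<in>carrier ?I. y \<oplus>\<^bsub>?I\<^esub> x = \<zero>\<^bsub>?I\<^esub>" for x
      by (intro bexI[of _ "- x"]) (simp_all add: Ind_sign_module_simps)
  qed (simp_all add: Ind_sign_module_simps ac_simps)
  moreover have "sign_char m (\<lambda>x. a x + b x) = sign_char m a + sign_char m b" for a b
    by (simp add: sign_char_def distrib_right sum.distrib)
  ultimately show ?thesis
    using ring_monoid_algebra[OF monoid_brauer_monoid, of m]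
    by (simp del: monoid_algebra_simps(1) add: left_module_def left_module_axioms_def Ind_sign_module_simps
        sign_char_mult sign_char_one algebra_simps)
qed

theorem proposition3p2p3:
  fixes m :: nat
  assumes "m \<ge> 1"
  shows "left_module_isomorphic (monoid_algebra (brauer_monoid m))
           (principal_left_ideal (monoid_algebra (brauer_monoid m)) (antisymmetrizer m))
           (Ind (brauer_monoid m) (sign_module m)) \<and>
         group_injective TYPE(complex) (brauer_monoid m)"
proof
  let ?M = "brauer_monoid m" and ?e = "antisymmetrizer m"
  let ?A = "monoid_algebra ?M :: (vertex set set \<Rightarrow> complex) ring"
    and ?G = "monoid_algebra (units_of ?M) :: (vertex set set \<Rightarrow> complex) ring"
  interpret A: division_idempotent ?A ?e by (rule division_idempotent_antisymmetrizer) simp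
  interpret G: division_idempotent ?G ?e by (rule division_idempotent_antisymmetrizer) simp
  have carA: "carrier (principal_left_ideal ?A ?e) = {(\<lambda>z. c * ?e z) |c. True}"
    by (rule antisymmetrizer_block_carrier) simp
  have carG: "carrier (principal_left_ideal ?G ?e) = {(\<lambda>z. c * ?e z) |c. True}"
    by (rule antisymmetrizer_block_carrier) simp
  have subA: "x \<in> carrier ?A" if "x \<in> carrier (principal_left_ideal ?A ?e)" for x
    using A.block_elt(1)[OF that] .
  show "left_module_isomorphic ?A (principal_left_ideal ?A ?e) (Ind ?M (sign_module m))"
    unfolding left_module_isomorphic_def
  proof (intro conjI bexI[of _ "sign_char m"])
    show "left_module ?A (principal_left_ideal ?A ?e)"
      by (rule A.left_module_principal_left_ideal) (rule A.e_closed)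
    show "left_module ?A (Ind ?M (sign_module m))" by (rule left_module_Ind_sign_module)
    show "bij_betw (sign_char m) (carrier (principal_left_ideal ?A ?e)) (carrier (Ind ?M (sign_module m)))"
      unfolding carA Ind_sign_module_simps
      by (rule bij_betwI[where g = "\<lambda>c z. c * ?e z"]) (auto simp: sign_char_scaled)
    show "sign_char m \<in> left_module_hom ?A (principal_left_ideal ?A ?e) (Ind ?M (sign_module m))"
    proof (rule left_module_homI)
      fix r x assume "r \<in> carrier ?A" "x \<in> carrier (principal_left_ideal ?A ?e)"
      then show "sign_char m (r \<odot>\<^bsub>principal_left_ideal ?A ?e\<^esub> x) = r \<odot>\<^bsub>Ind ?M (sign_module m)\<^esub> sign_char m x"
        using subA by (simp only: principal_left_ideal_simps(4) Ind_sign_module_simps sign_char_mult)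
    qed (simp_all add: Ind_sign_module_simps sign_char_def distrib_right sum.distrib)
  qed
  have "injective_module ?A (Ind ?M (principal_left_ideal ?G ?e))"
  proof (rule injective_module_cong[OF A.injective_block])
    show "carrier (Ind ?M (principal_left_ideal ?G ?e)) = carrier (principal_left_ideal ?A ?e)"
      using carA carG by (simp add: Ind_def del: principal_left_ideal_simps(1))
    fix a x assume a: "a \<in> carrier ?A" and "x \<in> carrier (principal_left_ideal ?A ?e)"
    then obtain c where x: "x = (\<lambda>z. c * ?e z)" unfolding carA by blast
    let ?a = "\<lambda>y. if y \<in> Units ?M then a y else 0"
    have sub: "{y. ?a y \<noteq> 0} \<subseteq> {y. a y \<noteq> 0}" by auto
    then have a': "?a \<in> carrier ?A"
      using a finite_subset[OF sub] unfolding monoid_algebra_simps(1) mem_Collect_eq by blast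
    \<comment> \<open>An element acts on the line only through its character, and the character
      ignores coefficients at non-units. So the truncated action of \<open>Ind\<close> and the
      multiplication of the monoid algebra agree on the line.\<close>
    have "sign_char m ?a = sign_char m a"
      unfolding sign_char_def by (intro sum.cong) (auto simp: Units_brauer_monoid)
    then have "?a \<otimes>\<^bsub>?A\<^esub> x = a \<otimes>\<^bsub>?A\<^esub> x"
      unfolding x monoid_algebra_smult_right[OF a antisymmetrizer_closed]
        monoid_algebra_smult_right[OF a' antisymmetrizer_closed]
        mult_antisymmetrizer(1)[OF a] mult_antisymmetrizer(1)[OF a'] by simp
    then show "a \<odot>\<^bsub>Ind ?M (principal_left_ideal ?G ?e)\<^esub> x = a \<odot>\<^bsub>principal_left_ideal ?A ?e\<^esub> x"
      by (simp add: Ind_def monoid_algebra_units_of_mult)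
  qed (simp_all add: Ind_def)
  then show "group_injective TYPE(complex) ?M"
    unfolding group_injective_def
    using G.projective_principal_left_ideal[OF G.e_closed G.e_idem] G.indecomposable_block by blast
qed

end
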